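(* Let $G$ be a compact Lie group. The mapping which sends an object $(P,T)$ of $\mathrm{Orb}^{\mathrm{ab}}_{\mathcal{L}^2_G}$ to $\mathrm{Fr}(T)$ and a morphism $\phi:(P,T)\to(P',T')$ to $\gamma\mapsto\phi\circ\gamma$ defines a functor $$\mathrm{Fr}:\mathrm{Orb}^{\mathrm{ab}}_{\mathcal{L}^2_G}\longrightarrow\mathrm{CxMfd}^{\mathbb{C}^\times}.$$
   Context: $H\le K$ denotes a closed subgroup. $\mathcal{L}^2_G$ is the topologically enriched groupoid whose objects are smooth principal $G$-bundles $P\to\Sigma$ over a smooth genus 1 surface (2-dimensional torus) $\Sigma$ and whose morphisms are $G$-equivariant diffeomorphisms $P\to P'$ covering a diffeomorphism $\Sigma\to\Sigma'$, with the compact-open topology. A *frame* in $P$ is a continuous homomorphism $\gamma:\mathbb{C}\to\mathrm{Aut}(P)$ such that the induced $\mathbb{C}$-action on $\Sigma$ is transitive. $\mathrm{Orb}^{\mathrm{ab}}_{\mathcal{L}^2_G}$ has as objects pairs $(P,T)$ with $P\in\mathcal{L}^2_G$ and $T\le\mathrm{Aut}(P)$ compact abelian; a morphism $(P,T)\to(P',T')$ is a natural transformation $\mathrm{Map}_{\mathcal{L}^2_G}(P,-)/T\to\mathrm{Map}_{\mathcal{L}^2_G}(P',-)/T'$ of functors to topological spaces (quotients by precomposition). Equivalently, a morphism $\phi$ is a $T'$-orbit $[g]$ of a morphism $g:P'\to P$ with $g^{-1}Tg\le T'$; it induces a homomorphism, also denoted $\phi:T\to T'$, $t\mapsto g^{-1}tg$,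 independent of the representative. For $T$ compact abelian, $\mathrm{Hom}(\mathbb{C},T)$ (Lie group homomorphisms) is a complex vector space with pointwise addition and scalars $(\lambda\cdot\gamma)(z)=\gamma(\bar\lambda z)$. $\mathrm{Fr}(T)\subset\mathrm{Hom}(\mathbb{C},T)$ is the subspace of frames in $P$ with image in $T$, with the $\mathbb C^\times$-action and complex structure inherited from $\mathrm{Hom}(\mathbb{C},T)$. An $n$-dimensional $\mathbb{C}^\times$-equivariant complex manifold is a $\mathbb{C}^\times$-space with a maximal atlas of charts $\mathbb{C}^n\supset U\to M$ that are $\mathbb{C}^\times$-equivariant (scalar action on $\mathbb{C}^n$) with biholomorphic transition functions; $\mathrm{CxMfd}^{\mathbb{C}^\times}$ is the category of these, with $\mathbb{C}^\times$-equivariant holomorphic maps. *)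

theory Defs
  imports "HOL-Analysis.Analysis" "HOL-Algebra.Group"
begin

section \<open>Smooth manifolds\<close>

text \<open>
  \<open>Ck_on k S f\<close>: \<open>f\<close> is of class \<open>C^k\<close> on the open set \<open>S\<close>. For a finite-dimensional domain,
  continuity of all \<open>x \<mapsto> f'(x) v\<close> is continuity of \<open>f'\<close>.
\<close>

fun Ck_on :: "nat \<Rightarrow> 'a::real_normed_vector set \<Rightarrow> ('a \<Rightarrow> 'b::real_normed_vector) \<Rightarrow> bool" where
  "Ck_on 0 S f \<longleftrightarrow> continuous_on S f"
| "Ck_on (Suc k) S f \<longleftrightarrow>
     (\<forall>x\<in>S. f differentiable (at x)) \<and> (\<forall>v. Ck_on k S (\<lambda>x. frechet_derivative f (at x) v))"

definition smooth_on :: "'a::real_normed_vector set \<Rightarrow> ('a \<Rightarrow> 'b::real_normed_vector) \<Rightarrow> bool" where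
  "smooth_on S f \<longleftrightarrow> (\<forall>k. Ck_on k S f)"

text \<open>
  The model space is a finite-dimensional type \<open>'e\<close> of class \<open>real_normed_vector\<close> rather than
  \<open>euclidean_space\<close>, because the latter excludes dimension 0 and hence finite groups.
  A chart is a pair of its (open) domain in the manifold and a map that is \<open>undefined\<close> outside
  the domain, so that a maximal atlas is determined by any atlas contained in it.
\<close>

type_synonym ('a, 'e) chart = "'a set \<times> ('a \<Rightarrow> 'e)"

record ('a, 'e) smfd =
  mtop :: "'a topology"
  charts :: "('a, 'e) chart set"

definition is_chart :: "'a topology \<Rightarrow> ('a, 'e::real_normed_vector) chart \<Rightarrow> bool" where
  "is_chart X c \<longleftrightarrow> (case c of (U, \<phi>) \<Rightarrow>
     openin X U \<and> \<phi> \<in> extensional U \<and> open (\<phi> ` U) \<and>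
     homeomorphic_map (subtopology X U) (top_of_set (\<phi> ` U)) \<phi>)"

definition smooth_compatible ::
    "('a, 'e::real_normed_vector) chart \<Rightarrow> ('a, 'e) chart \<Rightarrow> bool" where
  "smooth_compatible c d \<longleftrightarrow> (case (c, d) of ((U, \<phi>), (V, \<psi>)) \<Rightarrow>
     smooth_on (\<phi> ` (U \<inter> V)) (\<psi> \<circ> the_inv_into U \<phi>) \<and>
     smooth_on (\<psi> ` (U \<inter> V)) (\<phi> \<circ> the_inv_into V \<psi>))"

definition smooth_manifold :: "('a, 'e::real_normed_vector) smfd \<Rightarrow> bool" where
  "smooth_manifold M \<longleftrightarrow>
     (\<exists>B::'e set. finite B \<and> span B = UNIV) \<and>
     Hausdorff_space (mtop M) \<and> second_countable (mtop M) \<and>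
     (\<forall>c\<in>charts M. is_chart (mtop M) c) \<and>
     \<Union> (fst ` charts M) = topspace (mtop M) \<and>
     (\<forall>c\<in>charts M. \<forall>d\<in>charts M. smooth_compatible c d) \<and>
     (\<forall>c. is_chart (mtop M) c \<and> (\<forall>d\<in>charts M. smooth_compatible c d) \<longrightarrow> c \<in> charts M)"

text \<open>
  The following two notions only depend on the maximal atlases generated by the charts, so they may
  be applied to the products, open submanifolds and the torus below, whose atlases are not maximal.
\<close>

definition smooth_map ::
    "('a, 'e::real_normed_vector) smfd \<Rightarrow> ('b, 'f::real_normed_vector) smfd \<Rightarrow> ('a \<Rightarrow> 'b) \<Rightarrow> bool" where
  "smooth_map M N f \<longleftrightarrow> continuous_map (mtop M) (mtop N) f \<and>
     (\<forall>(U, \<phi>)\<in>charts M. \<forall>(V, \<psi>)\<in>charts N.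
        smooth_on (\<phi> ` (U \<inter> f -` V)) (\<psi> \<circ> f \<circ> the_inv_into U \<phi>))"

definition diffeo ::
    "('a, 'e::real_normed_vector) smfd \<Rightarrow> ('b, 'f::real_normed_vector) smfd \<Rightarrow> ('a \<Rightarrow> 'b) \<Rightarrow> bool" where
  "diffeo M N f \<longleftrightarrow> smooth_map M N f \<and>
     (\<exists>g. smooth_map N M g \<and>
        (\<forall>x\<in>topspace (mtop M). g (f x) = x) \<and> (\<forall>y\<in>topspace (mtop N). f (g y) = y))"

definition prod_mfd :: "('a, 'e) smfd \<Rightarrow> ('b, 'f) smfd \<Rightarrow> ('a \<times> 'b, 'e \<times> 'f) smfd" where
  "prod_mfd M N = \<lparr>mtop = prod_topology (mtop M) (mtop N),
     charts = {(U \<times> V, restrict (map_prod \<phi> \<psi>) (U \<times> V)) | U \<phi> V \<psi>.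
                 (U, \<phi>) \<in> charts M \<and> (V, \<psi>) \<in> charts N}\<rparr>"

definition open_submfd :: "('a, 'e) smfd \<Rightarrow> 'a set \<Rightarrow> ('a, 'e) smfd" where
  "open_submfd M W = \<lparr>mtop = subtopology (mtop M) W,
     charts = {(U \<inter> W, restrict \<phi> (U \<inter> W)) | U \<phi>. (U, \<phi>) \<in> charts M}\<rparr>"

definition circle :: "(complex, real) smfd" where
  "circle = \<lparr>mtop = top_of_set (sphere 0 1),
     charts = {(cis ` I, restrict (the_inv_into I cis) (cis ` I)) | I.
                 \<exists>a. I = {a <..< a + 2 * pi}}\<rparr>"

definition torus_surface :: "('b, real \<times> real) smfd \<Rightarrow> bool" where
  "torus_surface S \<longleftrightarrow> smooth_manifold S \<and> (\<exists>f. diffeo (prod_mfd circle circle) S f)"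

definition compact_lie_group ::
    "'g monoid \<Rightarrow> ('g, 'e::real_normed_vector) smfd \<Rightarrow> bool" where
  "compact_lie_group G M \<longleftrightarrow>
     group G \<and> smooth_manifold M \<and> topspace (mtop M) = carrier G \<and>
     smooth_map (prod_mfd M M) M (\<lambda>(x, y). x \<otimes>\<^bsub>G\<^esub> y) \<and>
     smooth_map M M (\<lambda>x. inv\<^bsub>G\<^esub> x) \<and>
     compact_space (mtop M)"


section \<open>Principal bundles over tori\<close>

text \<open>
  In the following \<open>G\<close> is the group, \<open>GM\<close> its manifold structure and \<open>'e\<close> its model space. As the
  total space has dimension \<open>2 + dim G\<close>, it is modelled on \<open>(real \<times> real) \<times> 'e\<close>.
\<close>

record ('p, 'b, 'g, 'e) gbundle =
  tot :: "('p, (real \<times> real) \<times> 'e) smfd"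
  base :: "('b, real \<times> real) smfd"
  bproj :: "'p \<Rightarrow> 'b"
  bact :: "'p \<Rightarrow> 'g \<Rightarrow> 'p"

abbreviation pts :: "('p, 'b, 'g, 'e) gbundle \<Rightarrow> 'p set" where
  "pts P \<equiv> topspace (mtop (tot P))"

abbreviation base_pts :: "('p, 'b, 'g, 'e) gbundle \<Rightarrow> 'b set" where
  "base_pts P \<equiv> topspace (mtop (base P))"

definition principal_bundle ::
    "'g monoid \<Rightarrow> ('g, 'e::real_normed_vector) smfd \<Rightarrow> ('p, 'b, 'g, 'e) gbundle \<Rightarrow> bool" where
  "principal_bundle G GM P \<longleftrightarrow>
     smooth_manifold (tot P) \<and> smooth_manifold (base P) \<and>
     smooth_map (tot P) (base P) (bproj P) \<and>
     smooth_map (prod_mfd (tot P) GM) (tot P) (\<lambda>(p, g). bact P p g) \<and>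
     (\<forall>p\<in>pts P. bact P p \<one>\<^bsub>G\<^esub> = p) \<and>
     (\<forall>p\<in>pts P. \<forall>g\<in>carrier G. \<forall>h\<in>carrier G.
        bact P (bact P p g) h = bact P p (g \<otimes>\<^bsub>G\<^esub> h)) \<and>
     (\<forall>p\<in>pts P. \<forall>g\<in>carrier G. bproj P (bact P p g) = bproj P p) \<and>
     (\<forall>x\<in>base_pts P. \<exists>W \<Phi>. openin (mtop (base P)) W \<and> x \<in> W \<and>
        diffeo (prod_mfd (open_submfd (base P) W) GM)
               (open_submfd (tot P) {p \<in> pts P. bproj P p \<in> W}) \<Phi> \<and>
        (\<forall>y\<in>W. \<forall>g\<in>carrier G. bproj P (\<Phi> (y, g)) = y \<and>
           (\<forall>h\<in>carrier G. \<Phi> (y, g \<otimes>\<^bsub>G\<^esub> h) = bact P (\<Phi> (y, g)) h)))"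

definition L2_obj ::
    "'g monoid \<Rightarrow> ('g, 'e::real_normed_vector) smfd \<Rightarrow> ('p, 'b, 'g, 'e) gbundle set" where
  "L2_obj G GM = {P. principal_bundle G GM P \<and> torus_surface (base P)}"

definition covers ::
    "('p, 'b, 'g, 'e) gbundle \<Rightarrow> ('p, 'b, 'g, 'e) gbundle \<Rightarrow> ('p \<Rightarrow> 'p) \<Rightarrow> ('b \<Rightarrow> 'b) \<Rightarrow> bool" where
  "covers P Q f h \<longleftrightarrow> (\<forall>p\<in>pts P. bproj Q (f p) = h (bproj P p))"

text \<open>Morphisms are extensional functions, so that equality in HOL is equality of morphisms.\<close>

definition L2_mor ::
    "'g monoid \<Rightarrow> ('p, 'b, 'g, 'e::real_normed_vector) gbundle \<Rightarrow> ('p, 'b, 'g, 'e) gbundle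
      \<Rightarrow> ('p \<Rightarrow> 'p) set" where
  "L2_mor G P Q = {f \<in> extensional (pts P).
     diffeo (tot P) (tot Q) f \<and>
     (\<forall>p\<in>pts P. \<forall>g\<in>carrier G. f (bact P p g) = bact Q (f p) g) \<and>
     (\<exists>h. diffeo (base P) (base Q) h \<and> covers P Q f h)}"

definition compact_open :: "'a topology \<Rightarrow> 'b topology \<Rightarrow> ('a \<Rightarrow> 'b) set \<Rightarrow> ('a \<Rightarrow> 'b) topology" where
  "compact_open X Y F =
     topology_generated_by {{f \<in> F. f ` K \<subseteq> U} | K U. compactin X K \<and> openin Y U}"

definition L2_map ::
    "'g monoid \<Rightarrow> ('p, 'b, 'g, 'e::real_normed_vector) gbundle \<Rightarrow> ('p, 'b, 'g, 'e) gbundle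
      \<Rightarrow> ('p \<Rightarrow> 'p) topology" where
  "L2_map G P Q = compact_open (mtop (tot P)) (mtop (tot Q)) (L2_mor G P Q)"

definition L2_id :: "('p, 'b, 'g, 'e) gbundle \<Rightarrow> 'p \<Rightarrow> 'p" where
  "L2_id P = (\<lambda>p\<in>pts P. p)"

definition L2_inv ::
    "('p, 'b, 'g, 'e) gbundle \<Rightarrow> ('p, 'b, 'g, 'e) gbundle \<Rightarrow> ('p \<Rightarrow> 'p) \<Rightarrow> 'p \<Rightarrow> 'p" where
  "L2_inv P Q f = restrict (the_inv_into (pts P) f) (pts Q)"

definition Aut :: "'g monoid \<Rightarrow> ('p, 'b, 'g, 'e::real_normed_vector) gbundle \<Rightarrow> ('p \<Rightarrow> 'p) monoid" where
  "Aut G P = \<lparr>carrier = L2_mor G P P, mult = (\<lambda>f g. compose (pts P) f g), one = L2_id P\<rparr>"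


section \<open>Categories and functors\<close>

text \<open>
  Composition takes the three objects as arguments: \<open>Comp C X Y Z g f\<close> is the composite of
  \<open>f : X \<rightarrow> Y\<close> and \<open>g : Y \<rightarrow> Z\<close>. Hom sets of different pairs of objects need not be disjoint.
\<close>

record ('o, 'm) cat =
  Obj :: "'o set"
  Hom :: "'o \<Rightarrow> 'o \<Rightarrow> 'm set"
  Id :: "'o \<Rightarrow> 'm"
  Comp :: "'o \<Rightarrow> 'o \<Rightarrow> 'o \<Rightarrow> 'm \<Rightarrow> 'm \<Rightarrow> 'm"

definition is_category :: "('o, 'm) cat \<Rightarrow> bool" where
  "is_category C \<longleftrightarrow>
     (\<forall>X\<in>Obj C. Id C X \<in> Hom C X X) \<and>
     (\<forall>X\<in>Obj C. \<forall>Y\<in>Obj C. \<forall>Z\<in>Obj C. \<forall>f\<in>Hom C X Y. \<forall>g\<in>Hom C Y Z.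
        Comp C X Y Z g f \<in> Hom C X Z) \<and>
     (\<forall>X\<in>Obj C. \<forall>Y\<in>Obj C. \<forall>f\<in>Hom C X Y.
        Comp C X X Y f (Id C X) = f \<and> Comp C X Y Y (Id C Y) f = f) \<and>
     (\<forall>W\<in>Obj C. \<forall>X\<in>Obj C. \<forall>Y\<in>Obj C. \<forall>Z\<in>Obj C.
        \<forall>f\<in>Hom C W X. \<forall>g\<in>Hom C X Y. \<forall>h\<in>Hom C Y Z.
          Comp C W Y Z h (Comp C W X Y g f) = Comp C W X Z (Comp C X Y Z h g) f)"

definition is_functor ::
    "('o, 'm) cat \<Rightarrow> ('q, 'n) cat \<Rightarrow> ('o \<Rightarrow> 'q) \<Rightarrow> ('o \<Rightarrow> 'o \<Rightarrow> 'm \<Rightarrow> 'n) \<Rightarrow> bool" where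
  "is_functor C D Fo Fm \<longleftrightarrow>
     is_category C \<and> is_category D \<and>
     (\<forall>X\<in>Obj C. Fo X \<in> Obj D) \<and>
     (\<forall>X\<in>Obj C. \<forall>Y\<in>Obj C. \<forall>f\<in>Hom C X Y. Fm X Y f \<in> Hom D (Fo X) (Fo Y)) \<and>
     (\<forall>X\<in>Obj C. Fm X X (Id C X) = Id D (Fo X)) \<and>
     (\<forall>X\<in>Obj C. \<forall>Y\<in>Obj C. \<forall>Z\<in>Obj C. \<forall>f\<in>Hom C X Y. \<forall>g\<in>Hom C Y Z.
        Fm X Z (Comp C X Y Z g f) = Comp D (Fo X) (Fo Y) (Fo Z) (Fm Y Z g) (Fm X Y f))"


section \<open>The abelian orbit category\<close>

type_synonym ('p, 'b, 'g, 'e) orb_obj = "('p, 'b, 'g, 'e) gbundle \<times> ('p \<Rightarrow> 'p) set"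

definition Orb_ab_obj ::
    "'g monoid \<Rightarrow> ('g, 'e::real_normed_vector) smfd \<Rightarrow> ('p, 'b, 'g, 'e) orb_obj set" where
  "Orb_ab_obj G GM = {(P, T). P \<in> L2_obj G GM \<and> subgroup T (Aut G P) \<and>
     closedin (L2_map G P P) T \<and> compactin (L2_map G P P) T \<and>
     (\<forall>s\<in>T. \<forall>t\<in>T. s \<otimes>\<^bsub>Aut G P\<^esub> t = t \<otimes>\<^bsub>Aut G P\<^esub> s)}"

definition quotient_top :: "'a topology \<Rightarrow> ('a \<Rightarrow> 'c) \<Rightarrow> 'c topology" where
  "quotient_top X q =
     topology (\<lambda>V. V \<subseteq> q ` topspace X \<and> openin X {x \<in> topspace X. q x \<in> V})"

lemma openin_quotient_top:
  "openin (quotient_top X q) V \<longleftrightarrow> V \<subseteq> q ` topspace X \<and> openin X {x \<in> topspace X. q x \<in> V}"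
proof -
  let ?O = "\<lambda>V. V \<subseteq> q ` topspace X \<and> openin X {x \<in> topspace X. q x \<in> V}"
  have "istopology ?O"
    unfolding istopology_def
  proof (intro conjI allI impI)
    fix S T assume S: "?O S" and T: "?O T"
    have "{x \<in> topspace X. q x \<in> S \<inter> T} = {x \<in> topspace X. q x \<in> S} \<inter> {x \<in> topspace X. q x \<in> T}"
      by auto
    then show "openin X {x \<in> topspace X. q x \<in> S \<inter> T}"
      using S T by (simp add: openin_Int)
    show "S \<inter> T \<subseteq> q ` topspace X" using S by auto
  next
    fix \<K> assume K: "\<forall>S\<in>\<K>. ?O S"
    have "{x \<in> topspace X. q x \<in> \<Union>\<K>} = (\<Union>S\<in>\<K>. {x \<in> topspace X. q x \<in> S})"
      by auto
    then show "openin X {x \<in> topspace X. q x \<in> \<Union>\<K>}"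
      using K by auto
    show "\<Union>\<K> \<subseteq> q ` topspace X" using K by auto
  qed
  then show ?thesis
    unfolding quotient_top_def by (simp add: topology_inverse')
qed

text \<open>
  The functor \<open>Map(P, -)/T\<close>: on objects the space of \<open>T\<close>-orbits, on a morphism \<open>h\<close> the map
  \<open>push P h\<close> induced by postcomposition.
\<close>

definition orbit ::
    "('p, 'b, 'g, 'e) orb_obj \<Rightarrow> ('p \<Rightarrow> 'p) \<Rightarrow> ('p \<Rightarrow> 'p) set" where
  "orbit X f = (case X of (P, T) \<Rightarrow> {compose (pts P) f t | t. t \<in> T})"

definition map_mod ::
    "'g monoid \<Rightarrow> ('p, 'b, 'g, 'e::real_normed_vector) orb_obj \<Rightarrow> ('p, 'b, 'g, 'e) gbundle
      \<Rightarrow> ('p \<Rightarrow> 'p) set topology" where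
  "map_mod G X Q = quotient_top (L2_map G (fst X) Q) (orbit X)"

definition push ::
    "('p, 'b, 'g, 'e) orb_obj \<Rightarrow> ('p \<Rightarrow> 'p) \<Rightarrow> ('p \<Rightarrow> 'p) set \<Rightarrow> ('p \<Rightarrow> 'p) set" where
  "push X h \<omega> = (\<lambda>f. compose (pts (fst X)) h f) ` \<omega>"

type_synonym ('p, 'b, 'g, 'e) orb_mor =
  "('p, 'b, 'g, 'e) gbundle \<Rightarrow> ('p \<Rightarrow> 'p) set \<Rightarrow> ('p \<Rightarrow> 'p) set"

definition Orb_ab_hom ::
    "'g monoid \<Rightarrow> ('g, 'e::real_normed_vector) smfd
      \<Rightarrow> ('p, 'b, 'g, 'e) orb_obj \<Rightarrow> ('p, 'b, 'g, 'e) orb_obj \<Rightarrow> ('p, 'b, 'g, 'e) orb_mor set" where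
  "Orb_ab_hom G GM X Y = {\<eta> \<in> extensional (L2_obj G GM).
     (\<forall>Q\<in>L2_obj G GM. \<eta> Q \<in> extensional (topspace (map_mod G X Q)) \<and>
        continuous_map (map_mod G X Q) (map_mod G Y Q) (\<eta> Q)) \<and>
     (\<forall>Q\<in>L2_obj G GM. \<forall>R\<in>L2_obj G GM. \<forall>h\<in>L2_mor G Q R. \<forall>\<omega>\<in>topspace (map_mod G X Q).
        \<eta> R (push X h \<omega>) = push Y h (\<eta> Q \<omega>))}"

definition Orb_ab ::
    "'g monoid \<Rightarrow> ('g, 'e::real_normed_vector) smfd
      \<Rightarrow> (('p, 'b, 'g, 'e) orb_obj, ('p, 'b, 'g, 'e) orb_mor) cat" where
  "Orb_ab G GM = \<lparr>
     Obj = Orb_ab_obj G GM,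
     Hom = Orb_ab_hom G GM,
     Id = (\<lambda>X. \<lambda>Q\<in>L2_obj G GM. \<lambda>\<omega>\<in>topspace (map_mod G X Q). \<omega>),
     Comp = (\<lambda>X Y Z \<psi> \<phi>. \<lambda>Q\<in>L2_obj G GM. compose (topspace (map_mod G X Q)) (\<psi> Q) (\<phi> Q))\<rparr>"

text \<open>
  By Yoneda, \<open>\<phi> : (P, T) \<rightarrow> (P', T')\<close> corresponds to the \<open>T'\<close>-orbit \<open>\<phi> P [id]\<close> of a morphism
  \<open>g : P' \<rightarrow> P\<close>; the induced homomorphism is \<open>t \<mapsto> g\<inverse> t g\<close> for any such representative.
\<close>

definition ind_hom ::
    "('p, 'b, 'g, 'e) orb_obj \<Rightarrow> ('p, 'b, 'g, 'e) orb_obj \<Rightarrow> ('p, 'b, 'g, 'e) orb_mor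
      \<Rightarrow> ('p \<Rightarrow> 'p) \<Rightarrow> ('p \<Rightarrow> 'p)" where
  "ind_hom X Y \<phi> t = (case (X, Y) of ((P, T), (P', T')) \<Rightarrow>
     let g = (SOME g. g \<in> \<phi> P (orbit X (L2_id P)))
     in compose (pts P') (L2_inv P' P g) (compose (pts P') t g))"


section \<open>Equivariant complex manifolds\<close>

text \<open>\<open>C^n\<close> is realised as the space of sequences supported on \<open>{..<n}\<close>, so that \<open>n\<close> can vary.\<close>

definition Cn :: "nat \<Rightarrow> (nat \<Rightarrow> complex) set" where
  "Cn n = {x. \<forall>i\<ge>n. x i = 0}"

definition cscale :: "complex \<Rightarrow> (nat \<Rightarrow> complex) \<Rightarrow> nat \<Rightarrow> complex" where
  "cscale c x = (\<lambda>i. c * x i)"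

text \<open>
  Complex (total) differentiability at every point; \<open>A\<close> is the complex Jacobian matrix at \<open>x\<close>.
\<close>

definition holo_on ::
    "nat \<Rightarrow> nat \<Rightarrow> (nat \<Rightarrow> complex) set \<Rightarrow> ((nat \<Rightarrow> complex) \<Rightarrow> nat \<Rightarrow> complex) \<Rightarrow> bool" where
  "holo_on n m U f \<longleftrightarrow> (\<forall>x\<in>U. \<exists>A :: nat \<Rightarrow> nat \<Rightarrow> complex. \<forall>j<m.
     ((\<lambda>y. (f y j - f x j - (\<Sum>i<n. A j i * (y i - x i)))
             / of_real (\<Sum>i<n. cmod (y i - x i))) \<longlongrightarrow> 0) (at x within U))"

text \<open>Here charts go from open subsets of \<open>C^n\<close> to the manifold.\<close>

type_synonym 'a cchart = "(nat \<Rightarrow> complex) set \<times> ((nat \<Rightarrow> complex) \<Rightarrow> 'a)"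

record 'a cmfd =
  ctop :: "'a topology"
  cact :: "complex \<Rightarrow> 'a \<Rightarrow> 'a"
  cdim :: nat
  ccharts :: "'a cchart set"

definition Cx_space :: "'a topology \<Rightarrow> (complex \<Rightarrow> 'a \<Rightarrow> 'a) \<Rightarrow> bool" where
  "Cx_space X a \<longleftrightarrow>
     continuous_map (prod_topology (top_of_set (UNIV - {0})) X) X (\<lambda>(c, x). a c x) \<and>
     (\<forall>x\<in>topspace X. a 1 x = x) \<and>
     (\<forall>c d. \<forall>x\<in>topspace X. c \<noteq> 0 \<and> d \<noteq> 0 \<longrightarrow> a c (a d x) = a (c * d) x)"

definition is_cchart ::
    "'a topology \<Rightarrow> (complex \<Rightarrow> 'a \<Rightarrow> 'a) \<Rightarrow> nat \<Rightarrow> 'a cchart \<Rightarrow> bool" where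
  "is_cchart X a n c \<longleftrightarrow> (case c of (U, \<phi>) \<Rightarrow>
     openin (top_of_set (Cn n)) U \<and> \<phi> \<in> extensional U \<and> openin X (\<phi> ` U) \<and>
     homeomorphic_map (top_of_set U) (subtopology X (\<phi> ` U)) \<phi> \<and>
     (\<forall>c x. c \<noteq> 0 \<and> x \<in> U \<longrightarrow> cscale c x \<in> U \<and> \<phi> (cscale c x) = a c (\<phi> x)))"

definition holo_compatible :: "nat \<Rightarrow> 'a cchart \<Rightarrow> 'a cchart \<Rightarrow> bool" where
  "holo_compatible n c d \<longleftrightarrow> (case (c, d) of ((U, \<phi>), (V, \<psi>)) \<Rightarrow>
     holo_on n n {x \<in> U. \<phi> x \<in> \<psi> ` V} (the_inv_into V \<psi> \<circ> \<phi>) \<and>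
     holo_on n n {x \<in> V. \<psi> x \<in> \<phi> ` U} (the_inv_into U \<phi> \<circ> \<psi>))"

definition Cx_manifold :: "'a cmfd \<Rightarrow> bool" where
  "Cx_manifold M \<longleftrightarrow>
     Hausdorff_space (ctop M) \<and> second_countable (ctop M) \<and>
     Cx_space (ctop M) (cact M) \<and>
     (\<forall>c\<in>ccharts M. is_cchart (ctop M) (cact M) (cdim M) c) \<and>
     (\<Union>(U, \<phi>)\<in>ccharts M. \<phi> ` U) = topspace (ctop M) \<and>
     (\<forall>c\<in>ccharts M. \<forall>d\<in>ccharts M. holo_compatible (cdim M) c d) \<and>
     (\<forall>c. is_cchart (ctop M) (cact M) (cdim M) c \<and>
          (\<forall>d\<in>ccharts M. holo_compatible (cdim M) c d) \<longrightarrow> c \<in> ccharts M)"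

definition Cx_holo_map :: "'a cmfd \<Rightarrow> 'b cmfd \<Rightarrow> ('a \<Rightarrow> 'b) \<Rightarrow> bool" where
  "Cx_holo_map M N f \<longleftrightarrow> continuous_map (ctop M) (ctop N) f \<and>
     (\<forall>c. \<forall>x\<in>topspace (ctop M). c \<noteq> 0 \<longrightarrow> f (cact M c x) = cact N c (f x)) \<and>
     (\<forall>(U, \<phi>)\<in>ccharts M. \<forall>(V, \<psi>)\<in>ccharts N.
        holo_on (cdim M) (cdim N) {x \<in> U. f (\<phi> x) \<in> \<psi> ` V} (the_inv_into V \<psi> \<circ> f \<circ> \<phi>))"

definition CxMfd :: "('a cmfd, 'a \<Rightarrow> 'a) cat" where
  "CxMfd = \<lparr>
     Obj = {M. Cx_manifold M},
     Hom = (\<lambda>M N. {f \<in> extensional (topspace (ctop M)). Cx_holo_map M N f}),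
     Id = (\<lambda>M. \<lambda>x\<in>topspace (ctop M). x),
     Comp = (\<lambda>M N R g f. compose (topspace (ctop M)) g f)\<rparr>"


section \<open>Frames\<close>

definition C_add :: "complex monoid" where
  "C_add = \<lparr>carrier = UNIV, mult = (+), one = 0\<rparr>"

type_synonym 'p chom = "complex \<Rightarrow> 'p \<Rightarrow> 'p"

definition frame :: "'g monoid \<Rightarrow> ('p, 'b, 'g, 'e::real_normed_vector) gbundle \<Rightarrow> 'p chom \<Rightarrow> bool" where
  "frame G P \<gamma> \<longleftrightarrow> \<gamma> \<in> hom C_add (Aut G P) \<and> continuous_map euclidean (L2_map G P P) \<gamma> \<and>
     (\<forall>x\<in>base_pts P. \<forall>y\<in>base_pts P. \<exists>z h. covers P P (\<gamma> z) h \<and> h x = y)"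

text \<open>
  Continuous homomorphisms into a Lie group are automatically smooth, so \<open>Hom_C G (P, T)\<close> is the set
  of Lie group homomorphisms from \<open>C\<close> to \<open>T\<close>.
\<close>

definition Hom_C :: "'g monoid \<Rightarrow> ('p, 'b, 'g, 'e::real_normed_vector) orb_obj \<Rightarrow> 'p chom set" where
  "Hom_C G X = (case X of (P, T) \<Rightarrow>
     {\<gamma> \<in> hom C_add (Aut G P\<lparr>carrier := T\<rparr>).
        continuous_map euclidean (subtopology (L2_map G P P) T) \<gamma>})"

definition Hom_C_add :: "'g monoid \<Rightarrow> ('p, 'b, 'g, 'e::real_normed_vector) orb_obj \<Rightarrow>
    'p chom \<Rightarrow> 'p chom \<Rightarrow> 'p chom" where
  "Hom_C_add G X \<gamma> \<delta> = (\<lambda>z. \<gamma> z \<otimes>\<^bsub>Aut G (fst X)\<^esub> \<delta> z)"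

definition Hom_C_scale :: "complex \<Rightarrow> 'p chom \<Rightarrow> 'p chom" where
  "Hom_C_scale c \<gamma> = (\<lambda>z. \<gamma> (cnj c * z))"

definition Hom_C_top ::
    "'g monoid \<Rightarrow> ('p, 'b, 'g, 'e::real_normed_vector) orb_obj \<Rightarrow> 'p chom topology" where
  "Hom_C_top G X = compact_open euclidean (L2_map G (fst X) (fst X)) (Hom_C G X)"

definition lin_iso ::
    "'g monoid \<Rightarrow> ('p, 'b, 'g, 'e::real_normed_vector) orb_obj \<Rightarrow> nat
      \<Rightarrow> ((nat \<Rightarrow> complex) \<Rightarrow> 'p chom) \<Rightarrow> bool" where
  "lin_iso G X n L \<longleftrightarrow> bij_betw L (Cn n) (Hom_C G X) \<and>
     (\<forall>x\<in>Cn n. \<forall>y\<in>Cn n. L (\<lambda>i. x i + y i) = Hom_C_add G X (L x) (L y)) \<and>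
     (\<forall>c. \<forall>x\<in>Cn n. L (cscale c x) = Hom_C_scale c (L x))"

definition Hom_C_dim :: "'g monoid \<Rightarrow> ('p, 'b, 'g, 'e::real_normed_vector) orb_obj \<Rightarrow> nat" where
  "Hom_C_dim G X = (THE n. \<exists>L. lin_iso G X n L)"

definition Fr_set :: "'g monoid \<Rightarrow> ('p, 'b, 'g, 'e::real_normed_vector) orb_obj \<Rightarrow> 'p chom set" where
  "Fr_set G X = {\<gamma>. frame G (fst X) \<gamma> \<and> range \<gamma> \<subseteq> snd X}"

text \<open>
  The complex structure inherited from \<open>Hom(C, T)\<close>: a chart of \<open>Fr(T)\<close> is an equivariant chart that
  is holomorphically compatible with the restrictions to \<open>Fr(T)\<close> of the linear isomorphisms
  \<open>C^n \<rightarrow> Hom(C, T)\<close>.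
\<close>

definition Fr :: "'g monoid \<Rightarrow> ('p, 'b, 'g, 'e::real_normed_vector) orb_obj \<Rightarrow> 'p chom cmfd" where
  "Fr G X = (let X\<^sub>F = subtopology (Hom_C_top G X) (Fr_set G X); n = Hom_C_dim G X in \<lparr>
     ctop = X\<^sub>F,
     cact = Hom_C_scale,
     cdim = n,
     ccharts = {c. is_cchart X\<^sub>F Hom_C_scale n c \<and>
       (\<forall>L. lin_iso G X n L \<longrightarrow>
          (let U = {x \<in> Cn n. L x \<in> Fr_set G X} in holo_compatible n c (U, restrict L U)))}\<rparr>)"

definition Fr_map ::
    "'g monoid \<Rightarrow> ('p, 'b, 'g, 'e::real_normed_vector) orb_obj \<Rightarrow> ('p, 'b, 'g, 'e) orb_obj
      \<Rightarrow> ('p, 'b, 'g, 'e) orb_mor \<Rightarrow> 'p chom \<Rightarrow> 'p chom" where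
  "Fr_map G X Y \<phi> = (\<lambda>\<gamma>\<in>Fr_set G X. ind_hom X Y \<phi> \<circ> \<gamma>)"

end

(*
If Fr(T) is empty there is nothing to do. Otherwise T acts transitively on the base, and since it is
abelian and commutes with the transitive action of G on the fibres, it acts freely on P. Evaluation
at a point therefore embeds T locally into a Euclidean space, and invariance of domain bounds the
dimension of Hom(C, T): a linear injection of C^k into Hom(C, T) gives x |-> (L x 1, L x i), which is
locally injective because closed subgroups of C^k without real lines are discrete. A linear
isomorphism L from C^n is a homeomorphism for the compact-open topology. A homomorphism C -> T is a
frame if and only if the stabilizer of a point of the surface contains no real line (by Baire's
theorem and invariance of dimension in one direction, by invariance of domain and connectedness in
the other), and this is an open condition. So Fr(T) is an open subset of C^n, with the linear charts
as an atlas, and a morphism of the orbit category, being conjugation by a representative g, induces a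
complex linear map.
*)
theory Submission
  imports Defs "HOL-Homology.Invariance_of_Domain"
begin

section \<open>Finite-dimensional normed spaces\<close>

text \<open>The obstacle is that \<open>T\<close> is compact only for the compact-open topology and
  is not known to be a Lie group, so neither the dimension of Hom(C, T) nor its topology can be read
  off a Lie algebra. The proof therefore handles one-parameter groups directly: complex linear maps
  from C^n into Hom(C, T) take the place of the exponential map, and an injective one of maximal n
  takes the place of a basis. The arguments 1 and i occur because they span C over the reals: a
  homomorphism that is trivial on both real lines through them is trivial, and evaluation at the two
  points yields 2N real coordinates for 2n real parameters. One discreteness argument, uniform over
  a compact set of directions, serves both for the kernel of this evaluation and for the stabilizers
  of points of the surface. If Fr(T) is empty, the proof provides no linear isomorphism, and
  \<open>Hom_C_dim\<close> may be a definite description without referent. The empty space is a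
  manifold of whatever dimension this denotes.\<close>

lemma compact_fun_box:
  fixes A :: "'i \<Rightarrow> 'a::topological_space set"
  assumes "\<And>i. compact (A i)"
  shows "compact {x. \<forall>i. x i \<in> A i}"
proof -
  have "compactin (product_topology (\<lambda>i. euclidean) UNIV) (PiE UNIV A)"
    using assms by (subst compactin_PiE) auto
  moreover have "PiE UNIV A = {x. \<forall>i. x i \<in> A i}"
    by auto
  ultimately show ?thesis
    by (simp add: euclidean_product_topology)
qed

lemma continuous_on_coordinate: "continuous_on A (\<lambda>x :: 'i \<Rightarrow> 'a::topological_space. x i)"
  by (rule continuous_on_subset[OF continuous_on_product_coordinates]) simp

lemma closed_coordinate_vanishing: "closed {x :: nat \<Rightarrow> 'a::real_normed_vector. \<forall>i\<ge>n. x i = 0}"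
proof -
  have "{x :: nat \<Rightarrow> 'a. \<forall>i\<ge>n. x i = 0} = (\<Inter>i\<in>{n..}. {x. x i = 0})"
    by auto
  moreover have "closed {x :: nat \<Rightarrow> 'a. x i = 0}" for i
    by (intro closed_Collect_eq continuous_intros) auto
  ultimately show ?thesis
    by (metis (no_types, lifting) closed_INT)
qed

text \<open>The sphere is a closed subset of a product of discs, so sequences of bounded support
  behave like finite-dimensional vectors even in the product topology. The real case gives
  continuity of coordinates, the complex case the compact set of directions in C^n.\<close>

lemma compact_unit_l1_sphere:
  "compact {x :: nat \<Rightarrow> 'a::{real_normed_vector,heine_borel}. (\<forall>i\<ge>n. x i = 0) \<and> (\<Sum>i<n. norm (x i)) = r}"
    (is "compact ?S")
proof -
  let ?B = "{x :: nat \<Rightarrow> 'a. \<forall>i. x i \<in> cball 0 \<bar>r\<bar>}"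
  have "closed ({x :: nat \<Rightarrow> 'a. \<forall>i\<ge>n. x i = 0} \<inter> {x. (\<Sum>i<n. norm (x i)) = r})"
    by (intro closed_Int closed_coordinate_vanishing closed_Collect_eq continuous_intros) auto
  then have "compact (?B \<inter> ({x. \<forall>i\<ge>n. x i = 0} \<inter> {x. (\<Sum>i<n. norm (x i)) = r}))"
    by (intro compact_Int_closed compact_fun_box compact_cball)
  moreover have "norm (x i) \<le> \<bar>r\<bar>" if "\<forall>i\<ge>n. x i = 0" "(\<Sum>i<n. norm (x i)) = r" for x :: "nat \<Rightarrow> 'a" and i
  proof (cases "i < n")
    case True
    then have "norm (x i) \<le> (\<Sum>i<n. norm (x i))"
      by (intro member_le_sum) auto
    then show ?thesis using that by simp
  qed (use that in auto)
  then have "?B \<inter> ({x. \<forall>i\<ge>n. x i = 0} \<inter> {x. (\<Sum>i<n. norm (x i)) = r}) = ?S"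
    by auto
  ultimately show ?thesis by simp
qed

text \<open>A model space is only known to be a normed space with a finite spanning set, so
  continuity of coordinates needs an argument: by independence the norm of a linear combination has
  a positive minimum on the compact l1 sphere of coefficients.\<close>

lemma finite_dim_coordinates:
  fixes B :: "'e::real_normed_vector set"
  assumes "finite B" "span B = UNIV"
  obtains n :: nat and c :: "nat \<Rightarrow> 'e \<Rightarrow> real" and b :: "nat \<Rightarrow> 'e"
  where "\<And>i. i < n \<Longrightarrow> bounded_linear (c i)" "\<And>x. x = (\<Sum>i<n. c i x *\<^sub>R b i)"
proof -
  obtain B' where B': "B' \<subseteq> B" "independent B'" "B \<subseteq> span B'"
    using real_vector.maximal_independent_subset by blast
  have fin: "finite B'" using B' assms finite_subset by blast
  have sp: "span B' = UNIV"
    using real_vector.span_minimal[OF B'(3) real_vector.subspace_span] assms(2) by auto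
  obtain b where b: "bij_betw b {..<card B'} B'"
    using fin ex_bij_betw_nat_finite[of B'] by (auto simp: atLeast0LessThan)
  let ?n = "card B'"
  define c where "c i x = real_vector.representation B' x (b i)" for i x
  have rep: "x = (\<Sum>i<?n. c i x *\<^sub>R b i)" for x
  proof -
    have "(\<Sum>v\<in>B'. real_vector.representation B' x v *\<^sub>R v) = x"
      using fin sp B' by (intro real_vector.sum_representation_eq) auto
    then show ?thesis
      unfolding c_def using sum.reindex_bij_betw[OF b, of "\<lambda>v. real_vector.representation B' x v *\<^sub>R v"]
      by simp
  qed
  have lin: "linear (c i)" for i
    unfolding c_def
    by (rule linearI) (auto simp: real_vector.representation_add real_vector.representation_scale B' sp)
  define T where "T r = (\<Sum>i<?n. r i *\<^sub>R b i)" for r :: "nat \<Rightarrow> real"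
  have cT: "c i (T r) = r i" if "i < ?n" for i r
  proof -
    have "c i (T r) = (\<Sum>j<?n. r j * c i (b j))"
      unfolding T_def by (simp add: linear_sum[OF lin] linear_cmul[OF lin])
    also have "\<dots> = (\<Sum>j<?n. r j * (if j = i then 1 else 0))"
    proof (intro sum.cong refl arg_cong2[where f="(*)"])
      fix j assume "j \<in> {..<?n}"
      then have "b j \<in> B'" "b i = b j \<longleftrightarrow> j = i"
        using b that by (auto simp: bij_betw_def inj_on_def)
      then show "c i (b j) = (if j = i then 1 else 0)"
        unfolding c_def using B' by (simp add: real_vector.representation_basis)
    qed
    also have "\<dots> = r i"
      using that by (subst sum.remove[of _ i]) auto
    finally show ?thesis .
  qed
  let ?S = "{r :: nat \<Rightarrow> real. (\<forall>i\<ge>?n. r i = 0) \<and> (\<Sum>i<?n. norm (r i)) = 1}"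
  have contT: "continuous_on A (\<lambda>r. norm (T r))" for A
    unfolding T_def by (intro continuous_intros continuous_on_coordinate)
  \<comment> \<open>The space may be zero; then the sphere of coefficients is empty and the constant
    1 serves.\<close>
  have "\<exists>m>0. \<forall>r\<in>?S. m \<le> norm (T r)"
  proof (cases "?S = {}")
    case True
    then show ?thesis
      by (intro exI[of _ "1::real"] conjI ballI) (simp, blast)
  next
    case False
    then obtain r0 where r0: "r0 \<in> ?S" "\<forall>r\<in>?S. norm (T r0) \<le> norm (T r)"
      using continuous_attains_inf[OF compact_unit_l1_sphere False contT] by blast
    have "T r0 \<noteq> 0"
    proof
      assume "T r0 = 0"
      then have "r0 i = 0" if "i < ?n" for i
        using cT[OF that, of r0] linear_0[OF lin] by simp
      then show False using r0(1) by simp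
    qed
    then show ?thesis using r0 by (intro exI[of _ "norm (T r0)"]) auto
  qed
  then obtain m where m: "m > 0" "\<And>r. r \<in> ?S \<Longrightarrow> m \<le> norm (T r)" by blast
  have "bounded_linear (c i)" if i: "i < ?n" for i
  proof (rule bounded_linear.intro[OF lin], unfold_locales, intro exI allI)
    fix x
    define s where "s = (\<Sum>i<?n. norm (c i x))"
    have s': "s = (\<Sum>i<?n. \<bar>c i x\<bar>)"
      by (simp add: s_def)
    have "norm (c i x) \<le> s"
      unfolding s_def using i by (intro member_le_sum) auto
    moreover have "s * m \<le> norm x"
    proof (cases "s > 0")
      case True
      \<comment> \<open>The coefficients of \<open>x\<close> are normalised onto the sphere, where
        \<open>m\<close> bounds the norm from below.\<close>
      let ?r = "\<lambda>i. if i < ?n then c i x / s else 0"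
      have "?r \<in> ?S"
        using True by (simp add: sum_divide_distrib[symmetric] s'[symmetric])
      moreover have "T ?r = (1 / s) *\<^sub>R x"
        unfolding T_def by (subst (3) rep) (simp add: scaleR_sum_right divide_inverse mult.commute)
      ultimately have "m \<le> norm x / s"
        using m(2)[of ?r] True by simp
      then show ?thesis using True by (simp add: field_simps)
    next
      case False
      then have "s = 0" unfolding s_def by (smt (verit) norm_ge_zero sum_nonneg)
      then show ?thesis by simp
    qed
    ultimately show "norm (c i x) \<le> norm x * (1 / m)"
      using m(1) pos_le_divide_eq[of m s "norm x"] by simp
  qed
  with rep show ?thesis using that by blast
qed

section \<open>Maps of class C-k\<close>

lemma Ck_on_subset: "Ck_on k T f \<Longrightarrow> S \<subseteq> T \<Longrightarrow> Ck_on k S f"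
  by (induction k arbitrary: f) (auto intro: continuous_on_subset)

lemma Ck_on_cong:
  assumes "open S" "\<And>x. x \<in> S \<Longrightarrow> f x = g x" "Ck_on k S f"
  shows "Ck_on k S g"
  using assms(2,3)
proof (induction k arbitrary: f g)
  case 0
  then show ?case by (simp cong: continuous_on_cong)
next
  case (Suc k)
  have "g differentiable (at x)" if "x \<in> S" for x
    using Suc.prems that assms(1) unfolding differentiable_def Ck_on.simps
    by (metis has_derivative_transform_within_open)
  moreover have "frechet_derivative f (at x) = frechet_derivative g (at x)" if "x \<in> S" for x
    using Suc.prems that assms(1) frechet_derivative_transform_within_open[of f x S g] by simp
  then have "Ck_on k S (\<lambda>x. frechet_derivative g (at x) v)" for v
    using Suc.IH[of "\<lambda>x. frechet_derivative f (at x) v" "\<lambda>x. frechet_derivative g (at x) v"] Suc.prems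
    by simp
  ultimately show ?case by simp
qed

lemma Ck_on_Suc_imp_Ck_on: "Ck_on (Suc k) S f \<Longrightarrow> Ck_on k S f"
proof (induction k arbitrary: f)
  case 0
  then show ?case
    by (auto intro!: continuous_at_imp_continuous_on differentiable_imp_continuous_within)
next
  case (Suc k)
  then show ?case
    using Ck_on.simps(2)[of "Suc k" S f, THEN iffD1] Ck_on.simps(2)[of k S f, THEN iffD2] by blast
qed

lemma Ck_on_local:
  assumes "\<And>x. x \<in> S \<Longrightarrow> \<exists>U. open U \<and> x \<in> U \<and> Ck_on k U f"
  shows "Ck_on k S f"
  using assms
proof (induction k arbitrary: f)
  case 0
  then show ?case
    by (metis Ck_on.simps(1) continuous_at_imp_continuous_on continuous_on_eq_continuous_at)
next
  case (Suc k)
  show ?case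
  proof (rule Ck_on.simps(2)[THEN iffD2], intro conjI ballI allI)
    show "f differentiable (at x)" if "x \<in> S" for x
      using Suc.prems[OF that] by auto
    show "Ck_on k S (\<lambda>x. frechet_derivative f (at x) v)" for v
    proof (rule Suc.IH)
      fix x assume "x \<in> S"
      from Suc.prems[OF this] show "\<exists>U. open U \<and> x \<in> U \<and> Ck_on k U (\<lambda>x. frechet_derivative f (at x) v)"
        by auto
    qed
  qed
qed

text \<open>Replaces the chosen \<open>frechet_derivative\<close> by any explicit derivative, so
  that the rules of differentiation can drive the inductions below.\<close>

lemma Ck_on_has_derivative:
  assumes "open S" "\<And>x. x \<in> S \<Longrightarrow> (f has_derivative f' x) (at x)" "\<And>v. Ck_on k S (\<lambda>x. f' x v)"
  shows "Ck_on (Suc k) S f"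
proof -
  have "f' x = frechet_derivative f (at x)" if "x \<in> S" for x
    using assms(2) that frechet_derivative_at by blast
  then have "Ck_on k S (\<lambda>x. frechet_derivative f (at x) v)" for v
    using Ck_on_cong[OF assms(1) _ assms(3)] by auto
  then show ?thesis using assms(2) by (auto simp: differentiable_def)
qed

lemma Ck_on_Suc_has_derivative:
  "Ck_on (Suc k) S f \<Longrightarrow> x \<in> S \<Longrightarrow> (f has_derivative frechet_derivative f (at x)) (at x)"
  by (simp add: frechet_derivative_works)

lemma Ck_on_const: "open S \<Longrightarrow> Ck_on k S (\<lambda>x. c)"
proof (induction k arbitrary: c)
  case (Suc k)
  show ?case
    by (rule Ck_on_has_derivative[where f'="\<lambda>x v. 0"]) (use Suc in auto)
qed auto

lemma Ck_on_add:
  assumes "open S" "Ck_on k S f" "Ck_on k S g"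
  shows "Ck_on k S (\<lambda>x. f x + g x)"
  using assms(2,3)
proof (induction k arbitrary: f g)
  case 0
  then show ?case by (auto intro: continuous_intros)
next
  case (Suc k)
  show ?case
    by (rule Ck_on_has_derivative[OF assms(1)
          has_derivative_add[OF Ck_on_Suc_has_derivative[OF Suc.prems(1)]
            Ck_on_Suc_has_derivative[OF Suc.prems(2)]]])
      (use Suc in auto)
qed

lemma Ck_on_sum:
  "open S \<Longrightarrow> (\<And>i. i \<in> I \<Longrightarrow> Ck_on k S (f i)) \<Longrightarrow> Ck_on k S (\<lambda>x. \<Sum>i\<in>I. f i x)"
  by (induction I rule: infinite_finite_induct) (auto intro: Ck_on_const Ck_on_add)

lemma Ck_on_bounded_linear:
  assumes "bounded_linear L" "open S" "Ck_on k S f"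
  shows "Ck_on k S (\<lambda>x. L (f x))"
  using assms(3)
proof (induction k arbitrary: f)
  case 0
  then show ?case
    using bounded_linear.continuous_on[OF assms(1)] by auto
next
  case (Suc k)
  show ?case
    by (rule Ck_on_has_derivative[OF assms(2)
          bounded_linear.has_derivative[OF assms(1) Ck_on_Suc_has_derivative[OF Suc.prems]]])
      (use Suc in auto)
qed

lemma Ck_on_scaleR:
  assumes "open S" "Ck_on k S f" "Ck_on k S g"
  shows "Ck_on k S (\<lambda>x. f x *\<^sub>R g x)"
  using assms(2,3)
proof (induction k arbitrary: f g)
  case 0
  then show ?case by (auto intro: continuous_intros)
next
  case (Suc k)
  show ?case
    by (rule Ck_on_has_derivative[OF assms(1)
          has_derivative_scaleR[OF Ck_on_Suc_has_derivative[OF Suc.prems(1)]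
            Ck_on_Suc_has_derivative[OF Suc.prems(2)]]])
      (use Suc Ck_on_Suc_imp_Ck_on[OF Suc.prems(1)] Ck_on_Suc_imp_Ck_on[OF Suc.prems(2)]
        in \<open>auto intro!: Ck_on_add assms(1)\<close>)
qed

text \<open>In the chain rule both the point \<open>f x\<close> and the vector to which the
  derivative of \<open>g\<close> is applied depend on \<open>x\<close>. Expanding the vector in
  coordinates of \<open>'b\<close> leaves a finite sum of scalar functions times derivatives of
  \<open>g\<close> along fixed vectors; this is where finite dimension enters.\<close>

lemma Ck_on_compose:
  fixes f :: "'a::real_normed_vector \<Rightarrow> 'b::real_normed_vector" and g :: "'b \<Rightarrow> 'c::real_normed_vector"
  assumes B: "finite (B :: 'b set)" "span B = UNIV" and S: "open S"
    and gf: "Ck_on k T g" "Ck_on k S f" "f ` S \<subseteq> T"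
  shows "Ck_on k S (\<lambda>x. g (f x))"
proof -
  obtain n and c :: "nat \<Rightarrow> 'b \<Rightarrow> real" and b
    where c: "\<And>i. i < n \<Longrightarrow> bounded_linear (c i)" "\<And>x. x = (\<Sum>i<n. c i x *\<^sub>R b i)"
    using finite_dim_coordinates[OF B] by metis
  show ?thesis
    using gf(1,2)
  proof (induction k arbitrary: g)
    case 0
    then show ?case
      using gf(3) continuous_on_compose2 by (auto simp: image_subset_iff)
  next
    case (Suc k)
    let ?f' = "\<lambda>x. frechet_derivative f (at x)" and ?g' = "\<lambda>y. frechet_derivative g (at y)"
    have g': "(g has_derivative ?g' (f x)) (at (f x))" if "x \<in> S" for x
      using Ck_on_Suc_has_derivative[OF Suc.prems(1)] gf(3) that by blast
    show ?case
    proof (rule Ck_on_has_derivative[OF S, where f'="\<lambda>x v. ?g' (f x) (?f' x v)"])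
      show "((\<lambda>x. g (f x)) has_derivative (\<lambda>v. ?g' (f x) (?f' x v))) (at x)" if "x \<in> S" for x
        by (rule has_derivative_compose[OF Ck_on_Suc_has_derivative[OF Suc.prems(2) that] g'[OF that]])
      fix v
      have "Ck_on k S (\<lambda>x. \<Sum>i<n. c i (?f' x v) *\<^sub>R ?g' (f x) (b i))"
      proof (rule Ck_on_sum[OF S], rule Ck_on_scaleR[OF S])
        fix i assume "i \<in> {..<n}"
        then show "Ck_on k S (\<lambda>x. c i (?f' x v))"
          using Suc.prems(2) c(1) by (intro Ck_on_bounded_linear[of "c i", OF _ S]) auto
        \<comment> \<open>The vector \<open>b i\<close> is constant, so this is again a composite
          with \<open>f\<close>, with a new outer function. For this reason the induction leaves
          \<open>g\<close> arbitrary.\<close>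
        show "Ck_on k S (\<lambda>x. ?g' (f x) (b i))"
          using Suc.prems(1) Ck_on_Suc_imp_Ck_on[OF Suc.prems(2)]
          by (intro Suc.IH[where g="\<lambda>y. ?g' y (b i)"]) simp_all
      qed
      moreover have "(\<Sum>i<n. c i (?f' x v) *\<^sub>R ?g' (f x) (b i)) = ?g' (f x) (?f' x v)" if "x \<in> S" for x
      proof -
        have "linear (?g' (f x))"
          using g'[OF that] has_derivative_linear by blast
        then have "?g' (f x) (\<Sum>i<n. c i (?f' x v) *\<^sub>R b i) = (\<Sum>i<n. c i (?f' x v) *\<^sub>R ?g' (f x) (b i))"
          by (simp add: linear_sum linear_cmul)
        then show ?thesis using c(2) by metis
      qed
      ultimately show "Ck_on k S (\<lambda>x. ?g' (f x) (?f' x v))"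
        using Ck_on_cong[OF S, of "\<lambda>x. \<Sum>i<n. c i (?f' x v) *\<^sub>R ?g' (f x) (b i)"
            "\<lambda>x. ?g' (f x) (?f' x v)"] by simp
    qed
  qed
qed

lemma smooth_on_compose:
  fixes f :: "'a::real_normed_vector \<Rightarrow> 'b::real_normed_vector" and g :: "'b \<Rightarrow> 'c::real_normed_vector"
  assumes "finite (B :: 'b set)" "span B = UNIV" "open S" "smooth_on T g" "smooth_on S f" "f ` S \<subseteq> T"
  shows "smooth_on S (\<lambda>x. g (f x))"
  unfolding smooth_on_def
proof
  fix k
  show "Ck_on k S (\<lambda>x. g (f x))"
    using assms(4,5) unfolding smooth_on_def
    by (intro Ck_on_compose[where g=g and f=f and T=T, OF assms(1-3) _ _ assms(6)]) auto
qed

lemma smooth_on_cong: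
  "open S \<Longrightarrow> (\<And>x. x \<in> S \<Longrightarrow> f x = g x) \<Longrightarrow> smooth_on S f \<Longrightarrow> smooth_on S g"
  unfolding smooth_on_def using Ck_on_cong by blast

lemma smooth_on_local:
  "(\<And>x. x \<in> S \<Longrightarrow> \<exists>U. open U \<and> x \<in> U \<and> smooth_on U f) \<Longrightarrow> smooth_on S f"
  unfolding smooth_on_def by (meson Ck_on_local)

lemma smooth_on_subset: "smooth_on T f \<Longrightarrow> S \<subseteq> T \<Longrightarrow> smooth_on S f"
  unfolding smooth_on_def using Ck_on_subset by blast

section \<open>Smooth maps between manifolds\<close>

lemma is_chartD:
  assumes "is_chart X (U, \<phi>)"
  shows "openin X U" "inj_on \<phi> U" "continuous_map (subtopology X U) euclidean \<phi>"
    "\<And>W. openin X W \<Longrightarrow> W \<subseteq> U \<Longrightarrow> open (\<phi> ` W)"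
    "U \<subseteq> topspace X" "homeomorphic_map (subtopology X U) (top_of_set (\<phi> ` U)) \<phi>"
proof -
  have h: "homeomorphic_map (subtopology X U) (top_of_set (\<phi> ` U)) \<phi>" "openin X U" "open (\<phi> ` U)"
    using assms by (auto simp: is_chart_def)
  show "openin X U" "homeomorphic_map (subtopology X U) (top_of_set (\<phi> ` U)) \<phi>" by fact+
  show sub: "U \<subseteq> topspace X" using h openin_subset by blast
  show "inj_on \<phi> U"
    using homeomorphic_imp_injective_map[OF h(1)] sub by (simp add: Int_absorb1)
  show "continuous_map (subtopology X U) euclidean \<phi>"
    using homeomorphic_imp_continuous_map[OF h(1)] continuous_map_into_fulltopology by blast
  show "open (\<phi> ` W)" if "openin X W" "W \<subseteq> U" for W
  proof -
    have "openin (subtopology X U) W"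
      using that by (metis inf.absorb1 openin_subtopology_Int)
    then have "openin (top_of_set (\<phi> ` U)) (\<phi> ` W)"
      using homeomorphic_imp_open_map[OF h(1)] by (simp add: open_map_def)
    then show ?thesis using h(3) openin_open_eq by blast
  qed
qed

lemma smooth_manifoldD:
  fixes M :: "('a, 'e::real_normed_vector) smfd"
  assumes "smooth_manifold M"
  shows "\<forall>c\<in>charts M. is_chart (mtop M) c" "\<Union> (fst ` charts M) = topspace (mtop M)"
    "Hausdorff_space (mtop M)" "second_countable (mtop M)"
    "\<exists>B::'e set. finite B \<and> span B = UNIV"
    "\<And>c d. c \<in> charts M \<Longrightarrow> d \<in> charts M \<Longrightarrow> smooth_compatible c d"
  using assms unfolding smooth_manifold_def by (elim conjE; assumption | blast)+

lemma smooth_manifold_chart_at: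
  assumes "smooth_manifold M" "x \<in> topspace (mtop M)"
  obtains U \<phi> where "(U, \<phi>) \<in> charts M" "x \<in> U"
proof -
  have "x \<in> \<Union> (fst ` charts M)"
    using assms smooth_manifoldD(2) by blast
  then obtain c where "c \<in> charts M" "x \<in> fst c" by blast
  then show ?thesis using that[of "fst c" "snd c"] by simp
qed

lemma smooth_mapI:
  assumes "continuous_map (mtop M) (mtop N) f"
    and "\<And>U \<phi> V \<psi>. (U, \<phi>) \<in> charts M \<Longrightarrow> (V, \<psi>) \<in> charts N
      \<Longrightarrow> smooth_on (\<phi> ` (U \<inter> f -` V)) (\<psi> \<circ> f \<circ> the_inv_into U \<phi>)"
  shows "smooth_map M N f"
  using assms unfolding smooth_map_def by blast

lemma smooth_mapD:
  assumes "smooth_map M N f"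
  shows "continuous_map (mtop M) (mtop N) f"
    and "\<And>U \<phi> V \<psi>. (U, \<phi>) \<in> charts M \<Longrightarrow> (V, \<psi>) \<in> charts N
      \<Longrightarrow> smooth_on (\<phi> ` (U \<inter> f -` V)) (\<psi> \<circ> f \<circ> the_inv_into U \<phi>)"
  using assms unfolding smooth_map_def by blast+

lemma smooth_map_in_topspace:
  "smooth_map M N f \<Longrightarrow> x \<in> topspace (mtop M) \<Longrightarrow> f x \<in> topspace (mtop N)"
  using smooth_mapD(1) continuous_map_image_subset_topspace by blast

text \<open>Morphisms are restricted to be extensional, so smoothness has to survive changes outside
  the manifold. The local expressions agree on images of open sets, where derivatives depend only on
  the values there.\<close>

lemma smooth_map_cong:
  assumes M: "\<forall>c\<in>charts M. is_chart (mtop M) c" and N: "\<forall>c\<in>charts N. is_chart (mtop N) c"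
    and fg: "\<And>x. x \<in> topspace (mtop M) \<Longrightarrow> f x = g x" and f: "smooth_map M N f"
  shows "smooth_map M N g"
proof (rule smooth_mapI)
  show "continuous_map (mtop M) (mtop N) g"
    using f fg continuous_map_eq unfolding smooth_map_def by blast
next
  fix U \<phi> V \<psi> assume U: "(U, \<phi>) \<in> charts M" and V: "(V, \<psi>) \<in> charts N"
  note U' = is_chartD[OF bspec[OF M U]] and V' = is_chartD[OF bspec[OF N V]]
  have eq: "U \<inter> f -` V = U \<inter> g -` V" using fg U'(5) by auto
  have "openin (mtop M) {x \<in> topspace (mtop M). f x \<in> V}"
    using f V'(1) unfolding smooth_map_def by (blast intro: openin_continuous_map_preimage)
  then have "openin (mtop M) (U \<inter> {x \<in> topspace (mtop M). f x \<in> V})"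
    using U'(1) by blast
  moreover have "U \<inter> {x \<in> topspace (mtop M). f x \<in> V} = U \<inter> f -` V"
    using U'(5) by auto
  ultimately have op: "open (\<phi> ` (U \<inter> f -` V))"
    using U'(4) by auto
  have "smooth_on (\<phi> ` (U \<inter> f -` V)) (\<psi> \<circ> f \<circ> the_inv_into U \<phi>)"
    by (rule smooth_mapD(2)[OF f U V])
  then have "smooth_on (\<phi> ` (U \<inter> f -` V)) (\<psi> \<circ> g \<circ> the_inv_into U \<phi>)"
    using op by (rule smooth_on_cong[rotated 2]) (use fg U'(2,5) in \<open>auto simp: the_inv_into_f_f subset_iff\<close>)
  then show "smooth_on (\<phi> ` (U \<inter> g -` V)) (\<psi> \<circ> g \<circ> the_inv_into U \<phi>)"
    using eq by simp
qed

text \<open>Near each point the local expression factors through a chart of \<open>N\<close> around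
  the image. \<open>M\<close> and \<open>R\<close> need only consist of genuine charts, whereas the
  charts of \<open>N\<close> must cover it.\<close>

lemma smooth_map_compose:
  fixes M :: "('a, 'e::real_normed_vector) smfd" and N :: "('b, 'f::real_normed_vector) smfd"
    and R :: "('c, 'd::real_normed_vector) smfd"
  assumes M: "\<forall>c\<in>charts M. is_chart (mtop M) c" and N: "smooth_manifold N"
    and R: "\<forall>c\<in>charts R. is_chart (mtop R) c"
    and f: "smooth_map M N f" and g: "smooth_map N R g"
  shows "smooth_map M R (g \<circ> f)"
proof (rule smooth_mapI)
  have cf: "continuous_map (mtop M) (mtop N) f" and cg: "continuous_map (mtop N) (mtop R) g"
    using f g by (auto dest: smooth_mapD)
  then show "continuous_map (mtop M) (mtop R) (g \<circ> f)"
    by (rule continuous_map_compose)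
  have N': "\<forall>c\<in>charts N. is_chart (mtop N) c" "\<Union> (fst ` charts N) = topspace (mtop N)"
    by (fact smooth_manifoldD[OF N])+
  obtain B :: "'f set" where B: "finite B" "span B = UNIV"
    using smooth_manifoldD(5)[OF N] by blast
  fix U \<phi> W \<theta> assume U: "(U, \<phi>) \<in> charts M" and W: "(W, \<theta>) \<in> charts R"
  note U' = is_chartD[OF bspec[OF M U]] and W' = is_chartD[OF bspec[OF R W]]
  show "smooth_on (\<phi> ` (U \<inter> (g \<circ> f) -` W)) (\<theta> \<circ> (g \<circ> f) \<circ> the_inv_into U \<phi>)"
  proof (rule smooth_on_local)
    fix y assume "y \<in> \<phi> ` (U \<inter> (g \<circ> f) -` W)"
    then obtain x where x: "x \<in> U" "g (f x) \<in> W" "y = \<phi> x" by auto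
    have fx: "f x \<in> topspace (mtop N)"
      using cf x(1) U'(5) by (meson continuous_map_image_subset_topspace image_subset_iff subsetD)
    obtain V \<psi> where V: "(V, \<psi>) \<in> charts N" "f x \<in> V"
      using smooth_manifold_chart_at[OF N fx] .
    note V' = is_chartD[OF bspec[OF N'(1) V(1)]]
    have "openin (mtop N) {y \<in> topspace (mtop N). g y \<in> W}"
      using cg W'(1) by (rule openin_continuous_map_preimage)
    moreover have "V \<inter> {y \<in> topspace (mtop N). g y \<in> W} = V \<inter> g -` W"
      using V'(5) by auto
    ultimately have oV: "openin (mtop N) (V \<inter> g -` W)"
      using openin_Int[OF V'(1), of "{y \<in> topspace (mtop N). g y \<in> W}"] by simp
    have "openin (mtop M) {x \<in> topspace (mtop M). f x \<in> V \<inter> g -` W}"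
      using cf oV by (rule openin_continuous_map_preimage)
    then have oU: "openin (mtop M) (U \<inter> {x \<in> topspace (mtop M). f x \<in> V \<inter> g -` W})"
      using U'(1) by blast
    let ?U = "U \<inter> {x \<in> topspace (mtop M). f x \<in> V \<inter> g -` W}"
    have op: "open (\<phi> ` ?U)" using oU U'(4) by blast
    have f': "smooth_on (\<phi> ` ?U) (\<psi> \<circ> f \<circ> the_inv_into U \<phi>)"
      by (rule smooth_on_subset[OF smooth_mapD(2)[OF f U V(1)]]) auto
    have g': "smooth_on (\<psi> ` (V \<inter> g -` W)) (\<theta> \<circ> g \<circ> the_inv_into V \<psi>)"
      by (rule smooth_mapD(2)[OF g V(1) W])
    have "smooth_on (\<phi> ` ?U) (\<lambda>x. (\<theta> \<circ> g \<circ> the_inv_into V \<psi>) ((\<psi> \<circ> f \<circ> the_inv_into U \<phi>) x))"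
      by (rule smooth_on_compose[OF B op g' f']) (auto simp: U'(2) the_inv_into_f_f)
    then have "smooth_on (\<phi> ` ?U) (\<theta> \<circ> (g \<circ> f) \<circ> the_inv_into U \<phi>)"
      by (rule smooth_on_cong[OF op, rotated]) (use U'(2) V'(2) in \<open>auto simp: the_inv_into_f_f\<close>)
    moreover have "y \<in> \<phi> ` ?U" using x V U'(5) by auto
    ultimately show "\<exists>U'. open U' \<and> y \<in> U' \<and> smooth_on U' (\<theta> \<circ> (g \<circ> f) \<circ> the_inv_into U \<phi>)"
      using op by blast
  qed
qed

lemma smooth_map_id:
  assumes "smooth_manifold M"
  shows "smooth_map M M (\<lambda>x. x)"
proof -
  have "smooth_on (\<phi> ` (U \<inter> V)) (\<psi> \<circ> the_inv_into U \<phi>)"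
    if "(U, \<phi>) \<in> charts M" "(V, \<psi>) \<in> charts M" for U \<phi> V \<psi>
    using smooth_manifoldD(6)[OF assms that] by (simp add: smooth_compatible_def)
  then show ?thesis
    by (auto simp: smooth_map_def comp_def)
qed

lemma diffeo_imp_smooth_map: "diffeo M N f \<Longrightarrow> smooth_map M N f"
  by (simp add: diffeo_def)

lemma diffeo_compose:
  assumes M: "smooth_manifold M" and N: "smooth_manifold N" and R: "smooth_manifold R"
    and f: "diffeo M N f" and g: "diffeo N R g"
  shows "diffeo M R (g \<circ> f)"
proof -
  have ch: "\<forall>c\<in>charts M. is_chart (mtop M) c" "\<forall>c\<in>charts R. is_chart (mtop R) c"
    using smooth_manifoldD(1) M R by blast+
  obtain f' where f': "smooth_map N M f'" "\<And>x. x \<in> topspace (mtop M) \<Longrightarrow> f' (f x) = x"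
      "\<And>y. y \<in> topspace (mtop N) \<Longrightarrow> f (f' y) = y"
    using f unfolding diffeo_def by blast
  obtain g' where g': "smooth_map R N g'" "\<And>x. x \<in> topspace (mtop N) \<Longrightarrow> g' (g x) = x"
      "\<And>y. y \<in> topspace (mtop R) \<Longrightarrow> g (g' y) = y"
    using g unfolding diffeo_def by blast
  have sm: "smooth_map M R (g \<circ> f)" "smooth_map R M (f' \<circ> g')"
    using f g f' g' ch N by (auto simp: diffeo_def intro!: smooth_map_compose)
  have "f x \<in> topspace (mtop N)" if "x \<in> topspace (mtop M)" for x
    using diffeo_imp_smooth_map[OF f] that by (rule smooth_map_in_topspace)
  moreover have "g' x \<in> topspace (mtop N)" if "x \<in> topspace (mtop R)" for x
    using g'(1) that by (rule smooth_map_in_topspace)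
  ultimately show ?thesis
    unfolding diffeo_def using sm f' g' by (intro conjI exI[of _ "f' \<circ> g'"]) auto
qed

lemma diffeo_cong:
  assumes M: "smooth_manifold M" and N: "smooth_manifold N"
    and fg: "\<And>x. x \<in> topspace (mtop M) \<Longrightarrow> f x = g x" and f: "diffeo M N f"
  shows "diffeo M N g"
proof -
  have ch: "\<forall>c\<in>charts M. is_chart (mtop M) c" "\<forall>c\<in>charts N. is_chart (mtop N) c"
    using smooth_manifoldD(1) M N by blast+
  obtain f' where f': "smooth_map N M f'" "\<And>x. x \<in> topspace (mtop M) \<Longrightarrow> f' (f x) = x"
      "\<And>y. y \<in> topspace (mtop N) \<Longrightarrow> f (f' y) = y"
    using f unfolding diffeo_def by blast
  have "g (f' y) = y" if "y \<in> topspace (mtop N)" for y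
    using f'(3)[OF that] fg[OF smooth_map_in_topspace[OF f'(1) that]] by simp
  moreover have "f' (g x) = x" if "x \<in> topspace (mtop M)" for x
    using f'(2)[OF that] fg[OF that] by simp
  moreover have "smooth_map M N g"
    by (rule smooth_map_cong[OF ch fg diffeo_imp_smooth_map[OF f]])
  ultimately show ?thesis
    unfolding diffeo_def using f'(1) by blast
qed

section \<open>Complex differentiability on finite sequences\<close>

abbreviation l1 :: "nat \<Rightarrow> (nat \<Rightarrow> complex) \<Rightarrow> real" where
  "l1 n x \<equiv> (\<Sum>i<n. cmod (x i))"

lemma l1_nonneg: "0 \<le> l1 n x"
  by (simp add: sum_nonneg)

lemma cmod_le_l1: "i < n \<Longrightarrow> cmod (x i) \<le> l1 n x"
  by (intro member_le_sum) auto

lemma l1_eq_0_iff: "x \<in> Cn n \<Longrightarrow> y \<in> Cn n \<Longrightarrow> l1 n (\<lambda>i. y i - x i) = 0 \<longleftrightarrow> y = x"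
  unfolding Cn_def fun_eq_iff by (auto simp: sum_nonneg_eq_0_iff) (metis lessThan_iff not_le)

lemma continuous_on_l1_diff: "continuous_on A (\<lambda>y. l1 n (\<lambda>i. y i - x i))"
  by (intro continuous_intros continuous_on_coordinate)

text \<open>Two elements of \<open>Cn n\<close> agree from coordinate \<open>n\<close> on, so a
  basic open box constrains only finitely many coordinates and the least of their radii
  works.\<close>

lemma open_contains_l1_ball:
  assumes S: "open S" and x: "x \<in> S" "x \<in> Cn n"
  obtains \<delta> where "\<delta> > 0" "\<And>y. y \<in> Cn n \<Longrightarrow> l1 n (\<lambda>i. y i - x i) < \<delta> \<Longrightarrow> y \<in> S"
proof -
  have "openin (product_topology (\<lambda>i. euclidean) UNIV) S"
    using S by (simp add: euclidean_product_topology)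
  then obtain V where V: "\<And>i. open (V i)" "x \<in> PiE UNIV V" "PiE UNIV V \<subseteq> S"
    using x(1) unfolding openin_product_topology_alt by (simp, blast)
  have "\<exists>e>0. ball (x i) e \<subseteq> V i" for i
    using V(1,2) open_contains_ball by blast
  then obtain e where e: "\<And>i. e i > 0" "\<And>i. ball (x i) (e i) \<subseteq> V i"
    by metis
  \<comment> \<open>The inserted 1 gives the minimum a meaning for \<open>n = 0\<close>.\<close>
  define \<delta> where "\<delta> = Min (insert 1 (e ` {..<n}))"
  have "\<delta> > 0" unfolding \<delta>_def using e(1) by (subst Min_gr_iff) auto
  moreover have "y \<in> S" if y: "y \<in> Cn n" "l1 n (\<lambda>i. y i - x i) < \<delta>" for y
  proof -
    have "y i \<in> V i" for i
    proof (cases "i < n")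
      case True
      then have "cmod (y i - x i) < \<delta>"
        using cmod_le_l1[of i n "\<lambda>i. y i - x i"] y(2) by simp
      also have "\<delta> \<le> e i" unfolding \<delta>_def using True by (intro Min_le) auto
      finally show ?thesis using e(2)[of i] by (auto simp: dist_norm norm_minus_commute)
    next
      case False
      then have "y i = x i" using y(1) x(2) by (simp add: Cn_def)
      then show ?thesis using V(2) by auto
    qed
    then show ?thesis using V(3) by auto
  qed
  ultimately show ?thesis using that by blast
qed

text \<open>On \<open>Cn n\<close> the product topology is the one of the l1 norm; this turns the
  filter in \<open>holo_on\<close> into an estimate with \<delta>.\<close>

lemma eventually_at_within_Cn:
  assumes U: "U \<subseteq> Cn n" and x: "x \<in> Cn n"
  shows "eventually P (at x within U) \<longleftrightarrow>
    (\<exists>\<delta>>0. \<forall>y\<in>U. 0 < l1 n (\<lambda>i. y i - x i) \<and> l1 n (\<lambda>i. y i - x i) < \<delta> \<longrightarrow> P y)" (is "?L \<longleftrightarrow> ?R")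
proof
  assume ?L
  then obtain S where S: "open S" "x \<in> S" "\<And>y. y \<in> S \<Longrightarrow> y \<noteq> x \<Longrightarrow> y \<in> U \<Longrightarrow> P y"
    by (auto simp: eventually_at_topological)
  obtain \<delta> where "\<delta> > 0" and d: "\<And>y. y \<in> Cn n \<Longrightarrow> l1 n (\<lambda>i. y i - x i) < \<delta> \<Longrightarrow> y \<in> S"
    using open_contains_l1_ball[OF S(1,2) x] by blast
  moreover have "P y" if "y \<in> U" "0 < l1 n (\<lambda>i. y i - x i)" "l1 n (\<lambda>i. y i - x i) < \<delta>" for y
  proof (rule S(3))
    show "y \<in> S" using d[of y] that U by blast
    show "y \<noteq> x" using that(2) by auto
  qed (fact that(1))
  ultimately show ?R by blast
next
  assume ?R
  then obtain \<delta> where d: "\<delta> > 0"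
    "\<And>y. y \<in> U \<Longrightarrow> 0 < l1 n (\<lambda>i. y i - x i) \<Longrightarrow> l1 n (\<lambda>i. y i - x i) < \<delta> \<Longrightarrow> P y" by blast
  have "open {y. l1 n (\<lambda>i. y i - x i) < \<delta>}"
    by (intro open_Collect_less continuous_on_l1_diff continuous_intros)
  moreover have "P y" if "y \<in> {y. l1 n (\<lambda>i. y i - x i) < \<delta>}" "y \<noteq> x" "y \<in> U" for y
    using that d(2)[of y] l1_eq_0_iff[OF x, of y] U l1_nonneg[of "\<lambda>i. y i - x i" n]
    by (simp add: subset_iff order.order_iff_strict)
  ultimately show ?L
    unfolding eventually_at_topological using d(1)
    by (intro exI[of _ "{y. l1 n (\<lambda>i. y i - x i) < \<delta>}"]) auto
qed

text \<open>Differentiability with the denominator cleared, for a fixed Jacobian \<open>A\<close>,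
  which is the form suited to the chain rule. The point \<open>y = x\<close> may be included because
  both sides vanish there.\<close>

definition holo_at ::
    "nat \<Rightarrow> nat \<Rightarrow> (nat \<Rightarrow> complex) set \<Rightarrow> ((nat \<Rightarrow> complex) \<Rightarrow> nat \<Rightarrow> complex) \<Rightarrow> (nat \<Rightarrow> complex)
      \<Rightarrow> (nat \<Rightarrow> nat \<Rightarrow> complex) \<Rightarrow> bool" where
  "holo_at n m U f x A \<longleftrightarrow> (\<forall>\<epsilon>>0. \<exists>\<delta>>0. \<forall>y\<in>U. l1 n (\<lambda>i. y i - x i) < \<delta> \<longrightarrow>
     (\<forall>j<m. cmod (f y j - f x j - (\<Sum>i<n. A j i * (y i - x i))) \<le> \<epsilon> * l1 n (\<lambda>i. y i - x i)))"

lemma tendsto_quotient_l1_iff: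
  assumes U: "U \<subseteq> Cn n" and x: "x \<in> U"
  shows "((\<lambda>y. F y / of_real (l1 n (\<lambda>i. y i - x i))) \<longlongrightarrow> 0) (at x within U) \<longleftrightarrow>
    (\<forall>\<epsilon>>0. eventually (\<lambda>y. cmod (F y) \<le> \<epsilon> * l1 n (\<lambda>i. y i - x i)) (at x within U))" (is "?L \<longleftrightarrow> ?R")
proof -
  have pos: "eventually (\<lambda>y. 0 < l1 n (\<lambda>i. y i - x i)) (at x within U)"
    by (subst eventually_at_within_Cn[OF U]) (use U x in \<open>auto intro: exI[of _ 1]\<close>)
  have "?L \<longleftrightarrow> (\<forall>\<epsilon>>0. eventually (\<lambda>y. cmod (F y) / l1 n (\<lambda>i. y i - x i) < \<epsilon>) (at x within U))"
    by (simp add: tendsto_iff norm_divide abs_of_nonneg[OF sum_nonneg] del: of_real_sum)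
  also have "\<dots> \<longleftrightarrow> ?R"
  proof (intro iffI allI impI)
    fix \<epsilon> :: real
    assume "\<forall>\<epsilon>>0. eventually (\<lambda>y. cmod (F y) / l1 n (\<lambda>i. y i - x i) < \<epsilon>) (at x within U)" "\<epsilon> > 0"
    then have "eventually (\<lambda>y. cmod (F y) / l1 n (\<lambda>i. y i - x i) < \<epsilon>) (at x within U)" by blast
    with pos show "eventually (\<lambda>y. cmod (F y) \<le> \<epsilon> * l1 n (\<lambda>i. y i - x i)) (at x within U)"
      by eventually_elim (simp add: pos_divide_less_eq)
  next
    fix \<epsilon> :: real
    assume "\<forall>\<epsilon>>0. eventually (\<lambda>y. cmod (F y) \<le> \<epsilon> * l1 n (\<lambda>i. y i - x i)) (at x within U)" "\<epsilon> > 0"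
    \<comment> \<open>Half of \<epsilon> turns the weak inequality into the strict one that
      \<open>tendsto_iff\<close> demands.\<close>
    then have "eventually (\<lambda>y. cmod (F y) \<le> (\<epsilon>/2) * l1 n (\<lambda>i. y i - x i)) (at x within U)"
      using half_gt_zero by blast
    with pos show "eventually (\<lambda>y. cmod (F y) / l1 n (\<lambda>i. y i - x i) < \<epsilon>) (at x within U)"
    proof eventually_elim
      case (elim y)
      have "(\<epsilon>/2) * l1 n (\<lambda>i. y i - x i) < \<epsilon> * l1 n (\<lambda>i. y i - x i)"
        using elim(1) \<open>\<epsilon> > 0\<close> by (intro mult_strict_right_mono) auto
      then show ?case using elim by (simp add: pos_divide_less_eq)
    qed
  qed
  finally show ?thesis .
qed

lemma holo_on_iff_holo_at:
  assumes U: "U \<subseteq> Cn n"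
  shows "holo_on n m U f \<longleftrightarrow> (\<forall>x\<in>U. \<exists>A. holo_at n m U f x A)"
proof -
  have "(\<forall>j<m. ((\<lambda>y. (f y j - f x j - (\<Sum>i<n. A j i * (y i - x i)))
             / of_real (l1 n (\<lambda>i. y i - x i))) \<longlongrightarrow> 0) (at x within U)) \<longleftrightarrow> holo_at n m U f x A"
    (is "?L \<longleftrightarrow> _") if x: "x \<in> U" for x A
  proof -
    let ?F = "\<lambda>j y. f y j - f x j - (\<Sum>i<n. A j i * (y i - x i))"
    have xC: "x \<in> Cn n" using U x by blast
    have "?L \<longleftrightarrow> (\<forall>j\<in>{..<m}. \<forall>\<epsilon>>0. eventually (\<lambda>y. cmod (?F j y) \<le> \<epsilon> * l1 n (\<lambda>i. y i - x i)) (at x within U))"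
      unfolding tendsto_quotient_l1_iff[OF U x] Ball_def lessThan_iff by (rule refl)
    also have "\<dots> \<longleftrightarrow> (\<forall>\<epsilon>>0. \<forall>j\<in>{..<m}. eventually (\<lambda>y. cmod (?F j y) \<le> \<epsilon> * l1 n (\<lambda>i. y i - x i)) (at x within U))"
      by blast
    also have "\<dots> \<longleftrightarrow> (\<forall>\<epsilon>>0. eventually (\<lambda>y. \<forall>j\<in>{..<m}. cmod (?F j y) \<le> \<epsilon> * l1 n (\<lambda>i. y i - x i)) (at x within U))"
      by (simp add: eventually_ball_finite_distrib)
    also have "\<dots> \<longleftrightarrow> holo_at n m U f x A"
    proof -
      have eq: "(0 < l1 n (\<lambda>i. y i - x i) \<and> l1 n (\<lambda>i. y i - x i) < \<delta> \<longrightarrow>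
          (\<forall>j\<in>{..<m}. cmod (?F j y) \<le> \<epsilon> * l1 n (\<lambda>i. y i - x i))) \<longleftrightarrow>
         (l1 n (\<lambda>i. y i - x i) < \<delta> \<longrightarrow> (\<forall>j<m. cmod (?F j y) \<le> \<epsilon> * l1 n (\<lambda>i. y i - x i)))"
        if "y \<in> U" for \<epsilon> \<delta> y
      proof -
        have yC: "y \<in> Cn n" using U that by blast
        have "0 < l1 n (\<lambda>i. y i - x i) \<or> y = x"
          using l1_eq_0_iff[OF xC yC] l1_nonneg[of "\<lambda>i. y i - x i" n] by linarith
        then show ?thesis by auto
      qed
      show ?thesis
        unfolding holo_at_def eventually_at_within_Cn[OF U xC]
        by (rule all_cong, rule ex_cong, rule ball_cong[OF refl], rule eq)
    qed
    finally show ?thesis .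
  qed
  then show ?thesis
    unfolding holo_on_def by simp
qed

lemma holo_on_cong:
  assumes "U \<subseteq> Cn n" "\<And>x. x \<in> U \<Longrightarrow> f x = g x" "holo_on n m U f"
  shows "holo_on n m U g"
  using assms by (simp add: holo_on_iff_holo_at holo_at_def)

lemma holo_on_subset: "holo_on n m V f \<Longrightarrow> U \<subseteq> V \<Longrightarrow> holo_on n m U f"
  unfolding holo_on_def by (meson subsetD tendsto_within_subset)

lemma holo_on_local:
  assumes "\<And>x. x \<in> U \<Longrightarrow> \<exists>W. openin (top_of_set U) W \<and> x \<in> W \<and> holo_on n m W f"
  shows "holo_on n m U f"
  unfolding holo_on_def
proof
  fix x assume "x \<in> U"
  then obtain W where W: "openin (top_of_set U) W" "x \<in> W" "holo_on n m W f"
    using assms by blast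
  then obtain S where S: "open S" "W = U \<inter> S" by (auto simp: openin_open)
  have eq: "at x within W = at x within U"
    using S W by (intro at_within_nhd[of x S]) auto
  show "\<exists>A. \<forall>j<m. ((\<lambda>y. (f y j - f x j - (\<Sum>i<n. A j i * (y i - x i)))
     / complex_of_real (\<Sum>i<n. cmod (y i - x i))) \<longlongrightarrow> 0) (at x within U)"
    using bspec[OF W(3)[unfolded holo_on_def] W(2)] unfolding eq .
qed

lemma holo_on_matrix:
  assumes "U \<subseteq> Cn n" "\<And>x j. x \<in> U \<Longrightarrow> j < m \<Longrightarrow> f x j = (\<Sum>i<n. A j i * x i)"
  shows "holo_on n m U f"
proof -
  have "holo_at n m U f x A" if "x \<in> U" for x
    unfolding holo_at_def
  proof (intro allI impI exI[of _ "1::real"] conjI ballI zero_less_one)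
    fix \<epsilon> :: real and y j assume "\<epsilon> > 0" "y \<in> U" "j < m"
    then show "cmod (f y j - f x j - (\<Sum>i<n. A j i * (y i - x i))) \<le> \<epsilon> * l1 n (\<lambda>i. y i - x i)"
      using that l1_nonneg[of "\<lambda>i. y i - x i" n]
      by (simp add: assms(2) right_diff_distrib sum_subtractf)
  qed
  then show ?thesis
    using holo_on_iff_holo_at[OF assms(1)] by blast
qed

lemma holo_on_compose:
  assumes U: "U \<subseteq> Cn n" and V: "V \<subseteq> Cn m" and g: "holo_on m k V g" and f: "holo_on n m U f"
    and fUV: "f ` U \<subseteq> V"
  shows "holo_on n k U (\<lambda>x. g (f x))"
proof -
  have "\<exists>A. holo_at n k U (\<lambda>x. g (f x)) x A" if x: "x \<in> U" for x
  proof -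
    let ?d = "\<lambda>y. l1 n (\<lambda>i. y i - x i)" and ?D = "\<lambda>y. l1 m (\<lambda>j. f y j - f x j)"
    obtain A where A: "holo_at n m U f x A"
      using f x holo_on_iff_holo_at[OF U] by blast
    obtain B where B: "holo_at m k V g (f x) B"
      using g x fUV holo_on_iff_holo_at[OF V] by blast
    define a where "a = (\<Sum>j<m. \<Sum>i<n. cmod (A j i))"
    define b where "b = (\<Sum>l<k. \<Sum>j<m. cmod (B l j))"
    \<comment> \<open>A local Lipschitz constant of \<open>f\<close> at \<open>x\<close>: each of
      the \<open>m\<close> coordinates changes by at most \<open>1 + a\<close> times the l1
      distance, where \<open>a\<close> bounds the linear part and 1 the remainder.\<close>
    define C where "C = real m * (1 + a)"
    have nn: "a \<ge> 0" "b \<ge> 0" "C \<ge> 0" by (simp_all add: a_def b_def C_def sum_nonneg)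
    obtain \<delta>0 where d0: "\<delta>0 > 0" and
      f0: "\<And>y j. y \<in> U \<Longrightarrow> ?d y < \<delta>0 \<Longrightarrow> j < m \<Longrightarrow>
        cmod (f y j - f x j - (\<Sum>i<n. A j i * (y i - x i))) \<le> 1 * ?d y"
      using A zero_less_one unfolding holo_at_def by blast
    have Dd: "?D y \<le> C * ?d y" if y: "y \<in> U" "?d y < \<delta>0" for y
    proof -
      have "cmod (f y j - f x j) \<le> (1 + a) * ?d y" if j: "j < m" for j
      proof -
        have "cmod (\<Sum>i<n. A j i * (y i - x i)) \<le> (\<Sum>i<n. cmod (A j i) * ?d y)"
          by (intro sum_norm_le) (auto simp: norm_mult intro!: mult_left_mono cmod_le_l1[of _ n "\<lambda>i. y i - x i"])
        also have "\<dots> = (\<Sum>i<n. cmod (A j i)) * ?d y" by (simp add: sum_distrib_right)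
        also have "\<dots> \<le> a * ?d y"
          unfolding a_def using j
          by (intro mult_right_mono l1_nonneg member_le_sum[of j "{..<m}" "\<lambda>j. \<Sum>i<n. cmod (A j i)"])
            (auto simp: sum_nonneg)
        finally show ?thesis
          using f0[OF y j] norm_triangle_sub[of "f y j - f x j" "\<Sum>i<n. A j i * (y i - x i)"]
          by (simp add: distrib_right)
      qed
      then have "?D y \<le> (\<Sum>j<m. (1 + a) * ?d y)" by (intro sum_mono) auto
      then show ?thesis by (simp add: C_def mult.assoc)
    qed
    have "holo_at n k U (\<lambda>x. g (f x)) x (\<lambda>l i. \<Sum>j<m. B l j * A j i)"
      unfolding holo_at_def
    proof (intro allI impI)
      fix \<epsilon> :: real assume e: "\<epsilon> > 0"
      \<comment> \<open>The error has two halves: \<open>e1\<close> pays for the remainder of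
        \<open>g\<close> at distance up to \<open>C\<close> times the original one, and
        \<open>e2\<close> for the remainder of \<open>f\<close> after applying \<open>B\<close>.
        Adding 1 keeps the denominators positive.\<close>
      define e1 where "e1 = \<epsilon> / (2 * (C + 1))"
      define e2 where "e2 = \<epsilon> / (2 * (b + 1))"
      have e12: "e1 > 0" "e2 > 0" using e nn by (simp_all add: e1_def e2_def)
      obtain \<delta>1 where d1: "\<delta>1 > 0" and
        g1: "\<And>z l. z \<in> V \<Longrightarrow> l1 m (\<lambda>j. z j - f x j) < \<delta>1 \<Longrightarrow> l < k \<Longrightarrow>
          cmod (g z l - g (f x) l - (\<Sum>j<m. B l j * (z j - f x j))) \<le> e1 * l1 m (\<lambda>j. z j - f x j)"
        using B e12(1) unfolding holo_at_def by blast
      obtain \<delta>2 where d2: "\<delta>2 > 0" and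
        f2: "\<And>y j. y \<in> U \<Longrightarrow> ?d y < \<delta>2 \<Longrightarrow> j < m \<Longrightarrow>
          cmod (f y j - f x j - (\<Sum>i<n. A j i * (y i - x i))) \<le> e2 * ?d y"
        using A e12(2) unfolding holo_at_def by blast
      \<comment> \<open>The bound \<open>\<delta>1 / (C + 1)\<close> puts \<open>f y\<close> within
        \<delta>1 of \<open>f x\<close> by the Lipschitz estimate.\<close>
      let ?\<delta> = "min \<delta>0 (min \<delta>2 (\<delta>1 / (C + 1)))"
      show "\<exists>\<delta>>0. \<forall>y\<in>U. ?d y < \<delta> \<longrightarrow> (\<forall>l<k. cmod (g (f y) l - g (f x) l
          - (\<Sum>i<n. (\<Sum>j<m. B l j * A j i) * (y i - x i))) \<le> \<epsilon> * ?d y)"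
      proof (intro exI[of _ ?\<delta>] conjI ballI allI impI)
        show "?\<delta> > 0" using d0 d1 d2 nn by simp
        fix y l assume y: "y \<in> U" "?d y < ?\<delta>" and l: "l < k"
        have dn: "?d y \<ge> 0" by (rule l1_nonneg)
        have D: "?D y \<le> C * ?d y" using Dd y by simp
        also have "\<dots> \<le> (C + 1) * ?d y" using dn by (intro mult_right_mono) auto
        also have "\<dots> < \<delta>1" using y(2) nn by (simp add: pos_less_divide_eq mult.commute)
        finally have "cmod (g (f y) l - g (f x) l - (\<Sum>j<m. B l j * (f y j - f x j))) \<le> e1 * ?D y"
          using g1[of "f y" l] fUV y(1) l by auto
        also have "\<dots> \<le> e1 * (C * ?d y)" using D e12 by (intro mult_left_mono) auto
        also have "\<dots> \<le> (\<epsilon>/2) * ?d y"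
        proof -
          have "e1 * C \<le> \<epsilon>/2" using e nn by (simp add: e1_def field_simps)
          then show ?thesis using mult_right_mono[OF _ dn, of "e1 * C" "\<epsilon>/2"] by (simp add: mult.assoc)
        qed
        finally have 1: "cmod (g (f y) l - g (f x) l - (\<Sum>j<m. B l j * (f y j - f x j))) \<le> (\<epsilon>/2) * ?d y" .
        let ?E = "\<lambda>j. f y j - f x j - (\<Sum>i<n. A j i * (y i - x i))"
        have "cmod (\<Sum>j<m. B l j * ?E j) \<le> (\<Sum>j<m. cmod (B l j) * (e2 * ?d y))"
          using f2 y by (intro sum_norm_le) (auto simp: norm_mult intro!: mult_left_mono)
        also have "\<dots> = (\<Sum>j<m. cmod (B l j)) * (e2 * ?d y)" by (simp add: sum_distrib_right)
        also have "\<dots> \<le> b * (e2 * ?d y)"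
          unfolding b_def using l e12 dn
          by (intro mult_right_mono member_le_sum[of l "{..<k}" "\<lambda>l. \<Sum>j<m. cmod (B l j)"])
            (auto simp: sum_nonneg)
        also have "\<dots> \<le> (\<epsilon>/2) * ?d y"
        proof -
          have "b * e2 \<le> \<epsilon>/2" using e nn by (simp add: e2_def field_simps)
          then show ?thesis using mult_right_mono[OF _ dn, of "b * e2" "\<epsilon>/2"] by (simp add: mult.assoc)
        qed
        finally have 2: "cmod (\<Sum>j<m. B l j * ?E j) \<le> (\<epsilon>/2) * ?d y" .
        have "(\<Sum>i<n. (\<Sum>j<m. B l j * A j i) * (y i - x i)) = (\<Sum>j<m. B l j * (\<Sum>i<n. A j i * (y i - x i)))"
          unfolding sum_distrib_left sum_distrib_right by (subst sum.swap) (simp add: mult.assoc)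
        then have "g (f y) l - g (f x) l - (\<Sum>i<n. (\<Sum>j<m. B l j * A j i) * (y i - x i))
          = (g (f y) l - g (f x) l - (\<Sum>j<m. B l j * (f y j - f x j))) + (\<Sum>j<m. B l j * ?E j)"
          by (simp add: right_diff_distrib sum_subtractf)
        then show "cmod (g (f y) l - g (f x) l - (\<Sum>i<n. (\<Sum>j<m. B l j * A j i) * (y i - x i))) \<le> \<epsilon> * ?d y"
          using norm_triangle_mono[OF 1 2] by (simp add: field_simps)
      qed
    qed
    then show ?thesis by blast
  qed
  then show ?thesis using holo_on_iff_holo_at[OF U] by blast
qed

section \<open>The category of equivariant complex manifolds\<close>

lemma is_cchartD:
  assumes "is_cchart X a n (U, \<phi>)"
  shows "U \<subseteq> Cn n" "inj_on \<phi> U" "openin X (\<phi> ` U)" "continuous_map (top_of_set U) X \<phi>"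
    "\<And>x. x \<in> U \<Longrightarrow> \<phi> x \<in> topspace X" "openin (top_of_set (Cn n)) U"
    "homeomorphic_map (top_of_set U) (subtopology X (\<phi> ` U)) \<phi>"
proof -
  have h: "homeomorphic_map (top_of_set U) (subtopology X (\<phi> ` U)) \<phi>" "openin X (\<phi> ` U)"
     "openin (top_of_set (Cn n)) U"
    using assms by (auto simp: is_cchart_def)
  then show "homeomorphic_map (top_of_set U) (subtopology X (\<phi> ` U)) \<phi>" "openin X (\<phi> ` U)"
     "openin (top_of_set (Cn n)) U" by blast+
  show "U \<subseteq> Cn n" using openin_subset[OF h(3)] by simp
  show "inj_on \<phi> U" using homeomorphic_imp_injective_map[OF h(1)] by simp
  show "continuous_map (top_of_set U) X \<phi>"
    using homeomorphic_imp_continuous_map[OF h(1)] continuous_map_into_fulltopology by blast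
  show "\<phi> x \<in> topspace X" if "x \<in> U" for x
    using openin_subset[OF h(2)] that by blast
qed

lemma Cx_manifoldD:
  assumes "Cx_manifold M"
  shows "\<And>c. c \<in> ccharts M \<Longrightarrow> is_cchart (ctop M) (cact M) (cdim M) c"
    "(\<Union>(U, \<phi>)\<in>ccharts M. \<phi> ` U) = topspace (ctop M)"
    "\<And>c d. c \<in> ccharts M \<Longrightarrow> d \<in> ccharts M \<Longrightarrow> holo_compatible (cdim M) c d"
  using assms unfolding Cx_manifold_def by (elim conjE; assumption | blast)+

lemma Cx_manifold_chart_at:
  assumes "Cx_manifold M" "x \<in> topspace (ctop M)"
  obtains U \<phi> u where "(U, \<phi>) \<in> ccharts M" "u \<in> U" "x = \<phi> u"
  using assms Cx_manifoldD(2) by blast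

lemma Cx_holo_mapD:
  assumes "Cx_holo_map M N f"
  shows "continuous_map (ctop M) (ctop N) f"
    "\<And>c x. x \<in> topspace (ctop M) \<Longrightarrow> c \<noteq> 0 \<Longrightarrow> f (cact M c x) = cact N c (f x)"
    "\<And>U \<phi> V \<psi>. (U, \<phi>) \<in> ccharts M \<Longrightarrow> (V, \<psi>) \<in> ccharts N \<Longrightarrow>
        holo_on (cdim M) (cdim N) {x \<in> U. f (\<phi> x) \<in> \<psi> ` V} (the_inv_into V \<psi> \<circ> f \<circ> \<phi>)"
  using assms unfolding Cx_holo_map_def by blast+

lemma Cx_holo_mapI:
  assumes "continuous_map (ctop M) (ctop N) f"
    "\<And>c x. x \<in> topspace (ctop M) \<Longrightarrow> c \<noteq> 0 \<Longrightarrow> f (cact M c x) = cact N c (f x)"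
    "\<And>U \<phi> V \<psi>. (U, \<phi>) \<in> ccharts M \<Longrightarrow> (V, \<psi>) \<in> ccharts N \<Longrightarrow>
        holo_on (cdim M) (cdim N) {x \<in> U. f (\<phi> x) \<in> \<psi> ` V} (the_inv_into V \<psi> \<circ> f \<circ> \<phi>)"
  shows "Cx_holo_map M N f"
  using assms unfolding Cx_holo_map_def by blast

lemma continuous_map_in_topspace:
  "continuous_map X Y f \<Longrightarrow> x \<in> topspace X \<Longrightarrow> f x \<in> topspace Y"
  using continuous_map_image_subset_topspace by blast

lemma Cx_action_closed:
  assumes "Cx_manifold M" "x \<in> topspace (ctop M)" "c \<noteq> 0"
  shows "cact M c x \<in> topspace (ctop M)"
proof -
  have "continuous_map (prod_topology (top_of_set (UNIV - {0})) (ctop M)) (ctop M) (\<lambda>(c, x). cact M c x)"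
    using assms(1) unfolding Cx_manifold_def Cx_space_def by blast
  from continuous_map_in_topspace[OF this, of "(c, x)"] show ?thesis
    using assms(2,3) by simp
qed

lemma Cx_holo_map_cong:
  assumes M: "Cx_manifold M" and fg: "\<And>x. x \<in> topspace (ctop M) \<Longrightarrow> f x = g x" and f: "Cx_holo_map M N f"
  shows "Cx_holo_map M N g"
proof (rule Cx_holo_mapI)
  show "continuous_map (ctop M) (ctop N) g"
    by (rule continuous_map_eq[OF Cx_holo_mapD(1)[OF f]]) (rule fg)
  show "g (cact M c x) = cact N c (g x)" if "x \<in> topspace (ctop M)" "c \<noteq> 0" for c x
    using Cx_holo_mapD(2)[OF f that] fg[OF that(1)] fg[OF Cx_action_closed[OF M that]] by simp
  fix U \<phi> V \<psi> assume U: "(U, \<phi>) \<in> ccharts M" and V: "(V, \<psi>) \<in> ccharts N"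
  note c = is_cchartD[OF Cx_manifoldD(1)[OF M U]]
  have "{x \<in> U. f (\<phi> x) \<in> \<psi> ` V} = {x \<in> U. g (\<phi> x) \<in> \<psi> ` V}"
    using fg c(5) by auto
  moreover have "holo_on (cdim M) (cdim N) {x \<in> U. f (\<phi> x) \<in> \<psi> ` V} (the_inv_into V \<psi> \<circ> g \<circ> \<phi>)"
    by (rule holo_on_cong[OF _ _ Cx_holo_mapD(3)[OF f U V]]) (use fg c(1,5) in auto)
  ultimately show "holo_on (cdim M) (cdim N) {x \<in> U. g (\<phi> x) \<in> \<psi> ` V} (the_inv_into V \<psi> \<circ> g \<circ> \<phi>)"
    by simp
qed

text \<open>As for smooth maps, an intermediate chart of \<open>N\<close> factors the local
  expression. The points mapped into that chart form a relatively open set, which suffices by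
  \<open>holo_on_local\<close>.\<close>

lemma Cx_holo_map_compose:
  assumes M: "Cx_manifold M" and N: "Cx_manifold N" and R: "Cx_manifold R"
    and f: "Cx_holo_map M N f" and g: "Cx_holo_map N R g"
  shows "Cx_holo_map M R (g \<circ> f)"
proof (rule Cx_holo_mapI)
  show "continuous_map (ctop M) (ctop R) (g \<circ> f)"
    by (rule continuous_map_compose[OF Cx_holo_mapD(1)[OF f] Cx_holo_mapD(1)[OF g]])
  show "(g \<circ> f) (cact M c x) = cact R c ((g \<circ> f) x)" if "x \<in> topspace (ctop M)" "c \<noteq> 0" for c x
    using Cx_holo_mapD(2)[OF f that]
      Cx_holo_mapD(2)[OF g continuous_map_in_topspace[OF Cx_holo_mapD(1)[OF f] that(1)] that(2)] by simp
  fix U \<phi> W \<theta> assume U: "(U, \<phi>) \<in> ccharts M" and W: "(W, \<theta>) \<in> ccharts R"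
  note cU = is_cchartD[OF Cx_manifoldD(1)[OF M U]] and cW = is_cchartD[OF Cx_manifoldD(1)[OF R W]]
  let ?S = "{x \<in> U. (g \<circ> f) (\<phi> x) \<in> \<theta> ` W}"
  show "holo_on (cdim M) (cdim R) ?S (the_inv_into W \<theta> \<circ> (g \<circ> f) \<circ> \<phi>)"
  proof (rule holo_on_local)
    fix x assume x: "x \<in> ?S"
    have "f (\<phi> x) \<in> topspace (ctop N)"
      using x cU(5) by (intro continuous_map_in_topspace[OF Cx_holo_mapD(1)[OF f]]) auto
    then obtain V \<psi> v where V: "(V, \<psi>) \<in> ccharts N" "v \<in> V" "f (\<phi> x) = \<psi> v"
      using Cx_manifold_chart_at[OF N] by metis
    note cV = is_cchartD[OF Cx_manifoldD(1)[OF N V(1)]]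
    let ?f = "the_inv_into V \<psi> \<circ> f \<circ> \<phi>" and ?g = "the_inv_into W \<theta> \<circ> g \<circ> \<psi>"
    have "openin (top_of_set U) {x \<in> topspace (top_of_set U). (f \<circ> \<phi>) x \<in> \<psi> ` V}"
      by (rule openin_continuous_map_preimage[OF continuous_map_compose[OF cU(4) Cx_holo_mapD(1)[OF f]] cV(3)])
    then obtain T where T: "open T" "{x \<in> U. f (\<phi> x) \<in> \<psi> ` V} = U \<inter> T"
      by (auto simp: openin_open)
    let ?W = "?S \<inter> T"
    have Wsub: "?W \<subseteq> {x \<in> U. f (\<phi> x) \<in> \<psi> ` V}" using T(2) by blast
    have inv: "?f y \<in> V" "\<psi> (?f y) = f (\<phi> y)" if "y \<in> ?W" for y
    proof -
      have *: "f (\<phi> y) \<in> \<psi> ` V" using that Wsub by blast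
      show "?f y \<in> V" using the_inv_into_into[OF cV(2) *] by simp
      show "\<psi> (?f y) = f (\<phi> y)" using f_the_inv_into_f[OF cV(2) *] by simp
    qed
    have "holo_on (cdim M) (cdim R) ?W (\<lambda>x. ?g (?f x))"
    proof (rule holo_on_compose[OF _ _ Cx_holo_mapD(3)[OF g V(1) W] holo_on_subset[OF Cx_holo_mapD(3)[OF f U V(1)] Wsub]])
      show "?f ` ?W \<subseteq> {x \<in> V. g (\<psi> x) \<in> \<theta> ` W}"
        using inv by auto
    qed (use cU(1) cV(1) in auto)
    then have "holo_on (cdim M) (cdim R) ?W (the_inv_into W \<theta> \<circ> (g \<circ> f) \<circ> \<phi>)"
      by (rule holo_on_cong[rotated 2]) (use cU(1) inv(2) in auto)
    moreover have "openin (top_of_set ?S) ?W" using T(1) by (auto simp: openin_open)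
    moreover have "x \<in> ?W" using x V T(2) by auto
    ultimately show "\<exists>W'. openin (top_of_set ?S) W' \<and> x \<in> W' \<and>
        holo_on (cdim M) (cdim R) W' (the_inv_into W \<theta> \<circ> (g \<circ> f) \<circ> \<phi>)"
      by blast
  qed
qed

lemma Cx_holo_map_id:
  assumes M: "Cx_manifold M"
  shows "Cx_holo_map M M (\<lambda>x. x)"
proof (rule Cx_holo_mapI)
  fix U \<phi> V \<psi> assume "(U, \<phi>) \<in> ccharts M" "(V, \<psi>) \<in> ccharts M"
  from Cx_manifoldD(3)[OF M this]
  show "holo_on (cdim M) (cdim M) {x \<in> U. \<phi> x \<in> \<psi> ` V} (the_inv_into V \<psi> \<circ> (\<lambda>x. x) \<circ> \<phi>)"
    by (simp add: holo_compatible_def comp_def)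
qed auto

lemma is_categoryI:
  assumes "\<And>X. X \<in> Obj C \<Longrightarrow> Id C X \<in> Hom C X X"
    and "\<And>X Y Z f g. X \<in> Obj C \<Longrightarrow> Y \<in> Obj C \<Longrightarrow> Z \<in> Obj C \<Longrightarrow> f \<in> Hom C X Y \<Longrightarrow> g \<in> Hom C Y Z
      \<Longrightarrow> Comp C X Y Z g f \<in> Hom C X Z"
    and "\<And>X Y f. X \<in> Obj C \<Longrightarrow> Y \<in> Obj C \<Longrightarrow> f \<in> Hom C X Y \<Longrightarrow> Comp C X X Y f (Id C X) = f"
    and "\<And>X Y f. X \<in> Obj C \<Longrightarrow> Y \<in> Obj C \<Longrightarrow> f \<in> Hom C X Y \<Longrightarrow> Comp C X Y Y (Id C Y) f = f"
    and "\<And>W X Y Z f g h. W \<in> Obj C \<Longrightarrow> X \<in> Obj C \<Longrightarrow> Y \<in> Obj C \<Longrightarrow> Z \<in> Obj C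
      \<Longrightarrow> f \<in> Hom C W X \<Longrightarrow> g \<in> Hom C X Y \<Longrightarrow> h \<in> Hom C Y Z
      \<Longrightarrow> Comp C W Y Z h (Comp C W X Y g f) = Comp C W X Z (Comp C X Y Z h g) f"
  shows "is_category C"
  using assms unfolding is_category_def by simp

lemma is_category_CxMfd: "is_category (CxMfd :: ('a cmfd, 'a \<Rightarrow> 'a) cat)"
proof -
  have sub: "f x \<in> topspace (ctop N)" if "Cx_holo_map M N f" "x \<in> topspace (ctop M)"
    for M N :: "'a cmfd" and f x
    using continuous_map_in_topspace[OF Cx_holo_mapD(1)[OF that(1)] that(2)] .
  show ?thesis
  proof (rule is_categoryI)
    fix M :: "'a cmfd" assume "M \<in> Obj CxMfd"
    then have *: "Cx_manifold M" by (simp add: CxMfd_def)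
    have "Cx_holo_map M M (\<lambda>x\<in>topspace (ctop M). x)"
      by (rule Cx_holo_map_cong[OF * _ Cx_holo_map_id[OF *]]) simp
    then show "Id CxMfd M \<in> Hom CxMfd M M"
      by (simp add: CxMfd_def)
  next
    fix M N R :: "'a cmfd" and f g
    assume "M \<in> Obj CxMfd" "N \<in> Obj CxMfd" "R \<in> Obj CxMfd" "f \<in> Hom CxMfd M N" "g \<in> Hom CxMfd N R"
    then have *: "Cx_manifold M" "Cx_holo_map M R (g \<circ> f)"
      by (auto simp: CxMfd_def intro: Cx_holo_map_compose)
    have "Cx_holo_map M R (compose (topspace (ctop M)) g f)"
      by (rule Cx_holo_map_cong[OF *(1) _ *(2)]) (simp add: compose_def)
    then show "Comp CxMfd M N R g f \<in> Hom CxMfd M R"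
      by (simp add: CxMfd_def compose_def)
  qed (auto simp: CxMfd_def compose_def fun_eq_iff extensional_def sub)
qed

section \<open>Topological preliminaries\<close>

text \<open>The tube lemma: a universal quantifier over a compact set preserves openness. It yields
  both the continuity of linear maps into the compact-open topology and the openness of the frame
  condition.\<close>

lemma openin_all_compactin:
  assumes W: "openin (prod_topology X Z) W" and K: "compactin Z K"
  shows "openin X {x \<in> topspace X. \<forall>z\<in>K. (x, z) \<in> W}"
proof (subst openin_subopen, intro ballI)
  fix x assume x: "x \<in> {x \<in> topspace X. \<forall>z\<in>K. (x, z) \<in> W}"
  then obtain U V where "openin X U" "openin Z V" "x \<in> U" "K \<subseteq> V" "U \<times> V \<subseteq> W"
    using tube_lemma_right[OF W K, of x] by auto
  then show "\<exists>U. openin X U \<and> x \<in> U \<and> U \<subseteq> {x \<in> topspace X. \<forall>z\<in>K. (x, z) \<in> W}"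
    using openin_subset[of X U] by (intro exI[of _ U]) auto
qed

text \<open>If \<open>n < m\<close>, then R^n is a coordinate subspace of R^m, and invariance of
  domain would make the image open in R^m although it lies in this subspace.\<close>

lemma no_injection_into_lower_dimension:
  assumes U: "openin (Euclidean_space m) U" "U \<noteq> {}"
    and f: "continuous_map (subtopology (Euclidean_space m) U) (Euclidean_space n) f" and inj: "inj_on f U"
  shows "m \<le> n"
proof (rule ccontr)
  assume "\<not> m \<le> n"
  then have nm: "n < m" by simp
  have sub: "U \<subseteq> topspace (Euclidean_space m)" using openin_subset[OF U(1)] .
  have eq: "Euclidean_space n = subtopology (Euclidean_space m) (topspace (Euclidean_space n))"
    by (metis Euclidean_space_def nm less_imp_le inf.absorb_iff2 subset_Euclidean_space subtopology_subtopology topspace_Euclidean_space)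
  have "continuous_map (subtopology (Euclidean_space m) U) (Euclidean_space m) f"
    using f eq continuous_map_in_subtopology by metis
  then have op: "openin (Euclidean_space m) (f ` U)"
    using invariance_of_domain_Euclidean_space U(1) inj by blast
  have fU: "f ` U \<subseteq> topspace (Euclidean_space n)"
    using continuous_map_image_subset_topspace[OF f] sub by auto
  obtain p where p: "p \<in> f ` U" using U(2) by blast
  \<comment> \<open>A line through \<open>p\<close> in the direction of coordinate \<open>n\<close>,
    the first one that vanishes on R^n since coordinates are counted from 0.\<close>
  define c where "c t = (\<lambda>i. if i < m then (p i + (if i = n then t else 0)) else 0)" for t :: real
  have pn: "p i = 0" if "i \<ge> n" for i
    using p fU that by (auto simp: topspace_Euclidean_space)
  have "continuous_map euclideanreal (Euclidean_space m) c"
    unfolding c_def continuous_map_componentwise_Euclidean_space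
  proof (intro allI impI)
    show "continuous_map euclideanreal euclideanreal (\<lambda>t. p i + (if i = n then t else 0))" for i
      by (cases "i = n") (simp_all add: continuous_intros)
  qed
  then have "open {t. c t \<in> f ` U}"
    using openin_continuous_map_preimage[OF _ op, of euclideanreal c] by simp
  moreover have "c 0 = p" using pn nm by (auto simp: c_def fun_eq_iff)
  ultimately obtain e where "e > 0" "\<And>t. \<bar>t\<bar> < e \<Longrightarrow> c t \<in> f ` U"
    using p unfolding open_dist by (metis (no_types, lifting) dist_norm mem_Collect_eq diff_zero real_norm_def)
  then have "c (e/2) \<in> topspace (Euclidean_space n)"
    using fU by (simp add: subset_iff)
  then have "c (e/2) n = 0" by (simp add: topspace_Euclidean_space)
  then show False using \<open>e > 0\<close> nm pn by (simp add: c_def)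
qed

text \<open>The previous bound, carried over along the homeomorphism of C^n with R^(2n) that
  interleaves real and imaginary parts.\<close>

lemma Cn_open_injection_dim_le:
  assumes U: "openin (top_of_set (Cn n)) U" "U \<noteq> {}"
    and f: "continuous_map (top_of_set U) (Euclidean_space N) f" and inj: "inj_on f U"
  shows "2 * n \<le> N"
proof -
  let ?E = "Euclidean_space (2 * n)"
  define c where "c r = (\<lambda>i. if i < n then Complex (r (2*i)) (r (2*i+1)) else 0)" for r :: "nat \<Rightarrow> real"
  define d where "d x = (\<lambda>k. if k < 2*n then (if even k then Re (x (k div 2)) else Im (x (k div 2))) else 0)"
    for x :: "nat \<Rightarrow> complex"
  have "continuous_map ?E euclidean c"
    unfolding continuous_map_Euclidean_space_iff
  proof (intro continuous_on_coordinatewise_then_product)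
    fix i
    have "continuous_on A (\<lambda>r :: nat \<Rightarrow> real. of_real (r (2*i)) + \<i> * of_real (r (2*i+1)))" for A
      by (intro continuous_intros continuous_on_coordinate)
    then show "continuous_on (topspace ?E) (\<lambda>r. c r i)"
      by (cases "i < n") (simp_all add: c_def Complex_eq)
  qed
  then have cc: "continuous_map ?E (top_of_set (Cn n)) c"
    by (auto simp: continuous_map_in_subtopology c_def Cn_def)
  have cd: "c (d x) = x" if "x \<in> Cn n" for x
    using that by (auto simp: c_def d_def Cn_def fun_eq_iff complex_eq_iff)
  have dc: "d (c r) = r" if "r \<in> topspace ?E" for r
  proof
    fix k
    show "d (c r) k = r k"
      using that by (cases "even k") (auto simp: c_def d_def topspace_Euclidean_space elim!: evenE oddE)
  qed
  define V where "V = {r \<in> topspace ?E. c r \<in> U}"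
  have V: "openin ?E V" unfolding V_def by (rule openin_continuous_map_preimage[OF cc U(1)])
  have "V \<noteq> {}"
  proof -
    obtain x where x: "x \<in> U" using U(2) by blast
    then have "c (d x) = x" using cd openin_subset[OF U(1)] by auto
    then have "d x \<in> V" using x by (simp add: V_def d_def topspace_Euclidean_space)
    then show ?thesis by blast
  qed
  moreover have "continuous_map (subtopology ?E V) (Euclidean_space N) (f \<circ> c)"
  proof (rule continuous_map_compose[OF _ f])
    have "continuous_map (subtopology ?E V) euclidean c"
      using continuous_map_from_subtopology[OF cc] continuous_map_into_fulltopology by blast
    then show "continuous_map (subtopology ?E V) (top_of_set U) c"
      by (auto simp: continuous_map_in_subtopology V_def)
  qed
  moreover have "inj_on (f \<circ> c) V"
  proof (rule comp_inj_on)
    show "inj_on c V" by (rule inj_on_inverseI[of _ d]) (simp add: V_def dc)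
    show "inj_on f (c ` V)" by (rule inj_on_subset[OF inj]) (auto simp: V_def)
  qed
  ultimately show ?thesis by (rule no_injection_into_lower_dimension[OF V])
qed

text \<open>
  The multiples of a small element \<open>t\<close> of \<open>{t. Q t v}\<close> come within \<open>\<bar>t\<bar>\<close> of every real number,
  so they hit an interval that is disjoint from this group for all nearby \<open>v\<close>.
\<close>

lemma compact_family_discrete:
  fixes Q :: "real \<Rightarrow> 'v::topological_space \<Rightarrow> bool"
  assumes S: "compact S" and clo: "closedin (top_of_set (UNIV \<times> S)) {p. snd p \<in> S \<and> Q (fst p) (snd p)}"
    and add: "\<And>s t v. v \<in> S \<Longrightarrow> Q s v \<Longrightarrow> Q t v \<Longrightarrow> Q (s + t) v"
    and neg: "\<And>t v. v \<in> S \<Longrightarrow> Q t v \<Longrightarrow> Q (- t) v"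
    and nontriv: "\<And>v. v \<in> S \<Longrightarrow> \<exists>t. \<not> Q t v"
  obtains \<delta> where "\<delta> > 0" "\<And>t v. v \<in> S \<Longrightarrow> 0 < \<bar>t\<bar> \<Longrightarrow> \<bar>t\<bar> < \<delta> \<Longrightarrow> \<not> Q t v"
proof -
  let ?W = "{p \<in> UNIV \<times> S. \<not> Q (fst p) (snd p)}"
  have "?W = UNIV \<times> S - {p. snd p \<in> S \<and> Q (fst p) (snd p)}" by auto
  then have "openin (top_of_set (UNIV \<times> S)) ?W"
    using openin_diff[OF openin_topspace clo] by simp
  then obtain G where G: "open G" "?W = (UNIV \<times> S) \<inter> G"
    by (auto simp: openin_open)
  have "\<exists>t e V. e > 0 \<and> open V \<and> v \<in> V \<and> (\<forall>s w. \<bar>s - t\<bar> < e \<longrightarrow> w \<in> V \<longrightarrow> w \<in> S \<longrightarrow> \<not> Q s w)"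
    if v: "v \<in> S" for v
  proof -
    obtain t where t: "\<not> Q t v" using nontriv v by blast
    then have "(t, v) \<in> ?W" using v by simp
    then have "(t, v) \<in> G" unfolding G(2) by (rule IntD2)
    then obtain A V where AV: "open A" "open V" "(t, v) \<in> A \<times> V" "A \<times> V \<subseteq> G"
      using G(1) open_prod_elim by blast
    then have "t \<in> A" by simp
    then obtain e where e: "e > 0" "ball t e \<subseteq> A" by (rule openE[OF AV(1)])
    have "\<not> Q s w" if "\<bar>s - t\<bar> < e" "w \<in> V" "w \<in> S" for s w
    proof -
      have "s \<in> ball t e" using that(1) by (simp add: dist_real_def abs_minus_commute)
      then have "(s, w) \<in> A \<times> V" using e(2) that(2) by blast
      then have "(s, w) \<in> (UNIV \<times> S) \<inter> G" using AV(4) that(3) by blast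
      then show ?thesis unfolding G(2)[symmetric] by simp
    qed
    then show ?thesis using AV(2,3) e(1) by blast
  qed
  then obtain t e V where tev: "\<And>v. v \<in> S \<Longrightarrow> e v > 0 \<and> open (V v) \<and> v \<in> V v \<and>
      (\<forall>s w. \<bar>s - t v\<bar> < (e v :: real) \<longrightarrow> w \<in> V v \<longrightarrow> w \<in> S \<longrightarrow> \<not> Q s w)"
    by metis
  obtain D where D: "D \<subseteq> S" "finite D" "S \<subseteq> (\<Union>v\<in>D. V v)"
    by (rule compactE_image[OF S, of S V]) (use tev in auto)
  define \<delta> where "\<delta> = Min (insert 1 (e ` D))"
  have "\<delta> > 0" unfolding \<delta>_def using tev D by (subst Min_gr_iff) auto
  moreover have "\<not> Q s w" if w: "w \<in> S" and s: "0 < \<bar>s\<bar>" "\<bar>s\<bar> < \<delta>" for s w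
  proof
    assume Q: "Q s w"
    have Q0: "Q 0 w" using add[OF w Q neg[OF w Q]] by simp
    have Qn: "Q (real k * s) w" for k
    proof (induction k)
      case (Suc k)
      then show ?case using add[OF w Q Suc] by (simp add: distrib_right)
    qed (use Q0 in simp)
    have Qz: "Q (of_int k * s) w" for k
    proof (cases "k \<ge> 0")
      case True
      then show ?thesis using Qn[of "nat k"] by simp
    next
      case False
      then show ?thesis using neg[OF w Qn[of "nat (- k)"]] by simp
    qed
    obtain u where u: "u \<in> D" "w \<in> V u" using D(3) w by blast
    let ?k = "\<lfloor>t u / s\<rfloor>"
    have "\<bar>of_int ?k - t u / s\<bar> < 1" by linarith
    then have "\<bar>of_int ?k - t u / s\<bar> * \<bar>s\<bar> < \<bar>s\<bar>"
      using s by (simp add: mult_less_cancel_right1)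
    moreover have "of_int ?k * s - t u = (of_int ?k - t u / s) * s"
      using s by (simp add: left_diff_distrib)
    ultimately have "\<bar>of_int ?k * s - t u\<bar> < \<bar>s\<bar>"
      by (simp only: abs_mult)
    also have "\<bar>s\<bar> < e u"
    proof -
      have "\<delta> \<le> e u" unfolding \<delta>_def using D(2) u(1) by (intro Min_le) auto
      then show ?thesis using s(2) by linarith
    qed
    finally show False
      using tev[of u] D(1) u w Qz by blast
  qed
  ultimately show ?thesis using that by blast
qed

text \<open>The subbasic set belonging to the empty compact set is the whole of
  \<open>F\<close>.\<close>

lemma topspace_compact_open:
  assumes "\<And>f. f \<in> F \<Longrightarrow> f \<in> topspace X \<rightarrow> topspace Y"
  shows "topspace (compact_open X Y F) = F"
proof -
  have "F \<in> {{f \<in> F. f ` K \<subseteq> U} | K U. compactin X K \<and> openin Y U}"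
    by (rule CollectI, rule exI[of _ "{}"], rule exI[of _ "{}"]) auto
  then show ?thesis unfolding compact_open_def topology_generated_by_topspace by blast
qed

lemma openin_compact_open:
  "compactin X K \<Longrightarrow> openin Y U \<Longrightarrow> openin (compact_open X Y F) {f \<in> F. f ` K \<subseteq> U}"
  unfolding compact_open_def by (rule topology_generated_by_Basis) blast

lemma continuous_map_into_compact_open:
  assumes F: "h \<in> topspace Z \<rightarrow> F"
    and op: "\<And>K U. compactin X K \<Longrightarrow> openin Y U \<Longrightarrow> openin Z {z \<in> topspace Z. h z ` K \<subseteq> U}"
  shows "continuous_map Z (compact_open X Y F) h"
  unfolding compact_open_def
proof (rule continuous_on_generated_topo)
  fix B assume "B \<in> {{f \<in> F. f ` K \<subseteq> U} | K U. compactin X K \<and> openin Y U}"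
  then obtain K U where KU: "B = {f \<in> F. f ` K \<subseteq> U}" "compactin X K" "openin Y U" by blast
  have "h -` B \<inter> topspace Z = {z \<in> topspace Z. h z ` K \<subseteq> U}"
    using F KU(1) by auto
  then show "openin Z (h -` B \<inter> topspace Z)"
    using op[OF KU(2,3)] by simp
next
  have "F \<in> {{f \<in> F. f ` K \<subseteq> U} | K U. compactin X K \<and> openin Y U}"
    by (rule CollectI, rule exI[of _ "{}"], rule exI[of _ "{}"]) auto
  then show "h ` topspace Z \<subseteq> \<Union> {{f \<in> F. f ` K \<subseteq> U} | K U. compactin X K \<and> openin Y U}"
    using F by blast
qed

section \<open>Linear maps into the one-parameter groups of an abelian group\<close>

lemma Cn_add: "x \<in> Cn n \<Longrightarrow> y \<in> Cn n \<Longrightarrow> (\<lambda>i. x i + y i) \<in> Cn n"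
  by (simp add: Cn_def)

lemma Cn_cscale: "x \<in> Cn n \<Longrightarrow> cscale c x \<in> Cn n"
  by (simp add: Cn_def cscale_def)

lemma l1_cscale: "l1 n (cscale c x) = cmod c * l1 n x"
  by (simp add: cscale_def norm_mult sum_distrib_left)

text \<open>Isolates from the automorphism group what the theory of one-parameter groups uses.
  \<open>Y\<close> may have more points than \<open>A\<close>, because \<open>Hom_C_top\<close>
  refers to the topology of all automorphisms and not to that of \<open>T\<close>.\<close>

locale hausdorff_abelian_group = comm_group A for A :: "'a monoid" (structure) +
  fixes Y :: "'a topology"
  assumes carrier_subset: "carrier A \<subseteq> topspace Y"
    and Hausdorff: "Hausdorff_space (subtopology Y (carrier A))"
    and continuous_mult: "continuous_map
      (prod_topology (subtopology Y (carrier A)) (subtopology Y (carrier A)))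
      (subtopology Y (carrier A)) (\<lambda>(a, b). a \<otimes> b)"
begin

abbreviation "\<tau> \<equiv> subtopology Y (carrier A)"

definition HomC :: "(complex \<Rightarrow> 'a) set" where
  "HomC = {\<gamma> \<in> hom C_add A. continuous_map euclidean \<tau> \<gamma>}"

text \<open>Complex linear maps from C^n into the vector space of one-parameter groups; the
  conjugate is that of \<open>Hom_C_scale\<close>.\<close>

definition linear_into :: "nat \<Rightarrow> ((nat \<Rightarrow> complex) \<Rightarrow> complex \<Rightarrow> 'a) \<Rightarrow> bool" where
  "linear_into n L \<longleftrightarrow> L ` Cn n \<subseteq> HomC \<and>
     (\<forall>x\<in>Cn n. \<forall>y\<in>Cn n. L (\<lambda>i. x i + y i) = (\<lambda>z. L x z \<otimes> L y z)) \<and>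
     (\<forall>c. \<forall>x\<in>Cn n. L (cscale c x) = (\<lambda>z. L x (cnj c * z)))"

lemma topspace_tau: "topspace \<tau> = carrier A"
  using carrier_subset by auto

lemma HomC_closed: "\<gamma> \<in> HomC \<Longrightarrow> \<gamma> z \<in> carrier A"
  by (auto simp: HomC_def hom_def C_add_def)

lemma HomC_add: "\<gamma> \<in> HomC \<Longrightarrow> \<gamma> (z + w) = \<gamma> z \<otimes> \<gamma> w"
  by (simp add: HomC_def hom_def C_add_def)

lemma HomC_zero: "\<gamma> \<in> HomC \<Longrightarrow> \<gamma> 0 = \<one>"
  using HomC_add[of \<gamma> 0 0] HomC_closed[of \<gamma> 0] l_cancel_one' by auto

lemma HomC_minus: "\<gamma> \<in> HomC \<Longrightarrow> \<gamma> (- z) = inv (\<gamma> z)"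
  using HomC_add[of \<gamma> "- z" z] HomC_zero[of \<gamma>] HomC_closed[of \<gamma>] inv_equality by force

lemma HomC_continuous: "\<gamma> \<in> HomC \<Longrightarrow> continuous_map euclidean \<tau> \<gamma>"
  by (simp add: HomC_def)

lemma continuous_map_mult:
  assumes "continuous_map X \<tau> f" "continuous_map X \<tau> g"
  shows "continuous_map X \<tau> (\<lambda>x. f x \<otimes> g x)"
  using continuous_map_compose[OF continuous_map_pairedI[OF assms] continuous_mult]
  by (simp add: comp_def)

lemma HomC_I:
  assumes "\<And>z. \<gamma> z \<in> carrier A" "\<And>z w. \<gamma> (z + w) = \<gamma> z \<otimes> \<gamma> w" "continuous_map euclidean \<tau> \<gamma>"
  shows "\<gamma> \<in> HomC"
  using assms by (auto simp: HomC_def hom_def C_add_def)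

lemma HomC_one: "(\<lambda>z. \<one>) \<in> HomC"
  by (rule HomC_I) (use carrier_subset in auto)

lemma HomC_mult:
  assumes "\<gamma> \<in> HomC" "\<delta> \<in> HomC"
  shows "(\<lambda>z. \<gamma> z \<otimes> \<delta> z) \<in> HomC"
proof (rule HomC_I)
  show "\<gamma> z \<otimes> \<delta> z \<in> carrier A" for z using assms HomC_closed by simp
  show "\<gamma> (z + w) \<otimes> \<delta> (z + w) = \<gamma> z \<otimes> \<delta> z \<otimes> (\<gamma> w \<otimes> \<delta> w)" for z w
    using assms HomC_closed by (simp add: HomC_add m_ac)
  show "continuous_map euclidean \<tau> (\<lambda>z. \<gamma> z \<otimes> \<delta> z)"
    using assms HomC_continuous by (intro continuous_map_mult)
qed

lemma HomC_scale:
  assumes "\<gamma> \<in> HomC"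
  shows "(\<lambda>z. \<gamma> (cnj c * z)) \<in> HomC"
proof (rule HomC_I)
  have "continuous_map euclidean euclidean (\<lambda>z. cnj c * z)"
    by (simp add: continuous_intros)
  from continuous_map_compose[OF this HomC_continuous[OF assms]]
  show "continuous_map euclidean \<tau> (\<lambda>z. \<gamma> (cnj c * z))" by (simp add: comp_def)
qed (use assms in \<open>auto simp: HomC_closed HomC_add distrib_left\<close>)

lemma linear_intoD:
  assumes "linear_into n L"
  shows "\<And>x. x \<in> Cn n \<Longrightarrow> L x \<in> HomC"
    "\<And>x y z. x \<in> Cn n \<Longrightarrow> y \<in> Cn n \<Longrightarrow> L (\<lambda>i. x i + y i) z = L x z \<otimes> L y z"
    "\<And>c x z. x \<in> Cn n \<Longrightarrow> L (cscale c x) z = L x (cnj c * z)"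
  using assms by (auto simp: linear_into_def)

lemma linear_into_zero:
  assumes "linear_into n L"
  shows "L (\<lambda>i. 0) z = \<one>"
proof -
  have "(\<lambda>i. 0) \<in> Cn n" by (simp add: Cn_def)
  from linear_intoD(3)[OF assms this, of 0 z] HomC_zero[OF linear_intoD(1)[OF assms this]]
  show ?thesis by (simp add: cscale_def)
qed

lemma linear_into_diff:
  assumes L: "linear_into n L" and xy: "x \<in> Cn n" "y \<in> Cn n"
  shows "L (\<lambda>i. x i - y i) z = L x z \<otimes> inv (L y z)"
proof -
  have "L (\<lambda>i. x i + cscale (-1) y i) z = L x z \<otimes> L (cscale (-1) y) z"
    by (rule linear_intoD(2)[OF L xy(1) Cn_cscale[OF xy(2)]])
  moreover have "L (cscale (-1) y) z = inv (L y z)"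
    using linear_intoD(3)[OF L xy(2), of "-1" z] HomC_minus[OF linear_intoD(1)[OF L xy(2)]] by simp
  moreover have "(\<lambda>i. x i + cscale (-1) y i) = (\<lambda>i. x i - y i)"
    by (simp add: cscale_def)
  ultimately show ?thesis by simp
qed

lemma Cn_diff: "x \<in> Cn n \<Longrightarrow> y \<in> Cn n \<Longrightarrow> (\<lambda>i. x i - y i) \<in> Cn n"
  by (simp add: Cn_def)

lemma linear_into_inj:
  assumes L: "linear_into n L" and ker: "\<And>x. x \<in> Cn n \<Longrightarrow> (\<And>z. L x z = \<one>) \<Longrightarrow> x = (\<lambda>i. 0)"
  shows "inj_on L (Cn n)"
proof (rule inj_onI)
  fix x y assume xy: "x \<in> Cn n" "y \<in> Cn n" "L x = L y"
  have "L (\<lambda>i. x i - y i) z = \<one>" for z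
    using linear_into_diff[OF L xy(1,2), of z] xy(3) HomC_closed[OF linear_intoD(1)[OF L xy(2)], of z] by simp
  then have "(\<lambda>i. x i - y i) = (\<lambda>i. 0)"
    by (rule ker[OF Cn_diff[OF xy(1,2)]])
  then show "x = y" by (simp add: fun_eq_iff)
qed

text \<open>Expanding \<open>x\<close> in the standard basis makes \<open>L x z\<close> a finite
  product of factors \<open>L (e m) (cnj (x m) * z)\<close>, each of which is jointly continuous.
  The induction adds one factor at a time by truncating \<open>x\<close>.\<close>

lemma linear_into_jointly_continuous:
  assumes L: "linear_into n L"
  shows "continuous_map (prod_topology (top_of_set (Cn n)) euclidean) \<tau> (\<lambda>p. L (fst p) (snd p))"
proof -
  let ?X = "prod_topology (top_of_set (Cn n)) (euclidean :: complex topology)"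
  have X: "?X = top_of_set (Cn n \<times> UNIV)"
    using prod_topology_subtopology_eu[of "Cn n" UNIV] by simp
  define tr where "tr m x = (\<lambda>i. if i < m then x i else 0)" for m and x :: "nat \<Rightarrow> complex"
  define e where "e m = (\<lambda>i. if i = m then 1 else (0::complex))" for m :: nat
  have trC: "tr m x \<in> Cn n" if "m \<le> n" for m x using that by (simp add: tr_def Cn_def)
  have "continuous_map ?X \<tau> (\<lambda>p. L (tr m (fst p)) (snd p))" if "m \<le> n" for m
    using that
  proof (induction m)
    case 0
    have "continuous_map ?X \<tau> (\<lambda>p. \<one>)" using subsetD[OF carrier_subset one_closed] by simp
    then show ?case using linear_into_zero[OF L] by (simp add: tr_def)
  next
    case (Suc m)
    have eC: "e m \<in> Cn n" using Suc.prems by (simp add: e_def Cn_def)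
    have "continuous_map ?X euclidean (\<lambda>p. cnj (fst p m) * snd p)"
      unfolding X continuous_map_iff_continuous
      by (intro continuous_intros continuous_on_product_then_coordinatewise) 
    from continuous_map_compose[OF this HomC_continuous[OF linear_intoD(1)[OF L eC]]]
    have 1: "continuous_map ?X \<tau> (\<lambda>p. L (e m) (cnj (fst p m) * snd p))" by (simp add: comp_def)
    have "L (tr (Suc m) x) z = L (tr m x) z \<otimes> L (e m) (cnj (x m) * z)" for x z
    proof -
      have "tr (Suc m) x = (\<lambda>i. tr m x i + cscale (x m) (e m) i)"
        by (auto simp: tr_def cscale_def e_def fun_eq_iff less_Suc_eq)
      then show ?thesis
        using linear_intoD(2)[OF L trC Cn_cscale[OF eC], of m x "x m" z] linear_intoD(3)[OF L eC, of "x m" z]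
          Suc.prems by simp
    qed
    then show ?case
      using continuous_map_mult[OF Suc.IH 1] Suc.prems by simp
  qed
  from this[of n] have "continuous_map ?X \<tau> (\<lambda>p. L (tr n (fst p)) (snd p))" by simp
  then show ?thesis
  proof (rule continuous_map_eq)
    fix p assume "p \<in> topspace ?X"
    then have "tr n (fst p) = fst p" by (auto simp: tr_def Cn_def fun_eq_iff not_less)
    then show "L (tr n (fst p)) (snd p) = L (fst p) (snd p)" by simp
  qed
qed

lemma linear_into_continuous_at_point:
  assumes L: "linear_into n L"
  shows "continuous_map (top_of_set (Cn n)) \<tau> (\<lambda>x. L x z)"
proof -
  have "continuous_map (top_of_set (Cn n)) (prod_topology (top_of_set (Cn n)) euclidean) (\<lambda>x. (x, z))"
    by (intro continuous_map_pairedI) auto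
  from continuous_map_compose[OF this linear_into_jointly_continuous[OF L]]
  show ?thesis by (simp add: comp_def)
qed

text \<open>
  If \<open>L x 1\<close> and \<open>L x \<i>\<close> were both trivial for arbitrarily small \<open>x\<close>, then they would be trivial on
  a whole real line of \<open>x\<close>, and thus \<open>L\<close> itself would be.
\<close>

lemma linear_into_locally_injective:
  assumes L: "linear_into n L" and inj: "inj_on L (Cn n)"
  obtains \<delta> where "\<delta> > 0"
    "\<And>x. x \<in> Cn n \<Longrightarrow> 0 < l1 n x \<Longrightarrow> l1 n x < \<delta> \<Longrightarrow> \<not> (L x 1 = \<one> \<and> L x \<i> = \<one>)"
proof -
  let ?S = "{x :: nat \<Rightarrow> complex. (\<forall>i\<ge>n. x i = 0) \<and> l1 n x = 1}"
  have SC: "?S \<subseteq> Cn n" by (auto simp: Cn_def)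
  define Q where "Q t v \<longleftrightarrow> L (cscale (of_real t) v) 1 = \<one> \<and> L (cscale (of_real t) v) \<i> = \<one>" for t v
  have Q: "Q t v \<longleftrightarrow> L v (of_real t) = \<one> \<and> L v (of_real t * \<i>) = \<one>" if "v \<in> ?S" for t v
    using linear_intoD(3)[OF L, of v] that SC by (auto simp: Q_def)
  have 1: "closedin (top_of_set (UNIV \<times> ?S)) {p. snd p \<in> ?S \<and> Q (fst p) (snd p)}"
  proof -
    have "continuous_map (top_of_set (UNIV \<times> ?S)) \<tau> (\<lambda>p. L (cscale (of_real (fst p)) (snd p)) z)" for z
    proof -
      have c: "continuous_map (top_of_set (UNIV \<times> ?S)) euclidean (\<lambda>p. cscale (of_real (fst p)) (snd p))"
        unfolding continuous_map_iff_continuous cscale_def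
        by (intro continuous_on_coordinatewise_then_product continuous_on_mult continuous_on_of_real
            continuous_on_fst continuous_on_id
            continuous_on_product_then_coordinatewise[OF continuous_on_snd[OF continuous_on_id]])
      have "continuous_map (top_of_set (UNIV \<times> ?S)) (top_of_set (Cn n)) (\<lambda>p. cscale (of_real (fst p)) (snd p))"
        using c SC by (auto simp: continuous_map_in_subtopology Cn_cscale subset_iff)
      from continuous_map_compose[OF this linear_into_continuous_at_point[OF L]]
      show ?thesis by (simp add: comp_def)
    qed
    moreover have "closedin \<tau> {\<one>}"
      using Hausdorff_imp_t1_space[OF Hausdorff] topspace_tau by (simp add: t1_space_closedin_singleton)
    ultimately have "closedin (top_of_set (UNIV \<times> ?S)) {p \<in> topspace (top_of_set (UNIV \<times> ?S)).
        L (cscale (of_real (fst p)) (snd p)) z \<in> {\<one>}}" for z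
      by (intro closedin_continuous_map_preimage)
    from closedin_Int[OF this[of 1] this[of \<i>]] show ?thesis
      by (rule back_subst[of "closedin (top_of_set (UNIV \<times> ?S))"]) (auto simp: Q_def)
  qed
  obtain \<delta> where \<delta>: "\<delta> > 0" "\<And>t v. v \<in> ?S \<Longrightarrow> 0 < \<bar>t\<bar> \<Longrightarrow> \<bar>t\<bar> < \<delta> \<Longrightarrow> \<not> Q t v"
  proof (rule compact_family_discrete[OF compact_unit_l1_sphere[of n 1] 1])
    show "Q (s + t) v" if "v \<in> ?S" "Q s v" "Q t v" for s t v
      using that HomC_add[OF linear_intoD(1)[OF L, of v]] SC by (auto simp: Q distrib_right)
    show "Q (- t) v" if "v \<in> ?S" "Q t v" for t v
      using that HomC_minus[OF linear_intoD(1)[OF L, of v]] SC by (auto simp: Q)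
    show "\<exists>t. \<not> Q t v" if v: "v \<in> ?S" for v
    proof (rule ccontr)
      assume "\<nexists>t. \<not> Q t v"
      then have t: "L v (of_real t) = \<one>" "L v (of_real t * \<i>) = \<one>" for t using Q v by blast+
      have vC: "v \<in> Cn n" using v SC by blast
      have "L v z = \<one>" for z
      proof -
        have "z = of_real (Re z) + of_real (Im z) * \<i>" by (simp add: complex_eq mult.commute)
        then have "L v z = L v (of_real (Re z)) \<otimes> L v (of_real (Im z) * \<i>)"
          using HomC_add[OF linear_intoD(1)[OF L vC]] by metis
        then show ?thesis using t by simp
      qed
      then have "L v = L (\<lambda>i. 0)" using linear_into_zero[OF L] by (simp add: fun_eq_iff)
      then have "v = (\<lambda>i. 0)" using inj vC by (simp add: inj_on_def Cn_def)
      then show False using v by simp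
    qed
  qed blast
  have "\<not> (L x 1 = \<one> \<and> L x \<i> = \<one>)" if x: "x \<in> Cn n" "0 < l1 n x" "l1 n x < \<delta>" for x
  proof -
    let ?r = "complex_of_real (l1 n x)" let ?v = "cscale (inverse ?r) x"
    have r: "cmod ?r = l1 n x" using x(2) by (simp only: norm_of_real)
    have "?r \<noteq> 0" using x(2) r by force
    then have "x = cscale ?r ?v" by (simp add: cscale_def fun_eq_iff)
    moreover have "l1 n ?v = 1" unfolding l1_cscale norm_inverse r using x(2) by simp
    then have "?v \<in> ?S" using Cn_cscale[OF x(1), of "inverse ?r"] by (simp add: Cn_def)
    then have "\<not> Q (l1 n x) ?v" using \<delta>(2)[of ?v "l1 n x"] x(2,3) by simp
    ultimately show ?thesis unfolding Q_def by simp
  qed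
  then show ?thesis using that \<delta>(1) by blast
qed

text \<open>Near 0 the map that sends \<open>x\<close> to the coordinates of \<open>L x 1\<close>
  and \<open>L x \<i>\<close> is injective, since the difference of two points with equal values
  would be a small element of the kernel. It sends an open subset of C^n into R^(2N).\<close>

lemma linear_into_dim_le:
  assumes L: "linear_into n L" and inj: "inj_on L (Cn n)"
    and O: "openin \<tau> O1" "\<one> \<in> O1" and e: "continuous_map (subtopology \<tau> O1) (Euclidean_space N) e" "inj_on e O1"
  shows "n \<le> N"
proof -
  obtain \<delta> where \<delta>: "\<delta> > 0"
    "\<And>x. x \<in> Cn n \<Longrightarrow> 0 < l1 n x \<Longrightarrow> l1 n x < \<delta> \<Longrightarrow> \<not> (L x 1 = \<one> \<and> L x \<i> = \<one>)"
    using linear_into_locally_injective[OF L inj] by blast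
  let ?E = "top_of_set (Cn n)"
  note cL = linear_into_continuous_at_point[OF L]
  \<comment> \<open>With radius \<open>\<delta>/2\<close> the difference of two points has l1 norm
    below \<delta>, where local injectivity applies.\<close>
  define U where "U = {x \<in> Cn n. l1 n x < \<delta>/2} \<inter> {x \<in> topspace ?E. L x 1 \<in> O1} \<inter> {x \<in> topspace ?E. L x \<i> \<in> O1}"
  have UC: "U \<subseteq> Cn n" by (auto simp: U_def)
  have "open {x :: nat \<Rightarrow> complex. l1 n x < \<delta>/2}"
    by (intro open_Collect_less continuous_intros continuous_on_coordinate)
  then have "openin ?E {x \<in> Cn n. l1 n x < \<delta>/2}"
    by (auto simp: openin_open)
  then have opU: "openin ?E U"
    unfolding U_def using O(1) by (intro openin_Int openin_continuous_map_preimage[OF cL]) auto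
  have "(\<lambda>i. 0) \<in> U"
    using \<delta>(1) O(2) by (simp add: U_def linear_into_zero[OF L] Cn_def)
  then have neU: "U \<noteq> {}" by blast
  have cU: "continuous_map (top_of_set U) (Euclidean_space N) (\<lambda>x. e (L x z))" if "z = 1 \<or> z = \<i>" for z
  proof -
    have "continuous_map (top_of_set U) \<tau> (\<lambda>x. L x z)"
      by (rule continuous_map_from_subtopology_mono[OF cL UC])
    then have "continuous_map (top_of_set U) (subtopology \<tau> O1) (\<lambda>x. L x z)"
      using that by (auto simp: continuous_map_in_subtopology U_def)
    from continuous_map_compose[OF this e(1)] show ?thesis by (simp add: comp_def)
  qed
  have coord: "continuous_map (Euclidean_space N) euclideanreal (\<lambda>x. x k)" for k
    by (simp add: continuous_map_Euclidean_space_iff continuous_on_coordinate)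
  define f where "f x = (\<lambda>k. if k < 2*N then (if k < N then e (L x 1) k else e (L x \<i>) (k - N)) else 0)" for x
  have f: "continuous_map (top_of_set U) (Euclidean_space (2*N)) f"
    unfolding f_def continuous_map_componentwise_Euclidean_space
  proof (intro allI impI)
    fix k
    show "continuous_map (top_of_set U) euclideanreal (\<lambda>x. if k < N then e (L x 1) k else e (L x \<i>) (k - N))"
      using continuous_map_compose[OF cU[of 1] coord[of k]] continuous_map_compose[OF cU[of \<i>] coord[of "k-N"]]
      by (cases "k < N") (simp_all add: comp_def)
  qed
  have "inj_on f U"
  proof (rule inj_onI)
    fix x y assume xy: "x \<in> U" "y \<in> U" "f x = f y"
    then have C: "x \<in> Cn n" "y \<in> Cn n" using UC by blast+
    have eE: "e (L x z) \<in> topspace (Euclidean_space N)" if "x \<in> U" "z = 1 \<or> z = \<i>" for x z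
      using continuous_map_in_topspace[OF cU[OF that(2)], of x] that(1) by simp
    have "e (L x 1) k = e (L y 1) k" for k
      using fun_cong[OF xy(3), of k] eE[of x 1] eE[of y 1] xy(1,2)
      by (cases "k < N") (auto simp: f_def topspace_Euclidean_space)
    then have e1: "e (L x 1) = e (L y 1)" ..
    have "e (L x \<i>) k = e (L y \<i>) k" for k
      using fun_cong[OF xy(3), of "k+N"] eE[of x \<i>] eE[of y \<i>] xy(1,2)
      by (cases "k < N") (auto simp: f_def topspace_Euclidean_space)
    then have e2: "e (L x \<i>) = e (L y \<i>)" ..
    have eq: "L x 1 = L y 1" "L x \<i> = L y \<i>"
      using e1 e2 e(2) xy(1,2) by (auto simp: U_def inj_on_def)
    let ?d = "\<lambda>i. x i - y i"
    have "L ?d 1 = \<one>" "L ?d \<i> = \<one>"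
      using linear_into_diff[OF L C] eq HomC_closed[OF linear_intoD(1)[OF L]] C by simp_all
    moreover have "l1 n ?d < \<delta>"
    proof -
      have "l1 n ?d \<le> (\<Sum>i<n. cmod (x i) + cmod (y i))"
        by (intro sum_mono norm_triangle_ineq4)
      also have "\<dots> = l1 n x + l1 n y" by (simp add: sum.distrib)
      also have "\<dots> < \<delta>" using xy(1,2) by (simp add: U_def)
      finally show ?thesis .
    qed
    ultimately have "\<not> 0 < l1 n ?d" using \<delta>(2)[OF Cn_diff[OF C]] by blast
    then have "l1 n ?d = 0" using l1_nonneg[of ?d n] by linarith
    then show "x = y" using l1_eq_0_iff[OF C(2,1)] by simp
  qed
  then have "2 * n \<le> 2 * N"
    by (rule Cn_open_injection_dim_le[OF opU neU f])
  then show ?thesis by simp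
qed

end

section \<open>Existence of linear isomorphisms onto Hom(C, T), and their topology\<close>

context hausdorff_abelian_group
begin

definition linear_onto :: "nat \<Rightarrow> ((nat \<Rightarrow> complex) \<Rightarrow> complex \<Rightarrow> 'a) \<Rightarrow> bool" where
  "linear_onto n L \<longleftrightarrow> linear_into n L \<and> bij_betw L (Cn n) HomC"

text \<open>A homomorphism outside the image is adjoined as a new basis vector. A kernel element
  with nonzero last coordinate could be solved for \<gamma>, which would put \<gamma> into the image
  after all.\<close>

lemma linear_into_extend:
  assumes L: "linear_into n L" and inj: "inj_on L (Cn n)" and \<gamma>: "\<gamma> \<in> HomC" "\<gamma> \<notin> L ` Cn n"
  obtains L' where "linear_into (Suc n) L'" "inj_on L' (Cn (Suc n))"
proof -
  define tr where "tr x = (\<lambda>i. if i < n then x i else 0)" for x :: "nat \<Rightarrow> complex"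
  define L' where "L' x = (\<lambda>z. L (tr x) z \<otimes> \<gamma> (cnj (x n) * z))" for x
  have trC: "tr x \<in> Cn n" for x by (simp add: tr_def Cn_def)
  have tr_add: "tr (\<lambda>i. x i + y i) = (\<lambda>i. tr x i + tr y i)" and tr_scale: "tr (cscale c x) = cscale c (tr x)"
    for x y c by (auto simp: tr_def cscale_def)
  note Lc = HomC_closed[OF linear_intoD(1)[OF L trC]] and \<gamma>c = HomC_closed[OF \<gamma>(1)]
  have lin: "linear_into (Suc n) L'"
    unfolding linear_into_def
  proof (intro conjI ballI allI)
    show "L' ` Cn (Suc n) \<subseteq> HomC"
      unfolding L'_def using HomC_mult[OF linear_intoD(1)[OF L trC] HomC_scale[OF \<gamma>(1)]] by blast
    show "L' (\<lambda>i. x i + y i) = (\<lambda>z. L' x z \<otimes> L' y z)" for x y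
      unfolding L'_def tr_add
      using linear_intoD(2)[OF L trC trC] HomC_add[OF \<gamma>(1)] Lc \<gamma>c
      by (simp add: distrib_right m_ac fun_eq_iff)
    show "L' (cscale c x) = (\<lambda>z. L' x (cnj c * z))" for c x
      unfolding L'_def tr_scale linear_intoD(3)[OF L trC] by (simp add: cscale_def mult_ac)
  qed
  moreover have "inj_on L' (Cn (Suc n))"
  proof (rule linear_into_inj[OF lin])
    fix x assume x: "x \<in> Cn (Suc n)" "\<And>z. L' x z = \<one>"
    have xn: "x n = 0"
    proof (rule ccontr)
      assume nz: "x n \<noteq> 0"
      \<comment> \<open>The solution for \<gamma> of the linear relation expressed by
        \<open>L' x\<close> being trivial.\<close>
      let ?y = "cscale (- inverse (x n)) (tr x)"
      have "L ?y z = \<gamma> z" for z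
      proof -
        \<comment> \<open>Chosen so that \<open>cnj (x n) * ?w = z\<close>, which makes the last
          factor of \<open>L' x ?w\<close> equal to \<open>\<gamma> z\<close>.\<close>
        let ?w = "inverse (cnj (x n)) * z"
        have "L (tr x) ?w \<otimes> \<gamma> z = \<one>"
          using x(2)[of ?w] nz by (simp add: L'_def mult.assoc[symmetric])
        then have "\<gamma> z \<otimes> L (tr x) ?w = \<one>" using Lc \<gamma>c by (simp add: m_comm)
        then have "inv (L (tr x) ?w) = \<gamma> z" using Lc \<gamma>c by (intro inv_equality)
        moreover have "L ?y z = L (tr x) (- ?w)"
          using linear_intoD(3)[OF L trC] by simp
        ultimately show ?thesis using HomC_minus[OF linear_intoD(1)[OF L trC]] by simp
      qed
      then have "L ?y = \<gamma>" by (simp add: fun_eq_iff)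
      moreover have "?y \<in> Cn n" by (rule Cn_cscale[OF trC])
      ultimately show False using \<gamma>(2) by blast
    qed
    then have "L (tr x) z = \<one>" for z
      using x(2)[of z] HomC_zero[OF \<gamma>(1)] Lc by (simp add: L'_def)
    then have "L (tr x) = L (\<lambda>i. 0)" using linear_into_zero[OF L] by (simp add: fun_eq_iff)
    then have "tr x = (\<lambda>i. 0)" using inj trC by (simp add: inj_on_def Cn_def)
    then have tr0: "tr x i = 0" for i by simp
    have "x i = 0" for i
      using tr0[of i] xn x(1)
      by (cases i n rule: linorder_cases) (auto simp: tr_def Cn_def)
    then show "x = (\<lambda>i. 0)" by (simp add: fun_eq_iff)
  qed
  ultimately show ?thesis using that by blast
qed

text \<open>Dimensions of injective linear maps are bounded by \<open>N\<close>, and dimension 0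
  occurs, so a largest one exists. An injective map of this dimension is onto, since it could
  otherwise be extended.\<close>

lemma linear_onto_exists:
  assumes O: "openin \<tau> O1" "\<one> \<in> O1" and e: "continuous_map (subtopology \<tau> O1) (Euclidean_space N) e" "inj_on e O1"
  obtains n L where "linear_onto n L"
proof -
  let ?P = "\<lambda>n. \<exists>L. linear_into n L \<and> inj_on L (Cn n)"
  have "linear_into 0 (\<lambda>x z. \<one>)"
    using HomC_one by (auto simp: linear_into_def)
  moreover have "inj_on (\<lambda>x z. \<one>) (Cn 0)"
    by (auto simp: inj_on_def Cn_def)
  ultimately have P0: "?P 0" by blast
  have bound: "\<forall>n. ?P n \<longrightarrow> n \<le> N"
    using linear_into_dim_le[OF _ _ O e] by blast
  obtain n where n: "?P n" "\<forall>m. ?P m \<longrightarrow> m \<le> n"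
    using Nat.ex_has_greatest_nat[OF P0 bound] by blast
  then obtain L where L: "linear_into n L" "inj_on L (Cn n)" by blast
  have "HomC \<subseteq> L ` Cn n"
  proof
    fix \<gamma> assume "\<gamma> \<in> HomC"
    show "\<gamma> \<in> L ` Cn n"
    proof (rule ccontr)
      assume "\<gamma> \<notin> L ` Cn n"
      then obtain L' where "linear_into (Suc n) L'" "inj_on L' (Cn (Suc n))"
        using linear_into_extend[OF L \<open>\<gamma> \<in> HomC\<close>] by blast
      then have "Suc n \<le> n" using n(2) by blast
      then show False by simp
    qed
  qed
  moreover have "L ` Cn n \<subseteq> HomC" using linear_intoD(1)[OF L(1)] by blast
  ultimately have "linear_onto n L"
    using L by (simp add: linear_onto_def bij_betw_def)
  then show ?thesis using that by blast
qed

lemma linear_ontoD: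
  assumes "linear_onto n L"
  shows "linear_into n L" "inj_on L (Cn n)" "L ` Cn n = HomC"
  using assms by (auto simp: linear_onto_def bij_betw_def)

definition Hom_top :: "(complex \<Rightarrow> 'a) topology" where
  "Hom_top = compact_open euclidean Y HomC"

lemma topspace_Hom_top: "topspace Hom_top = HomC"
  unfolding Hom_top_def by (rule topspace_compact_open) (use HomC_closed carrier_subset in auto)

text \<open>Distinct homomorphisms are separated by their values at one argument. This makes the
  images of compact sets under linear maps closed, which the openness of linear isomorphisms rests
  on.\<close>

lemma Hausdorff_Hom_top: "Hausdorff_space Hom_top"
  unfolding Hausdorff_space_def topspace_Hom_top
proof (intro allI impI, elim conjE)
  fix \<gamma> \<delta> assume \<gamma>: "\<gamma> \<in> HomC" "\<delta> \<in> HomC" "\<gamma> \<noteq> \<delta>"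
  then obtain z where z: "\<gamma> z \<noteq> \<delta> z" by (auto simp: fun_eq_iff)
  then obtain U V where UV: "openin \<tau> U" "openin \<tau> V" "\<gamma> z \<in> U" "\<delta> z \<in> V" "disjnt U V"
    using Hausdorff HomC_closed[OF \<gamma>(1), of z] HomC_closed[OF \<gamma>(2), of z] topspace_tau
    unfolding Hausdorff_space_def by metis
  obtain U' V' where U': "openin Y U'" "U = U' \<inter> carrier A" and V': "openin Y V'" "V = V' \<inter> carrier A"
    using UV(1,2) by (auto simp: openin_subtopology)
  have "openin Hom_top {f \<in> HomC. f ` {z} \<subseteq> U'}" "openin Hom_top {f \<in> HomC. f ` {z} \<subseteq> V'}"
    unfolding Hom_top_def
    using openin_compact_open[of euclidean "{z}" Y U' HomC] openin_compact_open[of euclidean "{z}" Y V' HomC]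
      U'(1) V'(1) by simp_all
  moreover have "disjnt {f \<in> HomC. f ` {z} \<subseteq> U'} {f \<in> HomC. f ` {z} \<subseteq> V'}"
    using UV(5) U'(2) V'(2) HomC_closed unfolding disjnt_def by auto
  ultimately show "\<exists>U V. openin Hom_top U \<and> openin Hom_top V \<and> \<gamma> \<in> U \<and> \<delta> \<in> V \<and> disjnt U V"
    using UV(3,4) U'(2) V'(2) \<gamma>(1,2) by (intro exI[of _ "{f \<in> HomC. f ` {z} \<subseteq> U'}"] exI[of _ "{f \<in> HomC. f ` {z} \<subseteq> V'}"]) auto
qed

text \<open>A subbasic condition of the compact-open topology quantifies over a compact set, so
  joint continuity and the tube lemma suffice.\<close>

lemma linear_into_continuous:
  assumes L: "linear_into n L"
  shows "continuous_map (top_of_set (Cn n)) Hom_top L"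
  unfolding Hom_top_def
proof (rule continuous_map_into_compact_open)
  show "L \<in> topspace (top_of_set (Cn n)) \<rightarrow> HomC"
    using linear_intoD(1)[OF L] by auto
  fix K :: "complex set" and U assume KU: "compactin euclidean K" "openin Y U"
  let ?X = "prod_topology (top_of_set (Cn n)) (euclidean :: complex topology)"
  let ?W = "{p \<in> topspace ?X. L (fst p) (snd p) \<in> U \<inter> carrier A}"
  have "openin \<tau> (U \<inter> carrier A)" using KU(2) by (auto simp: openin_subtopology)
  then have "openin ?X ?W"
    by (rule openin_continuous_map_preimage[OF linear_into_jointly_continuous[OF L]])
  from openin_all_compactin[OF this KU(1)]
  have "openin (top_of_set (Cn n)) {x \<in> Cn n. \<forall>z\<in>K. (x, z) \<in> ?W}" by simp
  moreover have "{x \<in> Cn n. \<forall>z\<in>K. (x, z) \<in> ?W} = {x \<in> topspace (top_of_set (Cn n)). L x ` K \<subseteq> U}"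
    using HomC_closed[OF linear_intoD(1)[OF L]] by auto
  ultimately show "openin (top_of_set (Cn n)) {x \<in> topspace (top_of_set (Cn n)). L x ` K \<subseteq> U}"
    by simp
qed

text \<open>A uniform form of injectivity on the unit sphere. For each \<open>v\<close> some
  argument keeps \<open>L w\<close> away from a neighbourhood of the unit for all \<open>w\<close>
  near \<open>v\<close>; finitely many such \<open>v\<close> suffice, and \<open>R\<close> bounds
  their arguments.\<close>

lemma linear_into_sphere_separated:
  assumes L: "linear_into n L" and inj: "inj_on L (Cn n)"
  obtains N R where "openin \<tau> N" "\<one> \<in> N" "R > 0"
    "\<And>v. v \<in> Cn n \<Longrightarrow> l1 n v = 1 \<Longrightarrow> \<exists>z. cmod z \<le> R \<and> L v z \<notin> N"
proof -
  let ?S = "{x :: nat \<Rightarrow> complex. (\<forall>i\<ge>n. x i = 0) \<and> l1 n x = 1}"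
  have SC: "?S \<subseteq> Cn n" by (auto simp: Cn_def)
  define P where "P v z M V \<longleftrightarrow> openin \<tau> M \<and> \<one> \<in> M \<and> open V \<and> v \<in> V \<and> (\<forall>w \<in> V \<inter> Cn n. L w z \<notin> M)"
    for v z M V
  have "\<exists>z M V. P v z M V" if v: "v \<in> ?S" for v
  proof -
    have vC: "v \<in> Cn n" using v SC by blast
    have "v \<noteq> (\<lambda>i. 0)" using v by auto
    then have "L v \<noteq> L (\<lambda>i. 0)" using inj_on_eq_iff[OF inj vC, of "\<lambda>i. 0"] by (simp add: Cn_def)
    then obtain z where z: "L v z \<noteq> \<one>"
      using linear_into_zero[OF L] by (auto simp: fun_eq_iff)
    then obtain M1 M where M: "openin \<tau> M1" "openin \<tau> M" "L v z \<in> M1" "\<one> \<in> M" "disjnt M1 M"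
      using Hausdorff HomC_closed[OF linear_intoD(1)[OF L vC], of z] topspace_tau
      unfolding Hausdorff_space_def by (metis one_closed)
    have "openin (top_of_set (Cn n)) {x \<in> topspace (top_of_set (Cn n)). L x z \<in> M1}"
      by (rule openin_continuous_map_preimage[OF linear_into_continuous_at_point[OF L] M(1)])
    then obtain V where V: "open V" "{x \<in> Cn n. L x z \<in> M1} = Cn n \<inter> V" by (auto simp: openin_open)
    have "v \<in> {x \<in> Cn n. L x z \<in> M1}" using M(3) vC by simp
    then have "v \<in> V" unfolding V(2) by (rule IntD2)
    moreover have "L w z \<notin> M" if "w \<in> V \<inter> Cn n" for w
    proof -
      have "w \<in> {x \<in> Cn n. L x z \<in> M1}" using that unfolding V(2) by blast
      then show ?thesis using M(5) unfolding disjnt_def by blast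
    qed
    ultimately show ?thesis unfolding P_def using M(2,4) V(1) by blast
  qed
  then have "\<forall>v\<in>?S. \<exists>p. P v (fst p) (fst (snd p)) (snd (snd p))"
    by simp
  from bchoice[OF this] obtain p where p: "\<forall>v\<in>?S. P v (fst (p v)) (fst (snd (p v))) (snd (snd (p v)))" ..
  define z where "z v = fst (p v)" for v
  define M where "M v = fst (snd (p v))" for v
  define V where "V v = snd (snd (p v))" for v
  have "P v (z v) (M v) (V v)" if "v \<in> ?S" for v
    unfolding z_def M_def V_def by (rule bspec[OF p that])
  then have zMV: "openin \<tau> (M v) \<and> \<one> \<in> M v \<and> open (V v) \<and> v \<in> V v \<and>
      (\<forall>w \<in> V v \<inter> Cn n. L w (z v) \<notin> M v)" if "v \<in> ?S" for v
    using that unfolding P_def by blast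
  obtain D where D: "D \<subseteq> ?S" "finite D" "?S \<subseteq> (\<Union>v\<in>D. V v)"
    by (rule compactE_image[OF compact_unit_l1_sphere[of n 1], of ?S V]) (use zMV in auto)
  \<comment> \<open>For \<open>n = 0\<close> the sphere, and with it \<open>D\<close>, is empty; the
    carrier then serves as the neighbourhood.\<close>
  let ?N = "carrier A \<inter> (\<Inter>v\<in>D. M v)"
  define R where "R = Max (insert 1 ((\<lambda>v. cmod (z v)) ` D))"
  show ?thesis
  proof (rule that)
    show "openin \<tau> ?N"
    proof (cases "D = {}")
      case True
      then show ?thesis using openin_topspace[of \<tau>] topspace_tau by simp
    next
      case False
      have "openin \<tau> (\<Inter>v\<in>D. M v)" using D(1,2) False zMV by (intro openin_INT2) blast+
      then show ?thesis using openin_Int[OF openin_topspace[of \<tau>]] topspace_tau by simp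
    qed
    show "\<one> \<in> ?N" using D(1) zMV by blast
    have "1 \<le> R" unfolding R_def using D(2) by (intro Max_ge) auto
    then show "R > 0" by simp
    show "\<exists>z. cmod z \<le> R \<and> L v z \<notin> ?N" if "v \<in> Cn n" "l1 n v = 1" for v
    proof -
      have "v \<in> ?S" using that by (simp add: Cn_def)
      then obtain u where u: "u \<in> D" "v \<in> V u" using D(3) by blast
      have "L v (z u) \<notin> M u" using zMV[of u] u that(1) D(1) by blast
      moreover have "cmod (z u) \<le> R" unfolding R_def using D(2) u(1) by (intro Max_ge) auto
      ultimately show ?thesis using u(1) by blast
    qed
  qed
qed

text \<open>
  The only question is local boundedness of the inverse: if \<open>L x\<close> maps a small disc into a small
  neighbourhood of the unit, then \<open>x\<close> is bounded, because rescaling \<open>x\<close> to the unit sphere rescales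
  the disc.
\<close>

lemma linear_onto_open_map:
  assumes L: "linear_onto n L"
  shows "open_map (top_of_set (Cn n)) Hom_top L"
  unfolding open_map_def
proof (intro allI impI)
  note Li = linear_ontoD(1)[OF L] and inj = linear_ontoD(2)[OF L] and onto = linear_ontoD(3)[OF L]
  fix V assume V: "openin (top_of_set (Cn n)) V"
  obtain N R where N: "openin \<tau> N" "\<one> \<in> N" and R: "R > 0"
    and sep: "\<And>v. v \<in> Cn n \<Longrightarrow> l1 n v = 1 \<Longrightarrow> \<exists>z. cmod z \<le> R \<and> L v z \<notin> N"
    using linear_into_sphere_separated[OF Li inj] by blast
  obtain N' where N': "openin Y N'" "N = N' \<inter> carrier A" using N(1) by (auto simp: openin_subtopology)
  show "openin Hom_top (L ` V)"
  proof (subst openin_subopen, intro ballI)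
    fix \<gamma> assume "\<gamma> \<in> L ` V"
    then obtain x0 where x0: "x0 \<in> V" "\<gamma> = L x0" by blast
    have VC: "V \<subseteq> Cn n" using openin_subset[OF V] by simp
    have gH: "\<gamma> \<in> HomC" using x0 VC linear_intoD(1)[OF Li] by blast
    have "openin euclidean {z \<in> topspace euclidean. \<gamma> z \<in> N}"
      by (rule openin_continuous_map_preimage[OF HomC_continuous[OF gH] N(1)])
    then have "open {z. \<gamma> z \<in> N}" by simp
    moreover have "0 \<in> {z. \<gamma> z \<in> N}" using HomC_zero[OF gH] N(2) by simp
    ultimately obtain \<rho> where \<rho>: "\<rho> > 0" "cball 0 \<rho> \<subseteq> {z. \<gamma> z \<in> N}"
      using open_contains_cball by blast
    define W where "W = {f \<in> HomC. f ` cball 0 \<rho> \<subseteq> N'}"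
    have W: "openin Hom_top W"
      unfolding W_def Hom_top_def using N'(1) by (intro openin_compact_open) auto
    have "\<gamma> \<in> W" unfolding W_def using \<rho>(2) gH N'(2) by auto
    let ?b = "R / \<rho>"
    have bd: "l1 n x \<le> ?b" if x: "x \<in> Cn n" "L x \<in> W" for x
    proof (rule ccontr)
      assume "\<not> l1 n x \<le> ?b"
      then have big: "R / \<rho> < l1 n x" by simp
      then have pos: "l1 n x > 0" using R \<rho>(1) by (meson divide_pos_pos less_trans)
      let ?r = "complex_of_real (l1 n x)" let ?v = "cscale (inverse ?r) x"
      have r: "cmod ?r = l1 n x" using pos by (simp only: norm_of_real)
      have "l1 n ?v = 1" unfolding l1_cscale norm_inverse r using pos by simp
      then obtain z where z: "cmod z \<le> R" "L ?v z \<notin> N" using sep[OF Cn_cscale[OF x(1)]] by blast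
      let ?w = "cnj (inverse ?r) * z"
      have "cmod ?w = cmod z / l1 n x"
        unfolding norm_mult complex_mod_cnj norm_inverse r by (simp add: field_simps)
      also have "\<dots> \<le> \<rho>"
        using z(1) big pos \<rho>(1) by (simp add: pos_divide_le_eq pos_divide_less_eq mult.commute)
      finally have "L x ?w \<in> N'" using x(2) by (auto simp: W_def)
      then have "L ?v z \<in> N"
        using linear_intoD(3)[OF Li x(1), of "inverse ?r" z] N'(2) HomC_closed[OF linear_intoD(1)[OF Li x(1)]] by simp
      then show False using z(2) by simp
    qed
    let ?B = "{x \<in> Cn n. l1 n x \<le> ?b}"
    obtain V' where V': "open V'" "V = Cn n \<inter> V'" using V by (auto simp: openin_open)
    \<comment> \<open>The image of this set is compact, hence closed. Removing it from
      \<open>W\<close> leaves a neighbourhood of \<gamma> all of whose members come from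
      \<open>V\<close>, because every preimage of an element of \<open>W\<close> lies in
      \<open>?B\<close>.\<close>
    have "compact (?B - V')"
    proof -
      let ?box = "{x :: nat \<Rightarrow> complex. \<forall>i. x i \<in> cball 0 ?b}"
      have "closed (Cn n \<inter> {x. l1 n x \<le> ?b} \<inter> - V')"
        unfolding Cn_def using V'(1)
        by (intro closed_Int closed_coordinate_vanishing closed_Collect_le continuous_intros continuous_on_coordinate) auto
      then have "compact (?box \<inter> (Cn n \<inter> {x. l1 n x \<le> ?b} \<inter> - V'))"
        by (intro compact_Int_closed compact_fun_box compact_cball)
      moreover have "x \<in> ?box" if "x \<in> ?B" for x
      proof -
        have "cmod (x i) \<le> ?b" for i
        proof (cases "i < n")
          case True
          then show ?thesis using cmod_le_l1[of i n x] that by simp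
        next
          case False
          then show ?thesis using that R \<rho>(1) by (simp add: Cn_def)
        qed
        then show ?thesis by simp
      qed
      then have "?box \<inter> (Cn n \<inter> {x. l1 n x \<le> ?b} \<inter> - V') = ?B - V'" by blast
      ultimately show ?thesis by simp
    qed
    then have "compactin (top_of_set (Cn n)) (?B - V')" by (auto simp: compactin_subtopology)
    from image_compactin[OF this linear_into_continuous[OF Li]]
    have "closedin Hom_top (L ` (?B - V'))" by (rule compactin_imp_closedin[OF Hausdorff_Hom_top])
    then have "openin Hom_top (W - L ` (?B - V'))" using W by (rule openin_diff[rotated])
    moreover have "\<gamma> \<in> W - L ` (?B - V')"
    proof -
      have "\<gamma> \<notin> L ` (?B - V')"
      proof
        assume "\<gamma> \<in> L ` (?B - V')"
        then obtain x where "x \<in> Cn n" "x \<notin> V'" "L x0 = L x" using x0(2) by auto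
        then have "x0 = x" using inj x0(1) VC by (auto simp: inj_on_def)
        then show False using x0(1) V'(2) \<open>x \<notin> V'\<close> by blast
      qed
      then show ?thesis using \<open>\<gamma> \<in> W\<close> by blast
    qed
    moreover have "W - L ` (?B - V') \<subseteq> L ` V"
    proof
      fix f assume f: "f \<in> W - L ` (?B - V')"
      then have "f \<in> L ` Cn n" unfolding onto by (simp add: W_def)
      then obtain x where x: "x \<in> Cn n" "f = L x" by blast
      have "x \<in> ?B" using bd x f by blast
      then have "x \<in> V'" using f x(2) by blast
      then show "f \<in> L ` V" using x V'(2) by blast
    qed
    ultimately show "\<exists>T. openin Hom_top T \<and> \<gamma> \<in> T \<and> T \<subseteq> L ` V" by blast
  qed
qed

lemma linear_onto_homeomorphic_map:
  assumes "linear_onto n L"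
  shows "homeomorphic_map (top_of_set (Cn n)) Hom_top L"
  using linear_ontoD[OF assms] linear_onto_open_map[OF assms] linear_into_continuous
  by (intro bijective_open_imp_homeomorphic_map) (auto simp: topspace_Hom_top)

end

section \<open>Frames of a transitive action on a closed surface\<close>

text \<open>The situation on the base of a bundle, stripped of bundle and smooth structure. The
  charts enter only as homeomorphisms with open subsets of the plane, to which dimension arguments
  apply.\<close>

locale surface_action = hausdorff_abelian_group A Y
  for A :: "'a monoid" (structure) and Y :: "'a topology" +
  fixes \<Sigma> :: "'s topology" and act :: "'a \<Rightarrow> 's \<Rightarrow> 's"
  assumes continuous_act: "a \<in> carrier A \<Longrightarrow> continuous_map \<Sigma> \<Sigma> (act a)"
    and act_one: "x \<in> topspace \<Sigma> \<Longrightarrow> act \<one> x = x"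
    and act_mult: "a \<in> carrier A \<Longrightarrow> b \<in> carrier A \<Longrightarrow> x \<in> topspace \<Sigma> \<Longrightarrow> act (a \<otimes> b) x = act a (act b x)"
    and continuous_orbit: "x \<in> topspace \<Sigma> \<Longrightarrow> continuous_map (subtopology Y (carrier A)) \<Sigma> (\<lambda>a. act a x)"
    and Hausdorff_surface: "Hausdorff_space \<Sigma>"
    and compact_surface: "compact_space \<Sigma>"
    and connected_surface: "connected_space \<Sigma>"
    and nonempty_surface: "topspace \<Sigma> \<noteq> {}"
    and surface_chart: "x \<in> topspace \<Sigma> \<Longrightarrow> \<exists>U (\<phi> :: 's \<Rightarrow> real \<times> real). openin \<Sigma> U \<and> x \<in> U \<and>
      open (\<phi> ` U) \<and> homeomorphic_map (subtopology \<Sigma> U) (top_of_set (\<phi> ` U)) \<phi>"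
begin

definition frames :: "(complex \<Rightarrow> 'a) set" where
  "frames = {\<gamma> \<in> HomC. \<forall>x\<in>topspace \<Sigma>. \<forall>y\<in>topspace \<Sigma>. \<exists>z. act (\<gamma> z) x = y}"

lemma act_in: "a \<in> carrier A \<Longrightarrow> x \<in> topspace \<Sigma> \<Longrightarrow> act a x \<in> topspace \<Sigma>"
  using continuous_map_in_topspace[OF continuous_act] .

lemma orbit_continuous:
  assumes "\<gamma> \<in> HomC" "x \<in> topspace \<Sigma>"
  shows "continuous_map euclidean \<Sigma> (\<lambda>z. act (\<gamma> z) x)"
  using continuous_map_compose[OF HomC_continuous[OF assms(1)] continuous_orbit[OF assms(2)]]
  by (simp add: comp_def)

lemma act_HomC_add:
  assumes "\<gamma> \<in> HomC" "x \<in> topspace \<Sigma>"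
  shows "act (\<gamma> (z + w)) x = act (\<gamma> z) (act (\<gamma> w) x)"
  using assms by (simp add: HomC_add act_mult HomC_closed)

lemma act_HomC_zero: "\<gamma> \<in> HomC \<Longrightarrow> x \<in> topspace \<Sigma> \<Longrightarrow> act (\<gamma> 0) x = x"
  by (simp add: HomC_zero act_one)

lemma act_HomC_eq_iff:
  assumes g: "\<gamma> \<in> HomC" and x: "x \<in> topspace \<Sigma>"
  shows "act (\<gamma> z) x = act (\<gamma> w) x \<longleftrightarrow> act (\<gamma> (z - w)) x = x"
proof
  assume eq: "act (\<gamma> z) x = act (\<gamma> w) x"
  have "act (\<gamma> (z - w)) x = act (\<gamma> (- w)) (act (\<gamma> z) x)"
    using act_HomC_add[OF g x, of "- w" z] by simp
  also have "\<dots> = act (\<gamma> (- w + w)) x"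
    unfolding eq act_HomC_add[OF g x] ..
  finally show "act (\<gamma> (z - w)) x = x" using act_HomC_zero[OF g x] by simp
next
  assume eq: "act (\<gamma> (z - w)) x = x"
  have "act (\<gamma> z) x = act (\<gamma> w) (act (\<gamma> (z - w)) x)"
    using act_HomC_add[OF g x, of w "z - w"] by simp
  then show "act (\<gamma> z) x = act (\<gamma> w) x" unfolding eq .
qed

lemma closedin_stabilizer:
  assumes "continuous_map Z \<Sigma> f" "x \<in> topspace \<Sigma>"
  shows "closedin Z {z \<in> topspace Z. f z = x}"
  using closedin_continuous_map_preimage[OF assms(1), of "{x}"] assms(2) Hausdorff_imp_t1_space[OF Hausdorff_surface]
  by (simp add: t1_space_closedin_singleton)

text \<open>An injective continuous map from a compact set into a Hausdorff space is an embedding.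
  An interior point of its image would thus yield a continuous injection of a nonempty open subset
  of the plane into the real line.\<close>

lemma interior_of_arc_empty:
  fixes I :: "real set"
  assumes I: "compact I" and f: "continuous_map (top_of_set I) \<Sigma> f" and inj: "inj_on f I"
  shows "\<Sigma> interior_of (f ` I) = {}"
proof (rule ccontr)
  assume ne: "\<Sigma> interior_of (f ` I) \<noteq> {}"
  let ?V = "\<Sigma> interior_of (f ` I)"
  obtain p where p: "p \<in> ?V" using ne by blast
  have Vsub: "?V \<subseteq> f ` I" by (rule interior_of_subset)
  have pS: "p \<in> topspace \<Sigma>" by (rule subsetD[OF interior_of_subset_topspace p])
  obtain U and \<phi> :: "'s \<Rightarrow> real \<times> real" where U: "openin \<Sigma> U" "p \<in> U" "open (\<phi> ` U)"
      "homeomorphic_map (subtopology \<Sigma> U) (top_of_set (\<phi> ` U)) \<phi>"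
    using surface_chart[OF pS] by blast
  have US: "topspace \<Sigma> \<inter> U = U" using openin_subset[OF U(1)] by blast
  have opVU: "openin \<Sigma> (?V \<inter> U)" using U(1) by (intro openin_Int openin_interior_of)
  have opD: "open (\<phi> ` (?V \<inter> U))"
  proof -
    have "openin (subtopology \<Sigma> U) (?V \<inter> U)"
      using opVU by (auto simp: openin_subtopology)
    then have "openin (top_of_set (\<phi> ` U)) (\<phi> ` (?V \<inter> U))"
      using homeomorphic_imp_open_map[OF U(4)] by (simp add: open_map_def)
    then show ?thesis using U(3) openin_open_eq by blast
  qed
  have "embedding_map (top_of_set I) \<Sigma> f"
    using I f inj Hausdorff_surface
    by (intro continuous_imp_embedding_map) (auto simp: compact_space_subtopology)
  then have "homeomorphic_map (top_of_set I) (subtopology \<Sigma> (f ` I)) f"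
    by (simp add: embedding_map_def)
  then obtain g where g: "homeomorphic_maps (top_of_set I) (subtopology \<Sigma> (f ` I)) f g"
    by (auto simp: homeomorphic_map_maps)
  obtain h where h: "homeomorphic_maps (subtopology \<Sigma> U) (top_of_set (\<phi> ` U)) \<phi> h"
    using U(4) by (auto simp: homeomorphic_map_maps)
  have h\<phi>: "h (\<phi> x) = x" if "x \<in> U" for x
    using h that US by (auto simp: homeomorphic_maps_def)
  have fI: "f ` I \<subseteq> topspace \<Sigma>" using continuous_map_image_subset_topspace[OF f] by simp
  have fg: "f (g y) = y" if "y \<in> f ` I" for y
    using g that fI by (auto simp: homeomorphic_maps_def)
  have "continuous_map (top_of_set (\<phi> ` (?V \<inter> U))) (subtopology \<Sigma> (f ` I)) h"
  proof -
    have "continuous_map (top_of_set (\<phi> ` U)) \<Sigma> h"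
      using h by (auto simp: homeomorphic_maps_def dest: continuous_map_into_fulltopology)
    then have "continuous_map (top_of_set (\<phi> ` (?V \<inter> U))) \<Sigma> h"
      using continuous_map_from_subtopology_mono[of _ "\<phi> ` U" _ h "\<phi> ` (?V \<inter> U)"] by blast
    moreover have "h \<in> \<phi> ` (?V \<inter> U) \<rightarrow> f ` I" using h\<phi> Vsub by auto
    ultimately show ?thesis by (simp add: continuous_map_in_subtopology)
  qed
  moreover have "continuous_map (subtopology \<Sigma> (f ` I)) euclideanreal g"
    using g by (auto simp: homeomorphic_maps_def dest: continuous_map_into_fulltopology)
  ultimately have "continuous_map (top_of_set (\<phi> ` (?V \<inter> U))) euclideanreal (g \<circ> h)"
    by (rule continuous_map_compose)
  then have "continuous_on (\<phi> ` (?V \<inter> U)) (g \<circ> h)" by simp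
  moreover have "inj_on (g \<circ> h) (\<phi> ` (?V \<inter> U))"
  proof (rule inj_onI)
    fix a b assume "a \<in> \<phi> ` (?V \<inter> U)" "b \<in> \<phi> ` (?V \<inter> U)" and eq: "(g \<circ> h) a = (g \<circ> h) b"
    then obtain x y where xy: "x \<in> ?V \<inter> U" "a = \<phi> x" "y \<in> ?V \<inter> U" "b = \<phi> y" by blast
    then have "g x = g y" using eq h\<phi> by simp
    moreover have "f (g x) = x" "f (g y) = y" using fg xy Vsub by blast+
    ultimately show "a = b" using xy by metis
  qed
  moreover have "\<phi> ` (?V \<inter> U) \<noteq> {}" using p U(2) by blast
  ultimately have "DIM(real \<times> real) \<le> DIM(real)"
    by (intro invariance_of_dimension[OF _ opD])
  then show False by simp
qed

lemma no_isolated_point: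
  assumes "x \<in> topspace \<Sigma>"
  shows "topspace \<Sigma> \<noteq> {x}"
proof
  assume eq: "topspace \<Sigma> = {x}"
  obtain U and \<phi> :: "'s \<Rightarrow> real \<times> real" where U: "openin \<Sigma> U" "x \<in> U" "open (\<phi> ` U)"
    using surface_chart[OF assms] by blast
  then have "U = {x}" using eq openin_subset[OF U(1)] by blast
  then show False using U(3) not_open_singleton[of "\<phi> x"] by simp
qed

section \<open>Characterization of frames by the absence of real lines in stabilizers\<close>

text \<open>A stabilizing line would leave only one real parameter to sweep out the surface, which
  would then be a countable union of compact arcs. Each of them is closed with empty interior,
  contrary to Baire's theorem.\<close>

lemma frame_stabilizer_no_line:
  assumes \<gamma>: "\<gamma> \<in> frames" and x: "x \<in> topspace \<Sigma>" and v: "v \<noteq> 0"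
  shows "\<exists>t::real. act (\<gamma> (of_real t * v)) x \<noteq> x"
proof (rule ccontr)
  assume "\<nexists>t::real. act (\<gamma> (of_real t * v)) x \<noteq> x"
  then have fixv: "act (\<gamma> (of_real t * v)) x = x" for t :: real by blast
  have g: "\<gamma> \<in> HomC" using \<gamma> by (simp add: frames_def)
  \<comment> \<open>Since \<open>v\<close> and \<open>\<i> * v\<close> span C over the reals and the
    line through \<open>v\<close> fixes \<open>x\<close>, the orbit of \<open>x\<close> is the range
    of \<open>f\<close>.\<close>
  define f where "f t = act (\<gamma> (of_real t * (\<i> * v))) x" for t :: real
  have surj: "\<exists>t. f t = y" if y: "y \<in> topspace \<Sigma>" for y
  proof -
    obtain z where z: "act (\<gamma> z) x = y" using \<gamma> x y unfolding frames_def by blast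
    define w where "w = z / v"
    have "z = (of_real (Re w) + \<i> * of_real (Im w)) * v"
      using v complex_eq[of w] by (simp add: w_def)
    then have "z = of_real (Im w) * (\<i> * v) + of_real (Re w) * v" by (simp add: algebra_simps)
    then have "act (\<gamma> z) x = f (Im w)"
      using act_HomC_add[OF g x] fixv by (simp add: f_def)
    then show ?thesis using z by (intro exI[of _ "Im w"]) simp
  qed
  have cf: "continuous_map euclideanreal \<Sigma> f"
  proof -
    have "continuous_map euclideanreal euclidean (\<lambda>t. of_real t * (\<i> * v))"
      by (simp add: continuous_intros)
    from continuous_map_compose[OF this orbit_continuous[OF g x]]
    show ?thesis by (simp add: f_def[abs_def] comp_def)
  qed
  have f_eq: "f s = f t \<longleftrightarrow> f (s - t) = x" for s t
    unfolding f_def using act_HomC_eq_iff[OF g x] by (simp add: left_diff_distrib)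
  have f0: "f 0 = x" using act_HomC_zero[OF g x] by (simp add: f_def)
  show False
  proof (cases "\<forall>t. f t = x")
    case True
    then have "topspace \<Sigma> = {x}" using surj x by blast
    then show False using no_isolated_point[OF x] by blast
  next
    case False
    \<comment> \<open>A single closed proper subgroup of the reals is treated as a family over a
      one-point parameter space.\<close>
    obtain \<delta> where \<delta>: "\<delta> > 0" "\<And>t v. v \<in> {0::real} \<Longrightarrow> 0 < \<bar>t\<bar> \<Longrightarrow> \<bar>t\<bar> < \<delta> \<Longrightarrow> \<not> f t = x"
    proof (rule compact_family_discrete[of "{0::real}" "\<lambda>t v. f t = x"])
      have "continuous_map (top_of_set (UNIV \<times> {0::real})) \<Sigma> (f \<circ> fst)"
        by (rule continuous_map_compose[OF _ cf]) (auto intro!: continuous_intros)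
      from closedin_stabilizer[OF this x]
      show "closedin (top_of_set (UNIV \<times> {0::real})) {p. snd p \<in> {0} \<and> f (fst p) = x}"
        by (rule back_subst[of "closedin (top_of_set (UNIV \<times> {0::real}))"]) auto
      show "f (s + t) = x" if "f s = x" "f t = x" for s t
        using that f_eq[of "s + t" t] by simp
      show "f (- t) = x" if "f t = x" for t
        using that f_eq[of 0 t] f0 by simp
    qed (use False in auto)
    \<comment> \<open>Length \<open>\<delta>/2\<close> keeps differences within one interval below
      \<delta>, so that \<open>f\<close> is injective on it.\<close>
    define I where "I j = {of_int j * (\<delta>/2) .. (of_int j + 1) * (\<delta>/2)}" for j :: int
    have inj: "inj_on f (I j)" for j
    proof (rule inj_onI, rule ccontr)
      fix s t assume st: "s \<in> I j" "t \<in> I j" "f s = f t" "s \<noteq> t"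
      then have "s - t \<le> \<delta>/2" "t - s \<le> \<delta>/2" by (auto simp: I_def distrib_right)
      then have "\<bar>s - t\<bar> < \<delta>" using \<delta>(1) by linarith
      then show False using \<delta>(2)[of 0 "s - t"] st f_eq[of s t] by simp
    qed
    have cI: "compact (I j)" for j by (simp add: I_def)
    have fI: "continuous_map (top_of_set (I j)) \<Sigma> f" for j
      by (rule continuous_map_from_subtopology[OF cf])
    have "\<Sigma> interior_of \<Union> (range (\<lambda>j. f ` I j)) = {}"
    proof (rule Baire_category_alt)
      show "completely_metrizable_space \<Sigma> \<or> locally_compact_space \<Sigma> \<and> regular_space \<Sigma>"
        using compact_imp_locally_compact_space[OF compact_surface]
          compact_Hausdorff_imp_regular_space[OF compact_surface Hausdorff_surface] by blast
      show "countable (range (\<lambda>j. f ` I j))" by simp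
      fix T assume "T \<in> range (\<lambda>j. f ` I j)"
      then obtain j where T: "T = f ` I j" by blast
      have "compactin \<Sigma> (f ` I j)"
        by (rule image_compactin[OF _ cf]) (simp add: cI)
      then show "closedin \<Sigma> T \<and> \<Sigma> interior_of T = {}"
        unfolding T using compactin_imp_closedin[OF Hausdorff_surface] interior_of_arc_empty[OF cI fI inj] by blast
    qed
    moreover have "\<Union> (range (\<lambda>j. f ` I j)) = topspace \<Sigma>"
    proof
      show "\<Union> (range (\<lambda>j. f ` I j)) \<subseteq> topspace \<Sigma>"
        using continuous_map_in_topspace[OF cf] by auto
      show "topspace \<Sigma> \<subseteq> \<Union> (range (\<lambda>j. f ` I j))"
      proof
        fix y assume "y \<in> topspace \<Sigma>"
        then obtain t where t: "f t = y" using surj by blast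
        define j where "j = \<lfloor>t / (\<delta>/2)\<rfloor>"
        have "of_int j \<le> t / (\<delta>/2)" "t / (\<delta>/2) \<le> of_int j + 1" unfolding j_def by linarith+
        then have "t \<in> I j" using \<delta>(1) by (simp add: I_def field_simps)
        then show "y \<in> \<Union> (range (\<lambda>j. f ` I j))" using t by blast
      qed
    qed
    ultimately show False using nonempty_surface by (simp add: interior_of_topspace)
  qed
qed

text \<open>Discreteness is applied to all real lines through 0 at once, with the compact circle of
  directions as parameter space. It makes the orbit map injective on a small disc, and in a chart
  invariance of domain makes its image open.\<close>

lemma no_line_imp_orbit_contains_open:
  assumes g: "\<gamma> \<in> HomC" and x: "x \<in> topspace \<Sigma>"
    and no_line: "\<And>v. v \<in> sphere 0 1 \<Longrightarrow> \<exists>t::real. act (\<gamma> (of_real t * v)) x \<noteq> x"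
  obtains V where "openin \<Sigma> V" "x \<in> V" "V \<subseteq> range (\<lambda>z. act (\<gamma> z) x)"
proof -
  let ?f = "\<lambda>z. act (\<gamma> z) x"
  obtain \<delta> where \<delta>: "\<delta> > 0" "\<And>t v. v \<in> sphere (0::complex) 1 \<Longrightarrow> 0 < \<bar>t\<bar> \<Longrightarrow> \<bar>t\<bar> < \<delta> \<Longrightarrow> \<not> ?f (of_real t * v) = x"
  proof (rule compact_family_discrete[of "sphere (0::complex) 1" "\<lambda>t v. ?f (of_real t * v) = x"])
    have "continuous_map (top_of_set (UNIV \<times> sphere (0::complex) 1)) euclidean (\<lambda>p. of_real (fst p) * snd p)"
      unfolding continuous_map_iff_continuous by (intro continuous_intros)
    from continuous_map_compose[OF this orbit_continuous[OF g x]]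
    have "continuous_map (top_of_set (UNIV \<times> sphere (0::complex) 1)) \<Sigma> (\<lambda>p. ?f (of_real (fst p) * snd p))"
      by (simp add: comp_def)
    from closedin_stabilizer[OF this x]
    show "closedin (top_of_set (UNIV \<times> sphere (0::complex) 1))
        {p. snd p \<in> sphere (0::complex) 1 \<and> ?f (of_real (fst p) * snd p) = x}"
      by (rule back_subst[of "closedin (top_of_set (UNIV \<times> sphere (0::complex) 1))"]) auto
    show "?f (of_real (s + t) * v) = x" if "?f (of_real s * v) = x" "?f (of_real t * v) = x" for s t :: real and v
      using act_HomC_add[OF g x, of "of_real s * v" "of_real t * v"] that by (simp add: distrib_right)
    show "?f (of_real (- t) * v) = x" if "?f (of_real t * v) = x" for t :: real and v
      using act_HomC_eq_iff[OF g x, of 0 "of_real t * v"] that act_HomC_zero[OF g x] by simp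
  qed (use no_line in auto)
  have noz: "?f z \<noteq> x" if "z \<noteq> 0" "cmod z < \<delta>" for z
  proof -
    let ?v = "z / of_real (cmod z)"
    have "?v \<in> sphere 0 1" using that(1) by (simp add: norm_divide)
    from \<delta>(2)[OF this, of "cmod z"] show ?thesis using that by simp
  qed
  have inj: "inj_on ?f (ball 0 (\<delta>/2))"
  proof (rule inj_onI, rule ccontr)
    fix z w assume zw: "z \<in> ball 0 (\<delta>/2)" "w \<in> ball 0 (\<delta>/2)" "?f z = ?f w" "z \<noteq> w"
    have "cmod (z - w) < \<delta>" using zw(1,2) norm_triangle_ineq4[of z w] by simp
    then show False using noz[of "z - w"] zw(3,4) act_HomC_eq_iff[OF g x, of z w] by simp
  qed
  obtain U and \<phi> :: "'s \<Rightarrow> real \<times> real" where U: "openin \<Sigma> U" "x \<in> U" "open (\<phi> ` U)"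
      "homeomorphic_map (subtopology \<Sigma> U) (top_of_set (\<phi> ` U)) \<phi>"
    using surface_chart[OF x] by blast
  have US: "topspace \<Sigma> \<inter> U = U" using openin_subset[OF U(1)] by blast
  have injphi: "inj_on \<phi> U" using homeomorphic_imp_injective_map[OF U(4)] US by simp
  define W where "W = ball 0 (\<delta>/2) \<inter> {z. ?f z \<in> U}"
  have "openin euclidean {z \<in> topspace euclidean. ?f z \<in> U}"
    by (rule openin_continuous_map_preimage[OF orbit_continuous[OF g x] U(1)])
  then have opW: "open W" unfolding W_def by (intro open_Int) auto
  have cW: "continuous_map (top_of_set W) (subtopology \<Sigma> U) ?f"
    using continuous_map_from_subtopology[OF orbit_continuous[OF g x], of W]
    by (auto simp: continuous_map_in_subtopology W_def)
  have c\<phi>: "continuous_map (subtopology \<Sigma> U) euclidean \<phi>"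
    using homeomorphic_imp_continuous_map[OF U(4)] continuous_map_into_fulltopology by blast
  have "continuous_on W (\<phi> \<circ> ?f)"
    using continuous_map_compose[OF cW c\<phi>] by simp
  moreover have "inj_on (\<phi> \<circ> ?f) W"
  proof (rule comp_inj_on)
    show "inj_on ?f W" by (rule inj_on_subset[OF inj]) (auto simp: W_def)
    show "inj_on \<phi> (?f ` W)" by (rule inj_on_subset[OF injphi]) (auto simp: W_def)
  qed
  ultimately have "open ((\<phi> \<circ> ?f) ` W)"
    by (intro invariance_of_domain_gen[OF opW]) simp_all
  then have "openin (subtopology \<Sigma> U) {y \<in> topspace (subtopology \<Sigma> U). \<phi> y \<in> (\<phi> \<circ> ?f) ` W}"
    by (intro openin_continuous_map_preimage[OF c\<phi>]) simp
  moreover have "{y \<in> topspace (subtopology \<Sigma> U). \<phi> y \<in> (\<phi> \<circ> ?f) ` W} = ?f ` W"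
  proof -
    have sub: "?f ` W \<subseteq> U" by (auto simp: W_def)
    have "\<phi> y \<in> \<phi> ` (?f ` W) \<longleftrightarrow> y \<in> ?f ` W" if "y \<in> U" for y
      using inj_on_image_mem_iff[OF injphi that sub] .
    then show ?thesis using US sub by (auto simp: image_comp[symmetric])
  qed
  ultimately have "openin (subtopology \<Sigma> U) (?f ` W)" by simp
  then have "openin \<Sigma> (?f ` W)" using U(1) openin_trans_full by blast
  moreover have "x \<in> ?f ` W"
    using act_HomC_zero[OF g x] U(2) \<delta>(1) by (intro image_eqI[of _ _ 0]) (auto simp: W_def)
  ultimately show ?thesis using that by blast
qed

text \<open>Translating \<open>V\<close> along the orbit of \<open>x\<close> shows that this orbit
  is open. Since \<open>A\<close> is commutative, it permutes the orbits of \<gamma>, and by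
  transitivity every orbit is a translate of that of \<open>x\<close>. So the complement is open
  too, and connectedness leaves a single orbit.\<close>

lemma no_line_imp_frame:
  assumes trans: "\<And>x y. x \<in> topspace \<Sigma> \<Longrightarrow> y \<in> topspace \<Sigma> \<Longrightarrow> \<exists>a\<in>carrier A. act a x = y"
    and g: "\<gamma> \<in> HomC" and x: "x \<in> topspace \<Sigma>"
    and no_line: "\<And>v. v \<in> sphere 0 1 \<Longrightarrow> \<exists>t::real. act (\<gamma> (of_real t * v)) x \<noteq> x"
  shows "\<gamma> \<in> frames"
proof -
  let ?O = "range (\<lambda>z. act (\<gamma> z) x)"
  obtain V where V: "openin \<Sigma> V" "x \<in> V" "V \<subseteq> ?O"
    using no_line_imp_orbit_contains_open[OF g x no_line] by blast
  have OS: "?O \<subseteq> topspace \<Sigma>" using act_in[OF HomC_closed[OF g] x] by blast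
  have "openin \<Sigma> ?O"
  proof (subst openin_subopen, intro ballI)
    fix y assume "y \<in> ?O"
    then obtain z where z: "y = act (\<gamma> z) x" by blast
    let ?T = "{u \<in> topspace \<Sigma>. act (\<gamma> (- z)) u \<in> V}"
    have "openin \<Sigma> ?T"
      by (rule openin_continuous_map_preimage[OF continuous_act[OF HomC_closed[OF g]] V(1)])
    moreover have "y \<in> ?T"
      using act_HomC_add[OF g x, of "- z" z] act_HomC_zero[OF g x] V(2) act_in[OF HomC_closed[OF g] x]
      by (simp add: z)
    moreover have "?T \<subseteq> ?O"
    proof
      fix u assume u: "u \<in> ?T"
      then obtain w where w: "act (\<gamma> (- z)) u = act (\<gamma> w) x" using V(3) by blast
      have "u = act (\<gamma> z) (act (\<gamma> (- z)) u)"
        using act_HomC_add[OF g, of u z "- z"] act_HomC_zero[OF g] u by simp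
      also have "\<dots> = act (\<gamma> (z + w)) x" unfolding w act_HomC_add[OF g x] ..
      finally show "u \<in> ?O" by blast
    qed
    ultimately show "\<exists>T. openin \<Sigma> T \<and> y \<in> T \<and> T \<subseteq> ?O" by blast
  qed
  moreover have "openin \<Sigma> (topspace \<Sigma> - ?O)"
  proof (subst openin_subopen, intro ballI)
    fix y assume y: "y \<in> topspace \<Sigma> - ?O"
    then obtain a where a: "a \<in> carrier A" "act a x = y" using trans[OF x] by blast
    \<comment> \<open>The translate of the orbit by \<open>a\<close>, that is, the orbit of
      \<open>y\<close> under \<gamma>.\<close>
    let ?T = "{u \<in> topspace \<Sigma>. act (inv a) u \<in> ?O}"
    have "openin \<Sigma> ?T"
      using openin_continuous_map_preimage[OF continuous_act \<open>openin \<Sigma> ?O\<close>] a(1) by simp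
    moreover have "y \<in> ?T"
    proof -
      have "act (inv a) y = act (inv a \<otimes> a) x" using act_mult[of "inv a" a x] a x by simp
      also have "\<dots> = act (\<gamma> 0) x" using a(1) act_one[OF x] act_HomC_zero[OF g x] by simp
      finally show ?thesis using y by blast
    qed
    moreover have "?T \<subseteq> topspace \<Sigma> - ?O"
    proof
      fix u assume u: "u \<in> ?T"
      then obtain w where w: "act (inv a) u = act (\<gamma> w) x" by blast
      have "u \<notin> ?O"
      proof
        assume "u \<in> ?O"
        then obtain z where z: "u = act (\<gamma> z) x" by blast
        have ia: "inv a \<in> carrier A" using a(1) by simp
        have "act (\<gamma> z) (act (inv a) x) = act (inv a) (act (\<gamma> z) x)"
          using act_mult[OF HomC_closed[OF g] ia x, of z] act_mult[OF ia HomC_closed[OF g] x, of z]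
            m_comm[OF HomC_closed[OF g] ia] by simp
        also have "\<dots> = act (\<gamma> w) x" using w z by simp
        finally have e: "act (\<gamma> z) (act (inv a) x) = act (\<gamma> w) x" .
        have ix: "act (inv a) x \<in> topspace \<Sigma>" by (rule act_in[OF ia x])
        have "act (inv a) x = act (\<gamma> (- z)) (act (\<gamma> z) (act (inv a) x))"
          using act_HomC_add[OF g ix, of "- z" z] act_HomC_zero[OF g ix] by simp
        also have "\<dots> = act (\<gamma> (w - z)) x" unfolding e using act_HomC_add[OF g x, of "- z" w] by simp
        finally have e2: "act (inv a) x = act (\<gamma> (w - z)) x" .
        have "x = act (a \<otimes> inv a) x" using a(1) act_one[OF x] by simp
        also have "\<dots> = act a (act (\<gamma> (w - z)) x)" using act_mult[OF a(1) ia x] e2 by simp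
        also have "\<dots> = act (a \<otimes> \<gamma> (w - z)) x"
          by (rule act_mult[OF a(1) HomC_closed[OF g] x, symmetric])
        also have "\<dots> = act (\<gamma> (w - z) \<otimes> a) x"
          by (simp only: m_comm[OF a(1) HomC_closed[OF g]])
        also have "\<dots> = act (\<gamma> (w - z)) y"
          unfolding act_mult[OF HomC_closed[OF g] a(1) x] a(2) ..
        finally have "act (\<gamma> (z - w)) x = act (\<gamma> (z - w)) (act (\<gamma> (w - z)) y)" by simp
        also have "\<dots> = y"
          using act_HomC_add[OF g, of y "z - w" "w - z"] act_HomC_zero[OF g, of y] y by simp
        finally show False using y by blast
      qed
      then show "u \<in> topspace \<Sigma> - ?O" using u by blast
    qed
    ultimately show "\<exists>T. openin \<Sigma> T \<and> y \<in> T \<and> T \<subseteq> topspace \<Sigma> - ?O" by blast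
  qed
  then have "closedin \<Sigma> ?O" using OS by (simp add: closedin_def)
  ultimately have "?O = {} \<or> ?O = topspace \<Sigma>"
    using connected_surface connected_space_clopen_in by blast
  then have O: "?O = topspace \<Sigma>" by blast
  have "\<exists>z. act (\<gamma> z) u = y" if uy: "u \<in> topspace \<Sigma>" "y \<in> topspace \<Sigma>" for u y
  proof -
    obtain z w where "u = act (\<gamma> z) x" "y = act (\<gamma> w) x" using uy O by blast
    then have "act (\<gamma> (w - z)) u = y" using act_HomC_add[OF g x, of "w - z" z] by simp
    then show ?thesis by blast
  qed
  then show ?thesis using g by (simp add: frames_def)
qed

lemma frames_scale:
  assumes "\<gamma> \<in> frames" "c \<noteq> 0"
  shows "(\<lambda>z. \<gamma> (cnj c * z)) \<in> frames"
proof -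
  have "\<exists>z. act (\<gamma> (cnj c * z)) x = y" if "x \<in> topspace \<Sigma>" "y \<in> topspace \<Sigma>" for x y
  proof -
    have "\<forall>x\<in>topspace \<Sigma>. \<forall>y\<in>topspace \<Sigma>. \<exists>z. act (\<gamma> z) x = y"
      using assms(1) by (simp add: frames_def)
    from bspec[OF bspec[OF this that(1)] that(2)] obtain z where "act (\<gamma> z) x = y" ..
    then show ?thesis using assms(2) by (intro exI[of _ "z / cnj c"]) simp
  qed
  moreover have "(\<lambda>z. \<gamma> (cnj c * z)) \<in> HomC"
    using assms(1) by (intro HomC_scale) (simp add: frames_def)
  ultimately show ?thesis by (simp add: frames_def)
qed

text \<open>One point \<open>x\<close> decides whether a homomorphism is a frame. The condition that
  \<open>L u\<close> moves \<open>x\<close> at some time in direction \<open>v\<close> is open in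
  \<open>(u, v)\<close>, and \<open>v\<close> ranges over the compact unit circle.\<close>

lemma openin_frames:
  assumes trans: "\<And>x y. x \<in> topspace \<Sigma> \<Longrightarrow> y \<in> topspace \<Sigma> \<Longrightarrow> \<exists>a\<in>carrier A. act a x = y"
    and L: "linear_into n L"
  shows "openin (top_of_set (Cn n)) {u \<in> Cn n. L u \<in> frames}"
proof -
  obtain x where x: "x \<in> topspace \<Sigma>" using nonempty_surface by blast
  let ?X = "prod_topology (top_of_set (Cn n)) (euclidean :: complex topology)"
  let ?W = "\<lambda>t::real. {p \<in> topspace ?X. act (L (fst p) (of_real t * snd p)) x \<in> topspace \<Sigma> - {x}}"
  have "openin ?X (?W t)" for t
  proof (rule openin_continuous_map_preimage)
    have "continuous_map ?X ?X (\<lambda>p. (fst p, of_real t * snd p))"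
    proof (rule continuous_map_pairedI)
      show "continuous_map ?X (top_of_set (Cn n)) fst" by (rule continuous_map_fst)
      have "continuous_map (euclidean :: complex topology) euclidean (\<lambda>z. of_real t * z)"
        by (simp add: continuous_intros)
      from continuous_map_compose[OF continuous_map_snd this]
      show "continuous_map ?X euclidean (\<lambda>p. of_real t * snd p)" by (simp add: comp_def)
    qed
    from continuous_map_compose[OF continuous_map_compose[OF this linear_into_jointly_continuous[OF L]] continuous_orbit[OF x]]
    show "continuous_map ?X \<Sigma> (\<lambda>p. act (L (fst p) (of_real t * snd p)) x)" by (simp add: comp_def)
    show "openin \<Sigma> (topspace \<Sigma> - {x})"
      using x Hausdorff_imp_t1_space[OF Hausdorff_surface] by (simp add: t1_space_closedin_singleton openin_diff)
  qed
  then have "openin ?X (\<Union>t. ?W t)" by blast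
  moreover have "compactin (euclidean :: complex topology) (sphere 0 1)" by simp
  ultimately have "openin (top_of_set (Cn n)) {u \<in> topspace (top_of_set (Cn n)). \<forall>v\<in>sphere 0 1. (u, v) \<in> (\<Union>t. ?W t)}"
    by (rule openin_all_compactin)
  moreover have "{u \<in> topspace (top_of_set (Cn n)). \<forall>v\<in>sphere 0 1. (u, v) \<in> (\<Union>t. ?W t)} = {u \<in> Cn n. L u \<in> frames}"
  proof -
    have "(\<forall>v\<in>sphere 0 1. (u, v) \<in> (\<Union>t. ?W t)) \<longleftrightarrow> L u \<in> frames" if u: "u \<in> Cn n" for u
    proof -
      note g = linear_intoD(1)[OF L u]
      have "(\<forall>v\<in>sphere 0 1. (u, v) \<in> (\<Union>t. ?W t)) \<longleftrightarrow> (\<forall>v\<in>sphere 0 1. \<exists>t::real. act (L u (of_real t * v)) x \<noteq> x)"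
        using u act_in[OF HomC_closed[OF g] x] by simp
      also have "\<dots> \<longleftrightarrow> L u \<in> frames"
      proof
        assume "\<forall>v\<in>sphere 0 1. \<exists>t::real. act (L u (of_real t * v)) x \<noteq> x"
        then show "L u \<in> frames" by (intro no_line_imp_frame[OF trans g x]) auto
      next
        assume fr: "L u \<in> frames"
        show "\<forall>v\<in>sphere 0 1. \<exists>t::real. act (L u (of_real t * v)) x \<noteq> x"
        proof
          fix v :: complex assume "v \<in> sphere 0 1"
          then have "v \<noteq> 0" by auto
          then show "\<exists>t::real. act (L u (of_real t * v)) x \<noteq> x"
            by (rule frame_stabilizer_no_line[OF fr x])
        qed
      qed
      finally show ?thesis .
    qed
    then show ?thesis by simp blast
  qed
  ultimately show ?thesis by simp
qed

end

section \<open>Topology of manifolds\<close>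

text \<open>Local compactness passes from points to compact sets by a finite cover. It provides the
  compact set in the middle space that continuity of composition needs.\<close>

lemma compact_between:
  assumes X: "locally_compact_space X" "Hausdorff_space X" and C: "compactin X C"
    and W: "openin X W" "C \<subseteq> W"
  obtains V L where "openin X V" "compactin X L" "C \<subseteq> V" "V \<subseteq> L" "L \<subseteq> W"
proof -
  have "neighbourhood_base_of (compactin X) X"
    using X locally_compact_space_neighbourhood_base by blast
  then have nb: "\<forall>W x. openin X W \<and> x \<in> W \<longrightarrow>
      (\<exists>U V. openin X U \<and> compactin X V \<and> x \<in> U \<and> U \<subseteq> V \<and> V \<subseteq> W)"
    unfolding neighbourhood_base_of .
  have "\<forall>x\<in>C. \<exists>p. openin X (fst p) \<and> compactin X (snd p) \<and> x \<in> fst p \<and> fst p \<subseteq> snd p \<and> snd p \<subseteq> W"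
  proof
    fix x assume "x \<in> C"
    then have "openin X W \<and> x \<in> W" using W by blast
    with nb have "\<exists>U V. openin X U \<and> compactin X V \<and> x \<in> U \<and> U \<subseteq> V \<and> V \<subseteq> W" by simp
    then obtain U V where "openin X U" "compactin X V" "x \<in> U" "U \<subseteq> V" "V \<subseteq> W"
      by (elim exE conjE)
    then show "\<exists>p. openin X (fst p) \<and> compactin X (snd p) \<and> x \<in> fst p \<and> fst p \<subseteq> snd p \<and> snd p \<subseteq> W"
      by (intro exI[of _ "(U, V)"]) simp
  qed
  from bchoice[OF this] obtain p where p: "\<forall>x\<in>C. openin X (fst (p x)) \<and> compactin X (snd (p x))
      \<and> x \<in> fst (p x) \<and> fst (p x) \<subseteq> snd (p x) \<and> snd (p x) \<subseteq> W" ..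
  have "\<exists>\<F>. finite \<F> \<and> \<F> \<subseteq> (\<lambda>x. fst (p x)) ` C \<and> C \<subseteq> \<Union>\<F>"
    using p by (intro compactinD[OF C]) blast+
  then obtain D where D: "finite D" "D \<subseteq> C" "C \<subseteq> (\<Union>x\<in>D. fst (p x))"
    by (metis finite_subset_image)
  show ?thesis
  proof (rule that)
    show "openin X (\<Union>x\<in>D. fst (p x))" using D(2) p by blast
    show "compactin X (\<Union>x\<in>D. snd (p x))" using D(1,2) p by (intro compactin_Union) blast+
    show "C \<subseteq> (\<Union>x\<in>D. fst (p x))" by fact
    show "(\<Union>x\<in>D. fst (p x)) \<subseteq> (\<Union>x\<in>D. snd (p x))" using D(2) p by blast
    show "(\<Union>x\<in>D. snd (p x)) \<subseteq> W" using D(2) p by blast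
  qed
qed

text \<open>The coordinates are bounded on the ball, which is therefore a closed part of the
  continuous image of a compact box.\<close>

lemma compact_cball_finite_dim:
  fixes B :: "'e::real_normed_vector set"
  assumes "finite B" "span B = UNIV"
  shows "compact (cball (a::'e) r)"
proof -
  obtain n :: nat and c :: "nat \<Rightarrow> 'e \<Rightarrow> real" and b :: "nat \<Rightarrow> 'e"
    where c: "\<And>i. i < n \<Longrightarrow> bounded_linear (c i)" "\<And>x. x = (\<Sum>i<n. c i x *\<^sub>R b i)"
    using finite_dim_coordinates[OF assms] by metis
  have "\<exists>K. \<forall>y\<in>cball a r. \<bar>c i y\<bar> \<le> K" if i: "i < n" for i
  proof -
    obtain K where K: "\<And>y. norm (c i y) \<le> norm y * K" "K > 0"
      using bounded_linear.pos_bounded[OF c(1)[OF i]] by blast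
    have "\<bar>c i y\<bar> \<le> (norm a + r) * K" if "y \<in> cball a r" for y
    proof -
      have "norm y \<le> norm a + r"
        using that norm_triangle_sub[of y a] by (simp add: dist_norm norm_minus_commute)
      then have "norm y * K \<le> (norm a + r) * K" using K(2) by (intro mult_right_mono) auto
      then show ?thesis using K(1)[of y] by simp
    qed
    then show ?thesis by blast
  qed
  then have "\<forall>i\<in>{..<n}. \<exists>K. \<forall>y\<in>cball a r. \<bar>c i y\<bar> \<le> K" by simp
  from bchoice[OF this] obtain K where K: "\<forall>i\<in>{..<n}. \<forall>y\<in>cball a r. \<bar>c i y\<bar> \<le> K i" ..
  let ?T = "\<lambda>s :: nat \<Rightarrow> real. \<Sum>i<n. s i *\<^sub>R b i"
  let ?box = "{s :: nat \<Rightarrow> real. \<forall>i. s i \<in> (if i < n then {- K i..K i} else {0})}"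
  have "compact (?T ` ?box)"
    by (intro compact_continuous_image compact_fun_box continuous_intros continuous_on_coordinate) auto
  then have "compact (?T ` ?box \<inter> cball a r)"
    by (intro compact_Int_closed closed_cball)
  moreover have "cball a r \<subseteq> ?T ` ?box"
  proof
    fix y assume y: "y \<in> cball a r"
    let ?s = "\<lambda>i. if i < n then c i y else 0"
    have "\<bar>c i y\<bar> \<le> K i" if "i < n" for i using K y that by blast
    then have box: "?s \<in> ?box" by (auto simp: abs_le_iff minus_le_iff)
    have "y = ?T ?s" using c(2)[of y] by simp
    then show "y \<in> ?T ` ?box" using box by (rule image_eqI)
  qed
  ultimately show ?thesis by (simp add: Int_absorb1)
qed

lemma smooth_manifold_locally_compact:
  fixes M :: "('a, 'e::real_normed_vector) smfd"
  assumes M: "smooth_manifold M"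
  shows "locally_compact_space (mtop M)"
  unfolding locally_compact_space_def
proof
  fix x assume x: "x \<in> topspace (mtop M)"
  obtain B :: "'e set" where B: "finite B" "span B = UNIV"
    using smooth_manifoldD(5)[OF M] by blast
  obtain U \<phi> where U: "(U, \<phi>) \<in> charts M" "x \<in> U"
    using smooth_manifold_chart_at[OF M x] .
  note c = is_chartD[OF bspec[OF smooth_manifoldD(1)[OF M] U(1)]]
  have op: "open (\<phi> ` U)" by (rule c(4)[OF c(1) subset_refl])
  then obtain r where r: "r > 0" "cball (\<phi> x) r \<subseteq> \<phi> ` U"
    using U(2) open_contains_cball by blast
  obtain h where h: "homeomorphic_maps (subtopology (mtop M) U) (top_of_set (\<phi> ` U)) \<phi> h"
    using c(6) by (auto simp: homeomorphic_map_maps)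
  have ch: "continuous_map (top_of_set (\<phi> ` U)) (mtop M) h"
    using h by (auto simp: homeomorphic_maps_def dest: continuous_map_into_fulltopology)
  have h\<phi>: "h (\<phi> y) = y" if "y \<in> U" for y
    using h that c(5) by (auto simp: homeomorphic_maps_def)
  have "compactin (top_of_set (\<phi> ` U)) (cball (\<phi> x) r)"
    using compact_cball_finite_dim[OF B] r(2) by (simp add: compactin_subtopology)
  from image_compactin[OF this ch] have "compactin (mtop M) (h ` cball (\<phi> x) r)" .
  moreover have "openin (subtopology (mtop M) U) {y \<in> topspace (subtopology (mtop M) U). \<phi> y \<in> ball (\<phi> x) r}"
    by (rule openin_continuous_map_preimage[OF c(3)]) simp
  then have "openin (mtop M) {y \<in> topspace (subtopology (mtop M) U). \<phi> y \<in> ball (\<phi> x) r}"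
    using c(1) by (rule openin_trans_full)
  moreover have "{y \<in> topspace (subtopology (mtop M) U). \<phi> y \<in> ball (\<phi> x) r} \<subseteq> h ` cball (\<phi> x) r"
  proof
    fix y assume "y \<in> {y \<in> topspace (subtopology (mtop M) U). \<phi> y \<in> ball (\<phi> x) r}"
    then have "y = h (\<phi> y)" "\<phi> y \<in> cball (\<phi> x) r" using h\<phi> by auto
    then show "y \<in> h ` cball (\<phi> x) r" by blast
  qed
  moreover have "x \<in> {y \<in> topspace (subtopology (mtop M) U). \<phi> y \<in> ball (\<phi> x) r}"
    using U(2) x r(1) by simp
  ultimately show "\<exists>U K. openin (mtop M) U \<and> compactin (mtop M) K \<and> x \<in> U \<and> U \<subseteq> K" by blast
qed

text \<open>Follows a chart by coordinates of its model space. The values then lie in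
  \<open>Euclidean_space N\<close>, the target in which \<open>linear_into_dim_le\<close> counts
  dimensions.\<close>

lemma smooth_manifold_local_coordinates:
  fixes M :: "('a, 'e::real_normed_vector) smfd"
  assumes M: "smooth_manifold M" and x: "x \<in> topspace (mtop M)"
  obtains U N e where "openin (mtop M) U" "x \<in> U"
    "continuous_map (subtopology (mtop M) U) (Euclidean_space N) e" "inj_on e U"
proof -
  obtain B :: "'e set" where B: "finite B" "span B = UNIV"
    using smooth_manifoldD(5)[OF M] by blast
  obtain n :: nat and c :: "nat \<Rightarrow> 'e \<Rightarrow> real" and b :: "nat \<Rightarrow> 'e"
    where c: "\<And>i. i < n \<Longrightarrow> bounded_linear (c i)" "\<And>x. x = (\<Sum>i<n. c i x *\<^sub>R b i)"
    using finite_dim_coordinates[OF B] by metis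
  obtain U \<phi> where U: "(U, \<phi>) \<in> charts M" "x \<in> U"
    using smooth_manifold_chart_at[OF M x] .
  note ch = is_chartD[OF bspec[OF smooth_manifoldD(1)[OF M] U(1)]]
  define e where "e y = (\<lambda>i. if i < n then c i (\<phi> y) else 0)" for y
  have "continuous_map (subtopology (mtop M) U) (Euclidean_space n) e"
    unfolding e_def continuous_map_componentwise_Euclidean_space
  proof (intro allI impI)
    fix i assume "i < n"
    have "continuous_on UNIV (c i)"
      using bounded_linear.continuous_on[OF c(1)[OF \<open>i < n\<close>] continuous_on_id] .
    then have "continuous_map euclidean euclideanreal (c i)" by simp
    from continuous_map_compose[OF ch(3) this]
    show "continuous_map (subtopology (mtop M) U) euclideanreal (\<lambda>y. c i (\<phi> y))" by (simp add: comp_def)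
  qed
  moreover have "inj_on e U"
  proof (rule inj_onI)
    fix y z assume yz: "y \<in> U" "z \<in> U" "e y = e z"
    have "c i (\<phi> y) = c i (\<phi> z)" if "i < n" for i
      using fun_cong[OF yz(3), of i] that by (simp add: e_def)
    then have "\<phi> y = \<phi> z" using c(2)[of "\<phi> y"] c(2)[of "\<phi> z"] by simp
    then show "y = z" using ch(2) yz(1,2) by (simp add: inj_on_def)
  qed
  ultimately show ?thesis using that ch(1) U(2) by blast
qed

lemma diffeo_inverse:
  assumes "diffeo M N f"
  obtains g where "diffeo N M g" "\<And>x. x \<in> topspace (mtop M) \<Longrightarrow> g (f x) = x"
    "\<And>y. y \<in> topspace (mtop N) \<Longrightarrow> f (g y) = y"
  using assms unfolding diffeo_def by blast

section \<open>The groupoid of principal bundles over tori\<close>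

lemma principal_bundleD:
  assumes "principal_bundle G GM P"
  shows "smooth_manifold (tot P)" "smooth_manifold (base P)" "smooth_map (tot P) (base P) (bproj P)"
    "smooth_map (prod_mfd (tot P) GM) (tot P) (\<lambda>(p, g). bact P p g)"
    "\<And>p. p \<in> pts P \<Longrightarrow> bact P p \<one>\<^bsub>G\<^esub> = p"
    "\<And>p g h. p \<in> pts P \<Longrightarrow> g \<in> carrier G \<Longrightarrow> h \<in> carrier G \<Longrightarrow>
        bact P (bact P p g) h = bact P p (g \<otimes>\<^bsub>G\<^esub> h)"
    "\<And>p g. p \<in> pts P \<Longrightarrow> g \<in> carrier G \<Longrightarrow> bproj P (bact P p g) = bproj P p"
    "\<And>x. x \<in> base_pts P \<Longrightarrow> \<exists>W \<Phi>. openin (mtop (base P)) W \<and> x \<in> W \<and>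
        diffeo (prod_mfd (open_submfd (base P) W) GM)
               (open_submfd (tot P) {p \<in> pts P. bproj P p \<in> W}) \<Phi> \<and>
        (\<forall>y\<in>W. \<forall>g\<in>carrier G. bproj P (\<Phi> (y, g)) = y \<and>
           (\<forall>h\<in>carrier G. \<Phi> (y, g \<otimes>\<^bsub>G\<^esub> h) = bact P (\<Phi> (y, g)) h))"
  using assms unfolding principal_bundle_def by (elim conjE; assumption | blast)+

lemma L2_objD:
  assumes "P \<in> L2_obj G GM"
  shows "principal_bundle G GM P" "torus_surface (base P)" "smooth_manifold (tot P)" "smooth_manifold (base P)"
  using assms principal_bundleD by (auto simp: L2_obj_def)

lemma bproj_in: "P \<in> L2_obj G GM \<Longrightarrow> p \<in> pts P \<Longrightarrow> bproj P p \<in> base_pts P"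
  by (rule smooth_map_in_topspace[OF principal_bundleD(3)[OF L2_objD(1)]])

section \<open>Local trivializations, fibres and morphisms of bundles\<close>

definition trivialization ::
    "'g monoid \<Rightarrow> ('g, 'e::real_normed_vector) smfd \<Rightarrow> ('p, 'b, 'g, 'e) gbundle
      \<Rightarrow> 'b set \<Rightarrow> ('b \<times> 'g \<Rightarrow> 'p) \<Rightarrow> bool" where
  "trivialization G GM P W \<Phi> \<longleftrightarrow>
     diffeo (prod_mfd (open_submfd (base P) W) GM) (open_submfd (tot P) {p \<in> pts P. bproj P p \<in> W}) \<Phi> \<and>
     (\<forall>y\<in>W. \<forall>g\<in>carrier G. bproj P (\<Phi> (y, g)) = y \<and>
        (\<forall>h\<in>carrier G. \<Phi> (y, g \<otimes>\<^bsub>G\<^esub> h) = bact P (\<Phi> (y, g)) h))"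

lemma trivializationD:
  assumes "trivialization G GM P W \<Phi>"
  shows "diffeo (prod_mfd (open_submfd (base P) W) GM) (open_submfd (tot P) {p \<in> pts P. bproj P p \<in> W}) \<Phi>"
    "\<And>y g. y \<in> W \<Longrightarrow> g \<in> carrier G \<Longrightarrow> bproj P (\<Phi> (y, g)) = y"
    "\<And>y g h. y \<in> W \<Longrightarrow> g \<in> carrier G \<Longrightarrow> h \<in> carrier G
      \<Longrightarrow> \<Phi> (y, g \<otimes>\<^bsub>G\<^esub> h) = bact P (\<Phi> (y, g)) h"
  using assms by (simp_all add: trivialization_def)

lemma ex_trivialization:
  assumes P: "P \<in> L2_obj G GM" and x: "x \<in> base_pts P"
  shows "\<exists>W \<Phi>. x \<in> W \<and> trivialization G GM P W \<Phi>"
  using principal_bundleD(8)[OF L2_objD(1)[OF P] x] unfolding trivialization_def by (elim exE conjE) (intro exI conjI)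

lemma bact_in:
  assumes G: "compact_lie_group G GM" and P: "P \<in> L2_obj G GM" and p: "p \<in> pts P" and g: "g \<in> carrier G"
  shows "bact P p g \<in> pts P"
proof -
  have "topspace (mtop GM) = carrier G" using G by (simp add: compact_lie_group_def)
  then show ?thesis
    using smooth_map_in_topspace[OF principal_bundleD(4)[OF L2_objD(1)[OF P]], of "(p, g)"] p g
    by (simp add: prod_mfd_def)
qed

text \<open>In one trivialization two points of a fibre have the same base coordinate, with group
  coordinates \<open>g\<close> and \<open>h\<close>; by equivariance the inverse of \<open>g\<close>
  times \<open>h\<close> carries one to the other.\<close>

lemma fibre_transitive:
  assumes G: "compact_lie_group G GM" and P: "P \<in> L2_obj G GM"
    and pq: "p \<in> pts P" "q \<in> pts P" "bproj P p = bproj P q"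
  obtains g where "g \<in> carrier G" "q = bact P p g"
proof -
  interpret G: group G using G by (simp add: compact_lie_group_def)
  have GM: "topspace (mtop GM) = carrier G" using G by (simp add: compact_lie_group_def)
  obtain W \<Phi> where W: "bproj P p \<in> W" and tr: "trivialization G GM P W \<Phi>"
    using ex_trivialization[OF P bproj_in[OF P pq(1)]] by blast
  note D = trivializationD(1)[OF tr] and \<Phi> = trivializationD(2,3)[OF tr]
  have "\<exists>\<Psi>. diffeo (open_submfd (tot P) {p \<in> pts P. bproj P p \<in> W}) (prod_mfd (open_submfd (base P) W) GM) \<Psi>
      \<and> (\<forall>y\<in>topspace (mtop (open_submfd (tot P) {p \<in> pts P. bproj P p \<in> W})). \<Phi> (\<Psi> y) = y)"
    by (rule diffeo_inverse[OF D]) (intro exI conjI ballI)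
  then obtain \<Psi> where \<Psi>: "diffeo (open_submfd (tot P) {p \<in> pts P. bproj P p \<in> W}) (prod_mfd (open_submfd (base P) W) GM) \<Psi>"
    "\<forall>y\<in>topspace (mtop (open_submfd (tot P) {p \<in> pts P. bproj P p \<in> W})). \<Phi> (\<Psi> y) = y"
    by (elim exE conjE)
  have ex: "\<exists>g\<in>carrier G. q = \<Phi> (bproj P q, g)" if q: "q \<in> pts P" "bproj P q \<in> W" for q
  proof -
    have qt: "q \<in> topspace (mtop (open_submfd (tot P) {p \<in> pts P. bproj P p \<in> W}))"
      using q by (simp add: open_submfd_def)
    have "\<Psi> q \<in> topspace (mtop (prod_mfd (open_submfd (base P) W) GM))"
      by (rule smooth_map_in_topspace[OF diffeo_imp_smooth_map[OF \<Psi>(1)] qt])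
    then obtain y g where yg: "\<Psi> q = (y, g)" "y \<in> W" "g \<in> carrier G"
      using GM by (cases "\<Psi> q") (auto simp: prod_mfd_def open_submfd_def)
    then have q': "q = \<Phi> (y, g)" using bspec[OF \<Psi>(2) qt] by simp
    have y: "y = bproj P q" unfolding q' by (rule \<Phi>(1)[OF yg(2,3), symmetric])
    have "q = \<Phi> (bproj P q, g)" using q' unfolding y .
    then show ?thesis using yg(3) by (rule bexI)
  qed
  obtain g where g: "g \<in> carrier G" "p = \<Phi> (bproj P p, g)"
    using ex[OF pq(1) W] by (rule bexE)
  have "bproj P q \<in> W" using W unfolding pq(3) .
  from ex[OF pq(2) this] obtain h where h: "h \<in> carrier G" "q = \<Phi> (bproj P p, h)"
    unfolding pq(3) by (rule bexE)
  have "q = \<Phi> (bproj P p, g \<otimes>\<^bsub>G\<^esub> (inv\<^bsub>G\<^esub> g \<otimes>\<^bsub>G\<^esub> h))"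
    using h(2) g(1) h(1) by (simp add: G.m_assoc[symmetric])
  also have "\<dots> = bact P (\<Phi> (bproj P p, g)) (inv\<^bsub>G\<^esub> g \<otimes>\<^bsub>G\<^esub> h)"
    using g(1) h(1) by (intro \<Phi>(2)[OF W]) simp_all
  also have "\<dots> = bact P p (inv\<^bsub>G\<^esub> g \<otimes>\<^bsub>G\<^esub> h)" unfolding g(2)[symmetric] ..
  finally show ?thesis using that[of "inv\<^bsub>G\<^esub> g \<otimes>\<^bsub>G\<^esub> h"] g(1) h(1) by simp
qed

lemma bproj_surj:
  assumes G: "compact_lie_group G GM" and P: "P \<in> L2_obj G GM" and x: "x \<in> base_pts P"
  obtains p where "p \<in> pts P" "bproj P p = x"
proof -
  interpret G: group G using G by (simp add: compact_lie_group_def)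
  have GM: "topspace (mtop GM) = carrier G" using G by (simp add: compact_lie_group_def)
  obtain W \<Phi> where W: "x \<in> W" and tr: "trivialization G GM P W \<Phi>"
    using ex_trivialization[OF P x] by blast
  note D = trivializationD(1)[OF tr] and \<Phi> = trivializationD(2,3)[OF tr]
  have "(x, \<one>\<^bsub>G\<^esub>) \<in> topspace (mtop (prod_mfd (open_submfd (base P) W) GM))"
    using W x GM by (simp add: prod_mfd_def open_submfd_def)
  then have "\<Phi> (x, \<one>\<^bsub>G\<^esub>) \<in> topspace (mtop (open_submfd (tot P) {p \<in> pts P. bproj P p \<in> W}))"
    by (rule smooth_map_in_topspace[OF diffeo_imp_smooth_map[OF D]])
  then have "\<Phi> (x, \<one>\<^bsub>G\<^esub>) \<in> pts P" by (simp add: open_submfd_def)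
  moreover have "bproj P (\<Phi> (x, \<one>\<^bsub>G\<^esub>)) = x" by (rule \<Phi>(1)[OF W G.one_closed])
  ultimately show ?thesis using that by blast
qed

lemma L2_morD:
  assumes "f \<in> L2_mor G P Q"
  shows "f \<in> extensional (pts P)" "diffeo (tot P) (tot Q) f"
    "\<And>p g. p \<in> pts P \<Longrightarrow> g \<in> carrier G \<Longrightarrow> f (bact P p g) = bact Q (f p) g"
    "\<exists>h. diffeo (base P) (base Q) h \<and> covers P Q f h"
    "continuous_map (mtop (tot P)) (mtop (tot Q)) f"
    "\<And>p. p \<in> pts P \<Longrightarrow> f p \<in> pts Q" "bij_betw f (pts P) (pts Q)"
proof -
  show f: "f \<in> extensional (pts P)" "diffeo (tot P) (tot Q) f"
    "\<And>p g. p \<in> pts P \<Longrightarrow> g \<in> carrier G \<Longrightarrow> f (bact P p g) = bact Q (f p) g"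
    "\<exists>h. diffeo (base P) (base Q) h \<and> covers P Q f h"
    using assms by (auto simp: L2_mor_def)
  show "continuous_map (mtop (tot P)) (mtop (tot Q)) f"
    by (rule smooth_mapD(1)[OF diffeo_imp_smooth_map[OF f(2)]])
  show in1: "f p \<in> pts Q" if "p \<in> pts P" for p
    by (rule smooth_map_in_topspace[OF diffeo_imp_smooth_map[OF f(2)] that])
  obtain g where g: "diffeo (tot Q) (tot P) g" "\<And>x. x \<in> pts P \<Longrightarrow> g (f x) = x" "\<And>y. y \<in> pts Q \<Longrightarrow> f (g y) = y"
    using diffeo_inverse[OF f(2)] by metis
  show "bij_betw f (pts P) (pts Q)"
    using in1 g(2,3) smooth_map_in_topspace[OF diffeo_imp_smooth_map[OF g(1)]]
    by (intro bij_betw_byWitness[of _ g]) auto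
qed

lemma L2_mor_compose:
  assumes G: "compact_lie_group G GM"
    and P: "P \<in> L2_obj G GM" and Q: "Q \<in> L2_obj G GM" and R: "R \<in> L2_obj G GM"
    and f: "f \<in> L2_mor G P Q" and g: "g \<in> L2_mor G Q R"
  shows "compose (pts P) g f \<in> L2_mor G P R"
proof -
  have "compose (pts P) g f (bact P p a) = bact R (compose (pts P) g f p) a"
    if "p \<in> pts P" "a \<in> carrier G" for p a
    using that L2_morD(3)[OF f that] L2_morD(3)[OF g L2_morD(6)[OF f that(1)] that(2)] bact_in[OF G P that]
    by (simp add: compose_def)
  moreover have "diffeo (tot P) (tot R) (compose (pts P) g f)"
    by (rule diffeo_cong[OF L2_objD(3)[OF P] L2_objD(3)[OF R] _
          diffeo_compose[OF L2_objD(3)[OF P] L2_objD(3)[OF Q] L2_objD(3)[OF R] L2_morD(2)[OF f] L2_morD(2)[OF g]]])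
      (simp add: compose_def)
  moreover have "\<exists>h. diffeo (base P) (base R) h \<and> covers P R (compose (pts P) g f) h"
  proof -
    obtain h k where h: "diffeo (base P) (base Q) h" "covers P Q f h"
      and k: "diffeo (base Q) (base R) k" "covers Q R g k"
      using L2_morD(4)[OF f] L2_morD(4)[OF g] by blast
    have "diffeo (base P) (base R) (k \<circ> h)"
      by (rule diffeo_compose[OF L2_objD(4)[OF P] L2_objD(4)[OF Q] L2_objD(4)[OF R] h(1) k(1)])
    moreover have "covers P R (compose (pts P) g f) (k \<circ> h)"
      using h(2) k(2) L2_morD(6)[OF f] by (simp add: covers_def compose_def)
    ultimately show ?thesis by blast
  qed
  ultimately show ?thesis by (simp add: L2_mor_def compose_def)
qed

lemma L2_inv_props:
  assumes f: "f \<in> L2_mor G P Q"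
  shows "\<And>p. p \<in> pts P \<Longrightarrow> L2_inv P Q f (f p) = p" "\<And>q. q \<in> pts Q \<Longrightarrow> f (L2_inv P Q f q) = q"
    "\<And>q. q \<in> pts Q \<Longrightarrow> L2_inv P Q f q \<in> pts P"
proof -
  have inj: "inj_on f (pts P)" and im: "f ` pts P = pts Q"
    using L2_morD(7)[OF f] by (auto simp: bij_betw_def)
  show "L2_inv P Q f (f p) = p" if "p \<in> pts P" for p
    using the_inv_into_f_f[OF inj that] L2_morD(6)[OF f that] by (simp add: L2_inv_def)
  show "f (L2_inv P Q f q) = q" if "q \<in> pts Q" for q
    using f_the_inv_into_f[OF inj, of q] that im by (simp add: L2_inv_def)
  show "L2_inv P Q f q \<in> pts P" if "q \<in> pts Q" for q
    using the_inv_into_into[OF inj, of q "pts P"] that im by (simp add: L2_inv_def)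
qed

lemma L2_mor_inv:
  assumes G: "compact_lie_group G GM" and P: "P \<in> L2_obj G GM" and Q: "Q \<in> L2_obj G GM"
    and f: "f \<in> L2_mor G P Q"
  shows "L2_inv P Q f \<in> L2_mor G Q P"
proof -
  note inv = L2_inv_props[OF f]
  obtain g where g: "diffeo (tot Q) (tot P) g" "\<And>x. x \<in> pts P \<Longrightarrow> g (f x) = x" "\<And>y. y \<in> pts Q \<Longrightarrow> f (g y) = y"
    using diffeo_inverse[OF L2_morD(2)[OF f]] by metis
  have "g q = L2_inv P Q f q" if "q \<in> pts Q" for q
    using g(2)[OF inv(3)[OF that]] inv(2)[OF that] by simp
  then have "diffeo (tot Q) (tot P) (L2_inv P Q f)"
    by (rule diffeo_cong[OF L2_objD(3)[OF Q] L2_objD(3)[OF P] _ g(1)])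
  moreover have "L2_inv P Q f (bact Q q a) = bact P (L2_inv P Q f q) a" if qa: "q \<in> pts Q" "a \<in> carrier G" for q a
  proof -
    have "f (bact P (L2_inv P Q f q) a) = bact Q q a"
      using L2_morD(3)[OF f inv(3)[OF qa(1)] qa(2)] inv(2)[OF qa(1)] by simp
    then show ?thesis using inv(1)[OF bact_in[OF G P inv(3)[OF qa(1)] qa(2)]] by simp
  qed
  moreover have "\<exists>h. diffeo (base Q) (base P) h \<and> covers Q P (L2_inv P Q f) h"
  proof -
    obtain h where h: "diffeo (base P) (base Q) h" "covers P Q f h"
      using L2_morD(4)[OF f] by blast
    obtain k where k: "diffeo (base Q) (base P) k" "\<And>x. x \<in> base_pts P \<Longrightarrow> k (h x) = x"
      using diffeo_inverse[OF h(1)] by metis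
    have "covers Q P (L2_inv P Q f) k"
      unfolding covers_def
    proof
      fix q assume q: "q \<in> pts Q"
      have "bproj Q q = h (bproj P (L2_inv P Q f q))"
        using h(2) inv(2,3)[OF q] unfolding covers_def by metis
      then show "bproj P (L2_inv P Q f q) = k (bproj Q q)"
        using k(2) bproj_in[OF P inv(3)[OF q]] by simp
    qed
    then show ?thesis using k(1) by blast
  qed
  ultimately show ?thesis by (simp add: L2_mor_def L2_inv_def)
qed

lemma L2_id_mor:
  assumes P: "P \<in> L2_obj G GM" and G: "compact_lie_group G GM"
  shows "L2_id P \<in> L2_mor G P P"
proof -
  have d: "diffeo M M (\<lambda>x. x)" if "smooth_manifold M" for M :: "('x, 'y::real_normed_vector) smfd"
    using smooth_map_id[OF that] unfolding diffeo_def by (intro conjI exI[of _ "\<lambda>x. x"]) auto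
  have "diffeo (tot P) (tot P) (L2_id P)"
    by (rule diffeo_cong[OF L2_objD(3)[OF P] L2_objD(3)[OF P] _ d[OF L2_objD(3)[OF P]]]) (simp add: L2_id_def)
  moreover have "covers P P (L2_id P) (\<lambda>x. x)" by (simp add: covers_def L2_id_def)
  moreover have "L2_id P (bact P p a) = bact P (L2_id P p) a" if "p \<in> pts P" "a \<in> carrier G" for p a
    using bact_in[OF G P that] that by (simp add: L2_id_def)
  ultimately show ?thesis
    using d[OF L2_objD(4)[OF P]] by (auto simp: L2_mor_def L2_id_def)
qed

lemma group_Aut:
  assumes G: "compact_lie_group G GM" and P: "P \<in> L2_obj G GM"
  shows "group (Aut G P)"
proof (rule groupI)
  fix f g h assume f: "f \<in> carrier (Aut G P)" and g: "g \<in> carrier (Aut G P)" and h: "h \<in> carrier (Aut G P)"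
  show "f \<otimes>\<^bsub>Aut G P\<^esub> g \<in> carrier (Aut G P)"
    using f g L2_mor_compose[OF G P P P] by (simp add: Aut_def)
  show "f \<otimes>\<^bsub>Aut G P\<^esub> g \<otimes>\<^bsub>Aut G P\<^esub> h = f \<otimes>\<^bsub>Aut G P\<^esub> (g \<otimes>\<^bsub>Aut G P\<^esub> h)"
    using f g h L2_morD(6) by (fastforce simp: Aut_def compose_def)
next
  show "\<one>\<^bsub>Aut G P\<^esub> \<in> carrier (Aut G P)" using L2_id_mor[OF P G] by (simp add: Aut_def)
next
  fix f assume f: "f \<in> carrier (Aut G P)"
  then have f': "f \<in> L2_mor G P P" by (simp add: Aut_def)
  show "\<one>\<^bsub>Aut G P\<^esub> \<otimes>\<^bsub>Aut G P\<^esub> f = f"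
    using L2_morD(1,6)[OF f'] by (auto simp: Aut_def compose_def L2_id_def fun_eq_iff extensional_def)
  have "compose (pts P) (L2_inv P P f) f = L2_id P"
    using L2_inv_props(1)[OF f'] by (auto simp: compose_def L2_id_def fun_eq_iff)
  then show "\<exists>g\<in>carrier (Aut G P). g \<otimes>\<^bsub>Aut G P\<^esub> f = \<one>\<^bsub>Aut G P\<^esub>"
    using L2_mor_inv[OF G P P f'] by (auto simp: Aut_def)
qed

section \<open>The compact-open topology on automorphisms\<close>

lemma topspace_L2_map: "topspace (L2_map G P Q) = L2_mor G P Q"
  unfolding L2_map_def by (rule topspace_compact_open) (auto dest: L2_morD(6))

lemma openin_L2_map:
  "compactin (mtop (tot P)) K \<Longrightarrow> openin (mtop (tot Q)) U \<Longrightarrow> openin (L2_map G P Q) {f \<in> L2_mor G P Q. f ` K \<subseteq> U}"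
  unfolding L2_map_def by (rule openin_compact_open)

lemma continuous_map_evaluation:
  assumes p: "p \<in> pts P"
  shows "continuous_map (L2_map G P Q) (mtop (tot Q)) (\<lambda>f. f p)"
  unfolding continuous_map_def topspace_L2_map
proof (intro conjI allI impI)
  show "(\<lambda>f. f p) \<in> L2_mor G P Q \<rightarrow> pts Q" by (auto simp: L2_morD(6)[OF _ p])
  fix U assume U: "openin (mtop (tot Q)) U"
  have "compactin (mtop (tot P)) {p}" using p by simp
  from openin_L2_map[OF this U] show "openin (L2_map G P Q) {f \<in> L2_mor G P Q. f p \<in> U}" by simp
qed

lemma Hausdorff_L2_map:
  assumes Q: "Q \<in> L2_obj G GM"
  shows "Hausdorff_space (L2_map G P Q)"
  unfolding Hausdorff_space_def topspace_L2_map
proof (intro allI impI, elim conjE)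
  fix f g assume fg: "f \<in> L2_mor G P Q" "g \<in> L2_mor G P Q" "f \<noteq> g"
  obtain p where p: "p \<in> pts P" "f p \<noteq> g p"
    using fg L2_morD(1)[OF fg(1)] L2_morD(1)[OF fg(2)] extensionalityI by metis
  have "Hausdorff_space (mtop (tot Q))" by (rule smooth_manifoldD(3)[OF L2_objD(3)[OF Q]])
  then obtain U V where UV: "openin (mtop (tot Q)) U" "openin (mtop (tot Q)) V" "f p \<in> U" "g p \<in> V" "disjnt U V"
    using L2_morD(6)[OF fg(1) p(1)] L2_morD(6)[OF fg(2) p(1)] p(2) unfolding Hausdorff_space_def by blast
  let ?E = "\<lambda>U. {h \<in> topspace (L2_map G P Q). h p \<in> U}"
  note op = openin_continuous_map_preimage[OF continuous_map_evaluation[OF p(1), where G=G and Q=Q]]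
  have "openin (L2_map G P Q) (?E U)" "openin (L2_map G P Q) (?E V)"
    by (fact op[OF UV(1)], fact op[OF UV(2)])
  moreover have "f \<in> ?E U" "g \<in> ?E V" using fg UV by (simp_all add: topspace_L2_map)
  moreover have "disjnt (?E U) (?E V)" using UV(5) unfolding disjnt_def by blast
  ultimately show "\<exists>U V. openin (L2_map G P Q) U \<and> openin (L2_map G P Q) V \<and> f \<in> U \<and> g \<in> V \<and> disjnt U V"
    by blast
qed

text \<open>If \<open>f\<close> after \<open>g\<close> maps \<open>K\<close> into \<open>U\<close>,
  local compactness of the total space gives a compact \<open>C\<close> inside the preimage of
  \<open>U\<close> under \<open>f\<close> with an open \<open>V\<close> between the image of
  \<open>K\<close> under \<open>g\<close> and \<open>C\<close>. Maps sending \<open>C\<close> into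
  \<open>U\<close> and maps sending \<open>K\<close> into \<open>V\<close> then compose to maps
  sending \<open>K\<close> into \<open>U\<close>.\<close>

lemma continuous_map_L2_compose:
  assumes G: "compact_lie_group G GM" and P: "P \<in> L2_obj G GM"
  shows "continuous_map (prod_topology (L2_map G P P) (L2_map G P P)) (L2_map G P P) (\<lambda>(f, g). compose (pts P) f g)"
  proof (subst (3) L2_map_def, rule continuous_map_into_compact_open)
  show "(\<lambda>(f, g). compose (pts P) f g) \<in> topspace (prod_topology (L2_map G P P) (L2_map G P P)) \<rightarrow> L2_mor G P P"
    using L2_mor_compose[OF G P P P] by (auto simp: topspace_L2_map)
  fix K U assume K: "compactin (mtop (tot P)) K" and U: "openin (mtop (tot P)) U"
  let ?X = "prod_topology (L2_map G P P) (L2_map G P P)"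
  let ?S = "{z \<in> topspace ?X. (case z of (f, g) \<Rightarrow> compose (pts P) f g) ` K \<subseteq> U}"
  have KP: "K \<subseteq> pts P" using compactin_subset_topspace[OF K] .
  show "openin ?X ?S"
  proof (subst openin_subopen, intro ballI)
    fix z assume z: "z \<in> ?S"
    then obtain f g where fg: "z = (f, g)" "f \<in> L2_mor G P P" "g \<in> L2_mor G P P" "compose (pts P) f g ` K \<subseteq> U"
      by (auto simp: topspace_L2_map)
    let ?W = "{p \<in> pts P. f p \<in> U}"
    have W: "openin (mtop (tot P)) ?W"
      by (rule openin_continuous_map_preimage[OF L2_morD(5)[OF fg(2)] U])
    have gK: "g ` K \<subseteq> ?W"
      using fg(4) KP L2_morD(6)[OF fg(3)] by (auto simp: compose_def)
    obtain V C where VC: "openin (mtop (tot P)) V" "compactin (mtop (tot P)) C" "g ` K \<subseteq> V" "V \<subseteq> C" "C \<subseteq> ?W"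
      using compact_between[OF smooth_manifold_locally_compact[OF L2_objD(3)[OF P]]
          smooth_manifoldD(3)[OF L2_objD(3)[OF P]] image_compactin[OF K L2_morD(5)[OF fg(3)]] W gK] by blast
    let ?A = "{h \<in> L2_mor G P P. h ` C \<subseteq> U}" and ?B = "{h \<in> L2_mor G P P. h ` K \<subseteq> V}"
    have "openin ?X (?A \<times> ?B)"
      unfolding openin_prod_Times_iff using openin_L2_map[OF VC(2) U] openin_L2_map[OF K VC(1)] by blast
    moreover have "z \<in> ?A \<times> ?B" using fg VC by auto
    moreover have "?A \<times> ?B \<subseteq> ?S"
    proof
      fix w assume "w \<in> ?A \<times> ?B"
      then obtain a b where ab: "w = (a, b)" "a \<in> ?A" "b \<in> ?B" by blast
      have "compose (pts P) a b k \<in> U" if "k \<in> K" for k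
      proof -
        have "b k \<in> C" using ab(3) VC(4) that by blast
        then have "a (b k) \<in> U" using ab(2) by blast
        then show ?thesis using that KP by (auto simp: compose_def)
      qed
      then show "w \<in> ?S" using ab by (auto simp: topspace_L2_map)
    qed
    ultimately show "\<exists>T. openin ?X T \<and> z \<in> T \<and> T \<subseteq> ?S" by blast
  qed
qed

section \<open>Dimension of complex coordinate spaces\<close>

lemma Cn_injection_dim_le:
  assumes f: "continuous_map (top_of_set (Cn n)) (top_of_set (Cn m)) f" and inj: "inj_on f (Cn n)"
  shows "n \<le> m"
proof -
  define d where "d x = (\<lambda>k. if k < 2*m then (if even k then Re (x (k div 2)) else Im (x (k div 2))) else 0)"
    for x :: "nat \<Rightarrow> complex"
  have "continuous_map (top_of_set (Cn m)) (Euclidean_space (2*m)) d"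
    unfolding d_def continuous_map_componentwise_Euclidean_space
  proof (intro allI impI)
    fix k
    have "continuous_on (Cn m) (\<lambda>x. Re (x (k div 2)))" "continuous_on (Cn m) (\<lambda>x. Im (x (k div 2)))"
      by (intro continuous_on_Re continuous_on_Im continuous_on_coordinate)+
    then show "continuous_map (top_of_set (Cn m)) euclideanreal
        (\<lambda>x. if even k then Re (x (k div 2)) else Im (x (k div 2)))"
      by (cases "even k") simp_all
  qed
  from continuous_map_compose[OF f this]
  have df: "continuous_map (top_of_set (Cn n)) (Euclidean_space (2*m)) (d \<circ> f)" .
  have "inj_on d (Cn m)"
  proof (rule inj_onI)
    fix x y assume xy: "x \<in> Cn m" "y \<in> Cn m" "d x = d y"
    have "x i = y i" for i
    proof (cases "i < m")
      case True
      then show ?thesis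
        using fun_cong[OF xy(3), of "2*i"] fun_cong[OF xy(3), of "2*i+1"]
        by (simp add: d_def complex_eq_iff)
    next
      case False
      then show ?thesis using xy(1,2) by (simp add: Cn_def)
    qed
    then show "x = y" ..
  qed
  then have "inj_on d (f ` Cn n)"
    by (rule inj_on_subset) (use continuous_map_image_subset_topspace[OF f] in auto)
  then have "inj_on (d \<circ> f) (Cn n)" by (rule comp_inj_on[OF inj])
  moreover have "openin (top_of_set (Cn n)) (Cn n)" by simp
  moreover have "(\<lambda>i. 0) \<in> Cn n" by (simp add: Cn_def)
  ultimately have "2 * n \<le> 2 * m" using Cn_open_injection_dim_le[OF _ _ df] by blast
  then show ?thesis by simp
qed

text \<open>Comparing two isomorphisms through their common target gives continuous injections
  between C^n and C^m in both directions. This justifies the definite description in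
  \<open>Hom_C_dim\<close>.\<close>

lemma (in hausdorff_abelian_group) linear_onto_dim_unique:
  assumes L: "linear_onto n L" and L': "linear_onto m L'"
  shows "n = m"
proof -
  have le: "n \<le> m" if L: "linear_onto n L" and L': "linear_onto m L'" for n m L L'
  proof -
    obtain g where g: "homeomorphic_maps (top_of_set (Cn m)) Hom_top L' g"
      using linear_onto_homeomorphic_map[OF L'] by (auto simp: homeomorphic_map_maps)
    have "continuous_map Hom_top (top_of_set (Cn m)) g" and gi: "\<And>h. h \<in> HomC \<Longrightarrow> L' (g h) = h"
      using g by (auto simp: homeomorphic_maps_def topspace_Hom_top)
    then have "continuous_map (top_of_set (Cn n)) (top_of_set (Cn m)) (g \<circ> L)"
      using linear_into_continuous[OF linear_ontoD(1)[OF L]] continuous_map_compose by blast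
    moreover have "inj_on (g \<circ> L) (Cn n)"
    proof (rule comp_inj_on[OF linear_ontoD(2)[OF L]])
      show "inj_on g (L ` Cn n)" unfolding linear_ontoD(3)[OF L] by (rule inj_on_inverseI[of _ L']) (rule gi)
    qed
    ultimately show ?thesis by (rule Cn_injection_dim_le)
  qed
  show ?thesis using le[OF L L'] le[OF L' L] by simp
qed

section \<open>Compact abelian groups of automorphisms of a bundle\<close>

definition aut_group :: "'g monoid \<Rightarrow> ('p, 'b, 'g, 'e::real_normed_vector) orb_obj \<Rightarrow> ('p \<Rightarrow> 'p) monoid" where
  "aut_group G X = Aut G (fst X)\<lparr>carrier := snd X\<rparr>"

text \<open>Makes the covered map of the base a function of \<open>t\<close>, where
  \<open>covers\<close> only relates the two. The result does not depend on the chosen point of the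
  fibre, because an automorphism covers some map.\<close>

definition base_act :: "('p, 'b, 'g, 'e) gbundle \<Rightarrow> ('p \<Rightarrow> 'p) \<Rightarrow> 'b \<Rightarrow> 'b" where
  "base_act P t x = bproj P (t (SOME p. p \<in> pts P \<and> bproj P p = x))"

lemma Orb_ab_objD:
  assumes "X \<in> Orb_ab_obj G GM"
  shows "fst X \<in> L2_obj G GM" "subgroup (snd X) (Aut G (fst X))"
    "\<And>s t. s \<in> snd X \<Longrightarrow> t \<in> snd X \<Longrightarrow> compose (pts (fst X)) s t = compose (pts (fst X)) t s"
    "\<And>t. t \<in> snd X \<Longrightarrow> t \<in> L2_mor G (fst X) (fst X)"
proof -
  show "fst X \<in> L2_obj G GM" "subgroup (snd X) (Aut G (fst X))"
    "\<And>s t. s \<in> snd X \<Longrightarrow> t \<in> snd X \<Longrightarrow> compose (pts (fst X)) s t = compose (pts (fst X)) t s"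
    using assms by (auto simp: Orb_ab_obj_def Aut_def)
  then show "t \<in> L2_mor G (fst X) (fst X)" if "t \<in> snd X" for t
    using subgroup.subset[of "snd X" "Aut G (fst X)"] that by (auto simp: Aut_def)
qed

lemma aut_group_simps:
  "carrier (aut_group G X) = snd X" "s \<otimes>\<^bsub>aut_group G X\<^esub> t = compose (pts (fst X)) s t"
  "\<one>\<^bsub>aut_group G X\<^esub> = L2_id (fst X)"
  by (simp_all add: aut_group_def Aut_def)

lemma hausdorff_abelian_group_aut_group:
  assumes G: "compact_lie_group G GM" and X: "X \<in> Orb_ab_obj G GM"
  shows "hausdorff_abelian_group (aut_group G X) (L2_map G (fst X) (fst X))"
proof -
  let ?P = "fst X" let ?Y = "L2_map G ?P ?P" let ?T = "snd X"
  note P = Orb_ab_objD(1)[OF X]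
  have "group (aut_group G X)"
    unfolding aut_group_def
    by (rule subgroup.subgroup_is_group[OF Orb_ab_objD(2)[OF X] group_Aut[OF G P]])
  then have "comm_group (aut_group G X)"
    by (rule group.group_comm_groupI) (simp add: aut_group_simps Orb_ab_objD(3)[OF X])
  moreover have sub: "?T \<subseteq> topspace ?Y"
    using Orb_ab_objD(4)[OF X] by (auto simp: topspace_L2_map)
  moreover have "Hausdorff_space (subtopology ?Y ?T)"
    by (rule Hausdorff_space_subtopology[OF Hausdorff_L2_map[OF P]])
  moreover have "continuous_map (prod_topology (subtopology ?Y ?T) (subtopology ?Y ?T)) (subtopology ?Y ?T)
      (\<lambda>(a, b). compose (pts ?P) a b)"
    unfolding continuous_map_in_subtopology
  proof
    show "continuous_map (prod_topology (subtopology ?Y ?T) (subtopology ?Y ?T)) ?Y (\<lambda>(a, b). compose (pts ?P) a b)"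
      unfolding subtopology_Times[symmetric]
      by (rule continuous_map_from_subtopology[OF continuous_map_L2_compose[OF G P]])
    show "(\<lambda>(a, b). compose (pts ?P) a b) \<in> topspace (prod_topology (subtopology ?Y ?T) (subtopology ?Y ?T)) \<rightarrow> ?T"
      using subgroup.m_closed[OF Orb_ab_objD(2)[OF X]] by (auto simp: Aut_def)
  qed
  ultimately show ?thesis
    by (simp add: hausdorff_abelian_group_def hausdorff_abelian_group_axioms_def aut_group_simps)
qed

lemma base_act_bproj:
  assumes t: "t \<in> L2_mor G P P" and p: "p \<in> pts P"
  shows "base_act P t (bproj P p) = bproj P (t p)"
proof -
  obtain h where h: "covers P P t h" using L2_morD(4)[OF t] by blast
  let ?q = "SOME q. q \<in> pts P \<and> bproj P q = bproj P p"
  have "?q \<in> pts P \<and> bproj P ?q = bproj P p" by (rule someI[of _ p]) (simp add: p)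
  then show ?thesis using h p by (simp add: covers_def base_act_def)
qed

lemma base_act_covers:
  assumes G: "compact_lie_group G GM" and P: "P \<in> L2_obj G GM" and t: "t \<in> L2_mor G P P"
    and h: "covers P P t h" and x: "x \<in> base_pts P"
  shows "base_act P t x = h x"
proof -
  obtain p where p: "p \<in> pts P" "bproj P p = x" using bproj_surj[OF G P x] by blast
  show ?thesis using base_act_bproj[OF t p(1)] h p by (simp add: covers_def)
qed

text \<open>These properties pass to the surface along the continuous surjection from the product of
  two circles.\<close>

lemma torus_surface_compact_connected:
  assumes "torus_surface S"
  shows "compact_space (mtop S)" "connected_space (mtop S)" "topspace (mtop S) \<noteq> {}"
proof -
  obtain f where f: "diffeo (prod_mfd circle circle) S f" using assms by (auto simp: torus_surface_def)
  let ?C = "prod_mfd circle circle"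
  have C: "mtop ?C = top_of_set (sphere (0::complex) 1 \<times> sphere (0::complex) 1)"
    by (simp add: prod_mfd_def circle_def)
  note cf = smooth_mapD(1)[OF diffeo_imp_smooth_map[OF f]]
  obtain g where g: "diffeo S ?C g" "\<And>x. x \<in> topspace (mtop ?C) \<Longrightarrow> g (f x) = x" "\<And>y. y \<in> topspace (mtop S) \<Longrightarrow> f (g y) = y"
    using diffeo_inverse[OF f] by metis
  have sur: "f ` topspace (mtop ?C) = topspace (mtop S)"
  proof
    show "f ` topspace (mtop ?C) \<subseteq> topspace (mtop S)" using continuous_map_in_topspace[OF cf] by blast
    show "topspace (mtop S) \<subseteq> f ` topspace (mtop ?C)"
    proof
      fix y assume y: "y \<in> topspace (mtop S)"
      have "g y \<in> topspace (mtop ?C)" by (rule smooth_map_in_topspace[OF diffeo_imp_smooth_map[OF g(1)] y])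
      then show "y \<in> f ` topspace (mtop ?C)" using g(3)[OF y] by (metis imageI)
    qed
  qed
  have "compactin (mtop ?C) (topspace (mtop ?C))"
    unfolding C by (simp add: compactin_subtopology compact_Times)
  from image_compactin[OF this cf] show "compact_space (mtop S)" by (simp add: sur compact_space_def)
  have "connected (sphere (0::complex) 1)" by (rule connected_sphere) simp
  then have "connectedin (mtop ?C) (topspace (mtop ?C))"
    unfolding C by (simp add: connectedin_subtopology connected_Times)
  from connectedin_continuous_map_image[OF cf this] show "connected_space (mtop S)" by (simp add: sur connectedin_topspace)
  have "(1, 1) \<in> topspace (mtop ?C)" unfolding C by simp
  then show "topspace (mtop S) \<noteq> {}" using sur by blast
qed

lemma surface_action_aut_group:
  assumes G: "compact_lie_group G GM" and X: "X \<in> Orb_ab_obj G GM"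
  shows "surface_action (aut_group G X) (L2_map G (fst X) (fst X)) (mtop (base (fst X))) (base_act (fst X))"
proof -
  let ?P = "fst X" let ?Y = "L2_map G ?P ?P" let ?T = "snd X" let ?S = "mtop (base ?P)"
  note P = Orb_ab_objD(1)[OF X]
  have tor: "torus_surface (base ?P)" by (rule L2_objD(2)[OF P])
  have base: "smooth_manifold (base ?P)" by (rule L2_objD(4)[OF P])
  have lift: "\<exists>p\<in>pts ?P. x = bproj ?P p" if "x \<in> topspace ?S" for x
    using bproj_surj[OF G P that] by blast
  show ?thesis
    unfolding surface_action_def surface_action_axioms_def aut_group_simps
  proof (intro conjI allI impI hausdorff_abelian_group_aut_group[OF G X] torus_surface_compact_connected[OF tor]
      smooth_manifoldD(3)[OF base])
    fix a assume "a \<in> ?T"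
    then have a: "a \<in> L2_mor G ?P ?P" by (rule Orb_ab_objD(4)[OF X])
    obtain h where h: "diffeo (base ?P) (base ?P) h" "covers ?P ?P a h" using L2_morD(4)[OF a] by blast
    show "continuous_map ?S ?S (base_act ?P a)"
      by (rule continuous_map_eq[OF smooth_mapD(1)[OF diffeo_imp_smooth_map[OF h(1)]]])
        (rule base_act_covers[OF G P a h(2), symmetric])
  next
    fix x assume "x \<in> topspace ?S"
    then obtain p where p: "p \<in> pts ?P" "x = bproj ?P p" using lift by blast
    show "base_act ?P (L2_id ?P) x = x"
      using base_act_bproj[OF L2_id_mor[OF P G] p(1)] p by (simp add: L2_id_def)
  next
    fix a b x assume ab: "a \<in> ?T" "b \<in> ?T" and "x \<in> topspace ?S"
    then obtain p where p: "p \<in> pts ?P" "x = bproj ?P p" using lift by blast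
    note a = Orb_ab_objD(4)[OF X ab(1)] and b = Orb_ab_objD(4)[OF X ab(2)]
    show "base_act ?P (compose (pts ?P) a b) x = base_act ?P a (base_act ?P b x)"
      using base_act_bproj[OF L2_mor_compose[OF G P P P b a] p(1)] base_act_bproj[OF b p(1)]
        base_act_bproj[OF a L2_morD(6)[OF b p(1)]] p by (simp add: compose_def)
  next
    fix x assume "x \<in> topspace ?S"
    then obtain p where p: "p \<in> pts ?P" "x = bproj ?P p" using lift by blast
    have "continuous_map (subtopology ?Y ?T) ?S (\<lambda>a. bproj ?P (a p))"
      using continuous_map_compose[OF continuous_map_from_subtopology[OF continuous_map_evaluation[OF p(1)]]
          smooth_mapD(1)[OF principal_bundleD(3)[OF L2_objD(1)[OF P]]]]
      by (simp add: comp_def)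
    then show "continuous_map (subtopology ?Y ?T) ?S (\<lambda>a. base_act ?P a x)"
    proof (rule continuous_map_eq)
      fix a assume "a \<in> topspace (subtopology ?Y ?T)"
      then have "a \<in> L2_mor G ?P ?P" by (simp add: topspace_L2_map)
      from base_act_bproj[OF this p(1)] show "bproj ?P (a p) = base_act ?P a x" by (simp add: p(2))
    qed
  next
    fix x assume x: "x \<in> topspace ?S"
    obtain U \<phi> where U: "(U, \<phi>) \<in> charts (base ?P)" "x \<in> U"
      using smooth_manifold_chart_at[OF base x] .
    note c = is_chartD[OF bspec[OF smooth_manifoldD(1)[OF base] U(1)]]
    show "\<exists>U (\<phi> :: _ \<Rightarrow> real \<times> real). openin ?S U \<and> x \<in> U \<and> open (\<phi> ` U) \<and>
        homeomorphic_map (subtopology ?S U) (top_of_set (\<phi> ` U)) \<phi>"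
      using c(1,6) c(4)[OF c(1) subset_refl] U(2) by blast
  qed
qed

section \<open>The abstract theory applied to an object of the orbit category\<close>

locale orb_object =
  fixes G :: "'g monoid" and GM :: "('g, 'e::real_normed_vector) smfd" and X :: "('p, 'b, 'g, 'e) orb_obj"
  assumes lie: "compact_lie_group G GM" and obj: "X \<in> Orb_ab_obj G GM"
begin

abbreviation P where "P \<equiv> fst X"
abbreviation T where "T \<equiv> snd X"

sublocale surface_action "aut_group G X" "L2_map G P P" "mtop (base P)" "base_act P"
  by (rule surface_action_aut_group[OF lie obj])

lemma P_obj: "P \<in> L2_obj G GM" and T_mor: "t \<in> T \<Longrightarrow> t \<in> L2_mor G P P"
  using Orb_ab_objD[OF obj] by blast+

lemma T_commute: "s \<in> T \<Longrightarrow> t \<in> T \<Longrightarrow> compose (pts P) s t = compose (pts P) t s"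
  by (rule Orb_ab_objD(3)[OF obj])

lemma Hom_C_eq: "Hom_C G X = HomC"
  unfolding Hom_C_def HomC_def by (simp add: aut_group_def split: prod.split)

lemma Hom_C_top_eq: "Hom_C_top G X = Hom_top"
  by (simp add: Hom_C_top_def Hom_top_def Hom_C_eq)

lemma lin_iso_iff: "lin_iso G X n L \<longleftrightarrow> linear_onto n L"
proof -
  have "Hom_C_add G X \<gamma> \<delta> = (\<lambda>z. \<gamma> z \<otimes>\<^bsub>aut_group G X\<^esub> \<delta> z)" for \<gamma> \<delta>
    by (simp add: Hom_C_add_def aut_group_def)
  then show ?thesis
    unfolding lin_iso_def linear_onto_def linear_into_def Hom_C_eq Hom_C_scale_def
    by (auto simp: bij_betw_def)
qed

text \<open>The projection is surjective, so any two maps covered by an automorphism agree on the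
  base; existence of a covered map sending \<open>x\<close> to \<open>y\<close> becomes an equation
  for \<open>base_act\<close>.\<close>

lemma Fr_set_eq: "Fr_set G X = frames"
proof -
  have "\<gamma> \<in> Fr_set G X \<longleftrightarrow> \<gamma> \<in> frames" for \<gamma>
  proof -
    have 1: "frame G P \<gamma> \<and> range \<gamma> \<subseteq> T \<longleftrightarrow> \<gamma> \<in> HomC \<and>
        (\<forall>x\<in>base_pts P. \<forall>y\<in>base_pts P. \<exists>z h. covers P P (\<gamma> z) h \<and> h x = y)"
      unfolding frame_def HomC_def mem_Collect_eq using T_mor by (auto simp: hom_def C_add_def Aut_def aut_group_def continuous_map_in_subtopology
          image_subset_iff)
    have 2: "(\<exists>h. covers P P (\<gamma> z) h \<and> h x = y) \<longleftrightarrow> base_act P (\<gamma> z) x = y"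
      if "\<gamma> \<in> HomC" "x \<in> base_pts P" for x y z
    proof -
      have m: "\<gamma> z \<in> L2_mor G P P" using HomC_closed[OF that(1)] T_mor by (simp add: aut_group_simps)
      obtain h where h: "covers P P (\<gamma> z) h" using L2_morD(4)[OF m] by blast
      show ?thesis
      proof
        assume "\<exists>h. covers P P (\<gamma> z) h \<and> h x = y"
        then obtain k where k: "covers P P (\<gamma> z) k" "k x = y" by (elim exE conjE)
        show "base_act P (\<gamma> z) x = y" using base_act_covers[OF lie P_obj m k(1) that(2)] k(2) by simp
      next
        assume "base_act P (\<gamma> z) x = y"
        then have "h x = y" using base_act_covers[OF lie P_obj m h that(2)] by simp
        then show "\<exists>h. covers P P (\<gamma> z) h \<and> h x = y" using h by (intro exI conjI)
      qed
    qed
    show ?thesis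
      unfolding Fr_set_def mem_Collect_eq 1 frames_def using 2 by auto
  qed
  then show ?thesis by blast
qed

lemma Fr_set_subset: "Fr_set G X \<subseteq> Hom_C G X"
  by (auto simp: Fr_set_eq Hom_C_eq frames_def)

lemma frame_transitive:
  assumes "Fr_set G X \<noteq> {}" "x \<in> base_pts P" "y \<in> base_pts P"
  shows "\<exists>a\<in>carrier (aut_group G X). base_act P a x = y"
proof -
  obtain \<gamma> where g: "\<gamma> \<in> frames" using assms(1) Fr_set_eq by blast
  then obtain z where "base_act P (\<gamma> z) x = y" using assms(2,3) unfolding frames_def by blast
  moreover have "\<gamma> z \<in> carrier (aut_group G X)" using g HomC_closed by (simp add: frames_def)
  ultimately show ?thesis by blast
qed

text \<open>
  If \<open>T\<close> acts transitively on the base, then \<open>T \<times> G\<close> acts transitively on the total space; since \<open>T\<close>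
  is abelian and commutes with \<open>G\<close>, it acts freely.
\<close>

lemma evaluation_inj_on:
  assumes fr: "Fr_set G X \<noteq> {}" and p0: "p0 \<in> pts P"
  shows "inj_on (\<lambda>t. t p0) T"
proof (rule inj_onI)
  fix s t assume st: "s \<in> T" "t \<in> T" "s p0 = t p0"
  have "s p = t p" if p: "p \<in> pts P" for p
  proof -
    obtain a where a: "a \<in> T" "base_act P a (bproj P p0) = bproj P p"
      using frame_transitive[OF fr bproj_in[OF P_obj p0] bproj_in[OF P_obj p]] by (auto simp: aut_group_simps)
    have ap: "a p0 \<in> pts P" by (rule L2_morD(6)[OF T_mor[OF a(1)] p0])
    have "bproj P (a p0) = bproj P p" using base_act_bproj[OF T_mor[OF a(1)] p0] a(2) by simp
    then obtain g where g: "g \<in> carrier G" "p = bact P (a p0) g"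
      using fibre_transitive[OF lie P_obj ap p] by blast
    have comm: "u (a p0) = a (u p0)" if "u \<in> T" for u
      using fun_cong[OF T_commute[OF that a(1)], of p0] p0 by (simp add: compose_def)
    have eq: "u p = bact P (a (u p0)) g" if "u \<in> T" for u
      unfolding g(2) L2_morD(3)[OF T_mor[OF that] ap g(1)] comm[OF that] ..
    show ?thesis unfolding eq[OF st(1)] eq[OF st(2)] st(3) ..
  qed
  then show "s = t"
    by (rule extensionalityI[OF L2_morD(1)[OF T_mor[OF st(1)]] L2_morD(1)[OF T_mor[OF st(2)]]])
qed

text \<open>Evaluation at \<open>p0\<close> is injective on \<open>T\<close> because the action is
  free. Followed by coordinates of the total space around \<open>p0\<close>, it embeds a
  neighbourhood of the unit of \<open>T\<close> in some R^N, which is what bounds the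
  dimension.\<close>

lemma lin_iso_exists:
  assumes fr: "Fr_set G X \<noteq> {}"
  obtains n L where "lin_iso G X n L"
proof -
  obtain x where "x \<in> base_pts P" using nonempty_surface by blast
  then obtain p0 where p0: "p0 \<in> pts P" using bproj_surj[OF lie P_obj] by blast
  obtain U N e where U: "openin (mtop (tot P)) U" "p0 \<in> U"
    "continuous_map (subtopology (mtop (tot P)) U) (Euclidean_space N) e" "inj_on e U"
    using smooth_manifold_local_coordinates[OF L2_objD(3)[OF P_obj] p0] by blast
  have ev: "continuous_map \<tau> (mtop (tot P)) (\<lambda>t. t p0)"
    by (rule continuous_map_from_subtopology[OF continuous_map_evaluation[OF p0]])
  define O1 where "O1 = {t \<in> topspace \<tau>. t p0 \<in> U}"
  have O1: "openin \<tau> O1" unfolding O1_def by (rule openin_continuous_map_preimage[OF ev U(1)])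
  have O1T: "O1 \<subseteq> T" unfolding O1_def topspace_tau by (auto simp: aut_group_simps)
  have "L2_id P \<in> T" using one_closed by (simp add: aut_group_simps)
  then have one: "\<one>\<^bsub>aut_group G X\<^esub> \<in> O1"
    unfolding O1_def topspace_tau using U(2) p0 by (simp add: aut_group_simps L2_id_def)
  have "continuous_map (subtopology \<tau> O1) (subtopology (mtop (tot P)) U) (\<lambda>t. t p0)"
    using continuous_map_from_subtopology[OF ev, of O1] by (auto simp: continuous_map_in_subtopology O1_def)
  from continuous_map_compose[OF this U(3)]
  have e: "continuous_map (subtopology \<tau> O1) (Euclidean_space N) (e \<circ> (\<lambda>t. t p0))" .
  have "inj_on (e \<circ> (\<lambda>t. t p0)) O1"
  proof (rule comp_inj_on)
    show "inj_on (\<lambda>t. t p0) O1" by (rule inj_on_subset[OF evaluation_inj_on[OF fr p0] O1T])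
    show "inj_on e ((\<lambda>t. t p0) ` O1)" by (rule inj_on_subset[OF U(4)]) (auto simp: O1_def)
  qed
  then obtain n L where "linear_onto n L"
    using linear_onto_exists[OF O1 one e] by blast
  then show ?thesis using that by (simp add: lin_iso_iff)
qed

lemma Hom_C_dim_eq:
  assumes "lin_iso G X n L"
  shows "Hom_C_dim G X = n"
  unfolding Hom_C_dim_def
proof (rule the_equality)
  show "\<exists>L. lin_iso G X n L" using assms by blast
  show "m = n" if "\<exists>L. lin_iso G X m L" for m
    using that assms linear_onto_dim_unique unfolding lin_iso_iff by blast
qed

lemma openin_Fr_set:
  assumes "Fr_set G X \<noteq> {}" "lin_iso G X n L"
  shows "openin (top_of_set (Cn n)) {x \<in> Cn n. L x \<in> Fr_set G X}"
proof -
  have "linear_into n L" using assms(2) by (simp add: lin_iso_iff linear_ontoD)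
  from openin_frames[OF frame_transitive[OF assms(1)] this] show ?thesis by (simp add: Fr_set_eq)
qed

lemma lin_iso_homeomorphic_map:
  "lin_iso G X n L \<Longrightarrow> homeomorphic_map (top_of_set (Cn n)) (Hom_C_top G X) L"
  unfolding lin_iso_iff Hom_C_top_eq by (rule linear_onto_homeomorphic_map)

lemma Fr_set_scale: "\<gamma> \<in> Fr_set G X \<Longrightarrow> c \<noteq> 0 \<Longrightarrow> Hom_C_scale c \<gamma> \<in> Fr_set G X"
  unfolding Fr_set_eq Hom_C_scale_def by (rule frames_scale)

lemma topspace_Hom_C_top: "topspace (Hom_C_top G X) = Hom_C G X"
  by (simp add: Hom_C_top_eq topspace_Hom_top Hom_C_eq)

end

section \<open>Complex manifolds covered by a single equivariant chart\<close>

text \<open>Compatibility with a third chart controls a transition only over the image of that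
  chart. When this image is the whole space, the transition is the composite of the two given
  ones.\<close>

lemma holo_compatible_via:
  assumes c: "is_cchart X a n (U, \<phi>)" and d: "is_cchart X a n (V, \<psi>)" and r: "is_cchart X a n (W, \<rho>)"
    and glob: "\<rho> ` W = topspace X" and cr: "holo_compatible n (U, \<phi>) (W, \<rho>)" and rd: "holo_compatible n (W, \<rho>) (V, \<psi>)"
  shows "holo_on n n {x \<in> U. \<phi> x \<in> \<psi> ` V} (the_inv_into V \<psi> \<circ> \<phi>)"
proof -
  note c' = is_cchartD[OF c] and d' = is_cchartD[OF d] and r' = is_cchartD[OF r]
  let ?S = "{x \<in> U. \<phi> x \<in> \<psi> ` V}" and ?f = "the_inv_into W \<rho> \<circ> \<phi>" and ?g = "the_inv_into V \<psi> \<circ> \<rho>"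
  have f: "holo_on n n ?S ?f"
    by (rule holo_on_subset[of n n "{x \<in> U. \<phi> x \<in> \<rho> ` W}"])
      (use cr c'(5) in \<open>auto simp: holo_compatible_def glob\<close>)
  have g: "holo_on n n {x \<in> W. \<rho> x \<in> \<psi> ` V} ?g"
    using rd by (simp add: holo_compatible_def)
  have inv: "?f x \<in> W" "\<rho> (?f x) = \<phi> x" if "x \<in> U" for x
  proof -
    have *: "\<phi> x \<in> \<rho> ` W" using c'(5)[OF that] by (simp add: glob)
    show "?f x \<in> W" using the_inv_into_into[OF r'(2) *] by simp
    show "\<rho> (?f x) = \<phi> x" using f_the_inv_into_f[OF r'(2) *] by simp
  qed
  have "holo_on n n ?S (\<lambda>x. ?g (?f x))"
  proof (rule holo_on_compose[OF _ _ g f])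
    show "?S \<subseteq> Cn n" using c'(1) by blast
    show "{x \<in> W. \<rho> x \<in> \<psi> ` V} \<subseteq> Cn n" using r'(1) by blast
    show "?f ` ?S \<subseteq> {x \<in> W. \<rho> x \<in> \<psi> ` V}"
    proof
      fix y assume "y \<in> ?f ` ?S"
      then obtain x where x: "x \<in> U" "\<phi> x \<in> \<psi> ` V" "y = ?f x" by blast
      have "\<rho> y = \<phi> x" unfolding x(3) by (rule inv(2)[OF x(1)])
      then show "y \<in> {x \<in> W. \<rho> x \<in> \<psi> ` V}" using x(2) inv(1)[OF x(1)] x(3) by simp
    qed
  qed
  then show ?thesis
    by (rule holo_on_cong[rotated 2]) (use c'(1) inv(2) in auto)
qed

lemma holo_compatible_sym: "holo_compatible n c d \<Longrightarrow> holo_compatible n d c"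
  by (auto simp: holo_compatible_def split: prod.splits)

lemma holo_compatible_trans:
  assumes c: "is_cchart X a n c" and d: "is_cchart X a n d" and r: "is_cchart X a n r"
    and glob: "snd r ` fst r = topspace X" and cr: "holo_compatible n c r" and rd: "holo_compatible n r d"
  shows "holo_compatible n c d"
proof -
  obtain U \<phi> V \<psi> W \<rho> where eq: "c = (U, \<phi>)" "d = (V, \<psi>)" "r = (W, \<rho>)" by (metis prod.collapse)
  show ?thesis
    using holo_compatible_via[OF c[unfolded eq] d[unfolded eq] r[unfolded eq] _ cr[unfolded eq] rd[unfolded eq]]
      holo_compatible_via[OF d[unfolded eq] c[unfolded eq] r[unfolded eq] _
        holo_compatible_sym[OF rd[unfolded eq]] holo_compatible_sym[OF cr[unfolded eq]]] glob
    by (simp add: eq holo_compatible_def)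
qed

lemma continuous_map_from_global_chart:
  assumes r: "homeomorphic_map (top_of_set W) X \<rho>" and f: "continuous_map (top_of_set W) Y (f \<circ> \<rho>)"
  shows "continuous_map X Y f"
proof -
  obtain h where h: "homeomorphic_maps (top_of_set W) X \<rho> h"
    using r by (auto simp: homeomorphic_map_maps)
  then have "continuous_map X (top_of_set W) h" and \<rho>h: "\<And>x. x \<in> topspace X \<Longrightarrow> \<rho> (h x) = x"
    by (auto simp: homeomorphic_maps_def)
  from continuous_map_compose[OF this(1) f]
  show ?thesis by (rule continuous_map_eq) (simp add: \<rho>h)
qed

text \<open>In an equivariant chart that covers the whole space the action is scalar
  multiplication.\<close>

lemma global_chart_action_continuous:
  assumes r: "homeomorphic_map (top_of_set W) X \<rho>"
    and equiv: "\<And>c x. c \<noteq> 0 \<Longrightarrow> x \<in> W \<Longrightarrow> cscale c x \<in> W \<and> \<rho> (cscale c x) = a c (\<rho> x)"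
  shows "continuous_map (prod_topology (top_of_set (UNIV - {0})) X) X (\<lambda>(c, x). a c x)"
proof -
  obtain h where h: "homeomorphic_maps (top_of_set W) X \<rho> h"
    using r by (auto simp: homeomorphic_map_maps)
  then have ch: "continuous_map X (top_of_set W) h" and cr: "continuous_map (top_of_set W) X \<rho>"
    and \<rho>h: "\<And>x. x \<in> topspace X \<Longrightarrow> \<rho> (h x) = x"
    by (auto simp: homeomorphic_maps_def)
  let ?C = "top_of_set (UNIV - {0 :: complex})"
  have "continuous_on ((UNIV - {0}) \<times> W) (\<lambda>p. cscale (fst p) (snd p))"
    unfolding cscale_def
    by (intro continuous_on_coordinatewise_then_product continuous_on_mult continuous_on_fst continuous_on_id
        continuous_on_product_then_coordinatewise[OF continuous_on_snd[OF continuous_on_id]])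
  moreover have "cscale (fst p) (snd p) \<in> W" if "p \<in> (UNIV - {0}) \<times> W" for p
    using that equiv[of "fst p" "snd p"] by (cases p) simp
  ultimately have "continuous_map (prod_topology ?C (top_of_set W)) (top_of_set W) (\<lambda>p. cscale (fst p) (snd p))"
    by (simp add: continuous_map_in_subtopology Pi_iff)
  moreover have "continuous_map (prod_topology ?C X) (prod_topology ?C (top_of_set W)) (\<lambda>p. (fst p, h (snd p)))"
    using continuous_map_compose[OF continuous_map_snd ch, of ?C]
    by (intro continuous_map_pairedI continuous_map_fst) (simp add: comp_def)
  ultimately have "continuous_map (prod_topology ?C X) X (\<rho> \<circ> ((\<lambda>p. cscale (fst p) (snd p)) \<circ> (\<lambda>p. (fst p, h (snd p)))))"
    by (intro continuous_map_compose[OF continuous_map_compose cr])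
  then show ?thesis
  proof (rule continuous_map_eq)
    fix p assume "p \<in> topspace (prod_topology ?C X)"
    then have p: "fst p \<noteq> 0" "snd p \<in> topspace X" by auto
    have "h (snd p) \<in> W" using continuous_map_in_topspace[OF ch p(2)] by simp
    then show "(\<rho> \<circ> ((\<lambda>p. cscale (fst p) (snd p)) \<circ> (\<lambda>p. (fst p, h (snd p))))) p = (case p of (c, x) \<Rightarrow> a c x)"
      using equiv[OF p(1)] \<rho>h[OF p(2)] by (simp add: case_prod_unfold)
  qed
qed

lemma second_countable_euclidean: "second_countable (euclidean :: 'a::second_countable_topology topology)"
proof -
  obtain B :: "'a set set" where B: "countable B" "\<And>C. C \<in> B \<Longrightarrow> open C" "\<And>S. open S \<Longrightarrow> \<exists>U. U \<subseteq> B \<and> S = \<Union>U"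
    using univ_second_countable by blast
  have "\<exists>V\<in>B. x \<in> V \<and> V \<subseteq> U" if "open U" "x \<in> U" for U x
    using B(3)[OF that(1)] that(2) by blast
  then show ?thesis
    unfolding second_countable_def using B(1,2) by (intro exI[of _ B]) auto
qed

text \<open>\<open>R\<close> is a set of reference charts, each of which covers the whole space, so
  compatibility with one of them is transitive. The assumptions on \<open>R\<close> are restricted
  to nonempty spaces; over the empty space every chart has empty domain and all conditions are
  vacuous.\<close>

lemma Cx_manifold_global_charts:
  assumes act: "\<And>x. x \<in> topspace X \<Longrightarrow> a 1 x = x"
      "\<And>c d x. x \<in> topspace X \<Longrightarrow> c \<noteq> 0 \<Longrightarrow> d \<noteq> 0 \<Longrightarrow> a c (a d x) = a (c * d) x"
    and R: "topspace X \<noteq> {} \<Longrightarrow> R \<noteq> {}"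
      "\<And>r. topspace X \<noteq> {} \<Longrightarrow> r \<in> R \<Longrightarrow> is_cchart X a n r \<and> snd r ` fst r = topspace X"
      "\<And>r s. topspace X \<noteq> {} \<Longrightarrow> r \<in> R \<Longrightarrow> s \<in> R \<Longrightarrow> holo_compatible n r s"
  shows "Cx_manifold \<lparr>ctop = X, cact = a, cdim = n,
    ccharts = {c. is_cchart X a n c \<and> (\<forall>r\<in>R. holo_compatible n c r)}\<rparr>" (is "Cx_manifold ?M")
proof (cases "topspace X = {}")
  case True
  have empty: "U = {}" if "is_cchart X a n (U, \<phi>)" for U \<phi>
    using is_cchartD(5)[OF that] True by blast
  have comp: "holo_compatible n c d" if "is_cchart X a n c" for c and d :: "(nat \<Rightarrow> complex) set \<times> ((nat \<Rightarrow> complex) \<Rightarrow> 'a)"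
  proof -
    obtain U \<phi> where "c = (U, \<phi>)" by (cases c)
    moreover obtain V \<psi> where "d = (V, \<psi>)" by (cases d)
    ultimately show ?thesis using empty[of U \<phi>] that by (simp add: holo_compatible_def holo_on_def)
  qed
  have X: "X = trivial_topology" using True by simp
  show ?thesis
    unfolding Cx_manifold_def Cx_space_def cmfd.simps
  proof (intro conjI ballI allI impI)
    show "Hausdorff_space X" using True by (simp add: Hausdorff_space_def)
    show "second_countable X" unfolding X second_countable_def by (intro exI[of _ "{}"]) auto
    show "continuous_map (prod_topology (top_of_set (UNIV - {0})) X) X (\<lambda>(c, x). a c x)"
      unfolding X by (simp add: continuous_map_def Pi_def)
    show "(\<Union>(U, \<phi>)\<in>{c. is_cchart X a n c \<and> (\<forall>r\<in>R. holo_compatible n c r)}. \<phi> ` U) = topspace X"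
      using empty True by auto
  qed (use comp True in auto)
next
  case False
  obtain r where r: "r \<in> R" using R(1)[OF False] by blast
  obtain W \<rho> where rW: "r = (W, \<rho>)" by (cases r)
  have rc: "is_cchart X a n (W, \<rho>)" and glob: "\<rho> ` W = topspace X"
    using R(2)[OF False r] by (auto simp: rW)
  have hom: "homeomorphic_map (top_of_set W) X \<rho>"
    using is_cchartD(7)[OF rc] by (simp add: glob)
  have hs: "top_of_set W homeomorphic_space X"
    by (rule homeomorphic_map_imp_homeomorphic_space[OF hom])
  show ?thesis
    unfolding Cx_manifold_def Cx_space_def cmfd.simps
  proof (intro conjI ballI allI impI)
    show "Hausdorff_space X"
      using homeomorphic_Hausdorff_space[OF hs] by (simp add: Hausdorff_space_subtopology)
    show "second_countable X"
      using homeomorphic_space_second_countability[OF hs] second_countable_subtopology[OF second_countable_euclidean]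
      by blast
    show "continuous_map (prod_topology (top_of_set (UNIV - {0})) X) X (\<lambda>(c, x). a c x)"
      by (rule global_chart_action_continuous[OF hom]) (use rc in \<open>auto simp: is_cchart_def\<close>)
    show "(\<Union>(U, \<phi>)\<in>{c. is_cchart X a n c \<and> (\<forall>r\<in>R. holo_compatible n c r)}. \<phi> ` U) = topspace X"
    proof
      show "(\<Union>(U, \<phi>)\<in>{c. is_cchart X a n c \<and> (\<forall>r\<in>R. holo_compatible n c r)}. \<phi> ` U) \<subseteq> topspace X"
        using is_cchartD(5) by fastforce
      have "(W, \<rho>) \<in> {c. is_cchart X a n c \<and> (\<forall>r\<in>R. holo_compatible n c r)}"
        using rc R(3)[OF False r] by (simp add: rW)
      then show "topspace X \<subseteq> (\<Union>(U, \<phi>)\<in>{c. is_cchart X a n c \<and> (\<forall>r\<in>R. holo_compatible n c r)}. \<phi> ` U)"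
        unfolding glob[symmetric] by blast
    qed
  next
    fix c d assume c: "c \<in> {c. is_cchart X a n c \<and> (\<forall>r\<in>R. holo_compatible n c r)}"
      and d: "d \<in> {c. is_cchart X a n c \<and> (\<forall>r\<in>R. holo_compatible n c r)}"
    have "holo_compatible n c r" "holo_compatible n d r" using c d r by blast+
    then show "holo_compatible n c d"
      using holo_compatible_trans[of X a n c d r] holo_compatible_sym[of n d r] c d R(2)[OF False r] by blast
  next
    \<comment> \<open>Maximality: \<open>R\<close> itself lies in the atlas, so a chart compatible
      with the atlas is compatible with \<open>R\<close>.\<close>
    fix c assume c: "is_cchart X a n c \<and> (\<forall>d\<in>{c. is_cchart X a n c \<and> (\<forall>r\<in>R. holo_compatible n c r)}. holo_compatible n c d)"
    have "holo_compatible n c s" if "s \<in> R" for s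
    proof -
      have "s \<in> {c. is_cchart X a n c \<and> (\<forall>r\<in>R. holo_compatible n c r)}"
        using R(2,3)[OF False that] by blast
      then show ?thesis using c by blast
    qed
    then show "c \<in> {c. is_cchart X a n c \<and> (\<forall>r\<in>R. holo_compatible n c r)}" using c by blast
  qed (use act rc in auto)
qed

text \<open>Every local expression is the one in the global charts, preceded and followed by
  holomorphic transitions. Hence one pair of charts decides.\<close>

lemma Cx_holo_map_global:
  assumes M: "Cx_manifold M" and N: "Cx_manifold N"
    and r: "(W, \<rho>) \<in> ccharts M" "\<rho> ` W = topspace (ctop M)"
    and s: "(W', \<sigma>) \<in> ccharts N" "\<sigma> ` W' = topspace (ctop N)"
    and cont: "continuous_map (ctop M) (ctop N) f"
    and equiv: "\<And>c x. x \<in> topspace (ctop M) \<Longrightarrow> c \<noteq> 0 \<Longrightarrow> f (cact M c x) = cact N c (f x)"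
    and holo: "holo_on (cdim M) (cdim N) W (the_inv_into W' \<sigma> \<circ> f \<circ> \<rho>)"
  shows "Cx_holo_map M N f"
proof (rule Cx_holo_mapI[OF cont equiv])
  fix U \<phi> V \<psi> assume U: "(U, \<phi>) \<in> ccharts M" and V: "(V, \<psi>) \<in> ccharts N"
  note cU = is_cchartD[OF Cx_manifoldD(1)[OF M U]] and cV = is_cchartD[OF Cx_manifoldD(1)[OF N V]]
    and cr = is_cchartD[OF Cx_manifoldD(1)[OF M r(1)]] and cs = is_cchartD[OF Cx_manifoldD(1)[OF N s(1)]]
  let ?n = "cdim M" and ?m = "cdim N"
  let ?S = "{x \<in> U. f (\<phi> x) \<in> \<psi> ` V}"
  let ?p = "the_inv_into W \<rho> \<circ> \<phi>" and ?q = "the_inv_into W' \<sigma> \<circ> f \<circ> \<rho>" and ?t = "the_inv_into V \<psi> \<circ> \<sigma>"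
  have p: "?p x \<in> W" "\<rho> (?p x) = \<phi> x" if "x \<in> U" for x
  proof -
    have *: "\<phi> x \<in> \<rho> ` W" using cU(5)[OF that] by (simp add: r(2))
    show "?p x \<in> W" using the_inv_into_into[OF cr(2) *] by simp
    show "\<rho> (?p x) = \<phi> x" using f_the_inv_into_f[OF cr(2) *] by simp
  qed
  have q: "?q x \<in> W'" "\<sigma> (?q x) = f (\<rho> x)" if "x \<in> W" for x
  proof -
    have *: "f (\<rho> x) \<in> \<sigma> ` W'"
      using continuous_map_in_topspace[OF cont cr(5)[OF that]] by (simp add: s(2))
    show "?q x \<in> W'" using the_inv_into_into[OF cs(2) *] by simp
    show "\<sigma> (?q x) = f (\<rho> x)" using f_the_inv_into_f[OF cs(2) *] by simp
  qed
  have "{x \<in> U. \<phi> x \<in> \<rho> ` W} = U" using cU(5) r(2) by auto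
  then have "holo_on ?n ?n U ?p"
    using Cx_manifoldD(3)[OF M U r(1)] by (simp add: holo_compatible_def)
  then have hp: "holo_on ?n ?n ?S ?p" by (rule holo_on_subset) auto
  have ht: "holo_on ?m ?m {x \<in> W'. \<sigma> x \<in> \<psi> ` V} ?t"
    using Cx_manifoldD(3)[OF N s(1) V] by (simp add: holo_compatible_def)
  have SC: "?S \<subseteq> Cn ?n" using cU(1) by blast
  have "holo_on ?n ?m ?S (\<lambda>x. ?q (?p x))"
    by (rule holo_on_compose[OF SC cr(1) holo hp]) (use p in auto)
  then have "holo_on ?n ?m ?S (\<lambda>x. ?t (?q (?p x)))"
  proof (rule holo_on_compose[OF SC _ ht, rotated])
    show "{x \<in> W'. \<sigma> x \<in> \<psi> ` V} \<subseteq> Cn ?m" using cs(1) by blast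
    show "(\<lambda>x. ?q (?p x)) ` ?S \<subseteq> {x \<in> W'. \<sigma> x \<in> \<psi> ` V}"
    proof
      fix y assume "y \<in> (\<lambda>x. ?q (?p x)) ` ?S"
      then obtain x where x: "x \<in> U" "f (\<phi> x) \<in> \<psi> ` V" "y = ?q (?p x)" by blast
      have "y \<in> W'" unfolding x(3) by (rule q(1)[OF p(1)[OF x(1)]])
      moreover have "\<sigma> y = f (\<phi> x)" unfolding x(3) q(2)[OF p(1)[OF x(1)]] p(2)[OF x(1)] ..
      ultimately show "y \<in> {x \<in> W'. \<sigma> x \<in> \<psi> ` V}" using x(2) by simp
    qed
  qed
  then show "holo_on ?n ?m ?S (the_inv_into V \<psi> \<circ> f \<circ> \<phi>)"
  proof (rule holo_on_cong[OF SC, rotated])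
    fix x assume "x \<in> ?S"
    then have "x \<in> U" by blast
    have "\<sigma> (?q (?p x)) = f (\<phi> x)" unfolding q(2)[OF p(1)[OF \<open>x \<in> U\<close>]] p(2)[OF \<open>x \<in> U\<close>] ..
    then show "?t (?q (?p x)) = (the_inv_into V \<psi> \<circ> f \<circ> \<phi>) x" by simp
  qed
qed

section \<open>Complex linear maps between coordinate spaces\<close>

text \<open>The columns of the matrix are the values on the standard basis. An explicit matrix gives
  holomorphy by \<open>holo_on_matrix\<close> and continuity by
  \<open>continuous_on_matrix\<close>.\<close>

lemma linear_Cn_matrix:
  assumes A: "\<And>x. x \<in> Cn n \<Longrightarrow> A x \<in> Cn m"
    and add: "\<And>x y. x \<in> Cn n \<Longrightarrow> y \<in> Cn n \<Longrightarrow> A (\<lambda>i. x i + y i) = (\<lambda>j. A x j + A y j)"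
    and scale: "\<And>c x. x \<in> Cn n \<Longrightarrow> A (cscale c x) = cscale c (A x)"
  obtains a where "\<And>x j. x \<in> Cn n \<Longrightarrow> A x j = (\<Sum>i<n. a j i * x i)"
proof -
  define tr where "tr m x = (\<lambda>i. if i < m then x i else 0)" for m and x :: "nat \<Rightarrow> complex"
  define e where "e m = (\<lambda>i. if i = m then 1 else (0::complex))" for m :: nat
  have trC: "tr k x \<in> Cn n" if "k \<le> n" for k x using that by (simp add: tr_def Cn_def)
  have z: "(\<lambda>i. 0) \<in> Cn n" by (simp add: Cn_def)
  have "A (tr k x) j = (\<Sum>i<k. A (e i) j * x i)" if "k \<le> n" for k x j
    using that
  proof (induction k)
    case 0
    have "A (\<lambda>i. 0) = cscale 0 (A (\<lambda>i. 0))" using scale[OF z, of 0] by (simp add: cscale_def)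
    from fun_cong[OF this, of j] show ?case by (simp add: tr_def cscale_def)
  next
    case (Suc k)
    have eC: "e k \<in> Cn n" using Suc.prems by (simp add: e_def Cn_def)
    have "tr (Suc k) x = (\<lambda>i. tr k x i + cscale (x k) (e k) i)"
      by (auto simp: tr_def cscale_def e_def fun_eq_iff less_Suc_eq)
    then have "A (tr (Suc k) x) j = A (tr k x) j + A (cscale (x k) (e k)) j"
      using add[OF trC Cn_cscale[OF eC], of k x "x k"] Suc.prems by simp
    also have "A (cscale (x k) (e k)) j = A (e k) j * x k"
      unfolding scale[OF eC] by (simp add: cscale_def)
    finally show ?case using Suc by simp
  qed
  from this[of n] have *: "A (tr n x) j = (\<Sum>i<n. A (e i) j * x i)" for x j by simp
  have "A x j = (\<Sum>i<n. A (e i) j * x i)" if "x \<in> Cn n" for x j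
  proof -
    have "tr n x = x" using that by (auto simp: tr_def Cn_def fun_eq_iff not_less)
    then show ?thesis using *[of x j] by simp
  qed
  then show ?thesis using that[of "\<lambda>j i. A (e i) j"] by blast
qed

lemma continuous_on_matrix:
  assumes "\<And>x j. x \<in> U \<Longrightarrow> A x j = (\<Sum>i<n. a j i * x i)"
  shows "continuous_on U (A :: (nat \<Rightarrow> complex) \<Rightarrow> nat \<Rightarrow> complex)"
proof (rule continuous_on_coordinatewise_then_product)
  fix j
  have "continuous_on U (\<lambda>x. \<Sum>i<n. a j i * x i)"
    by (intro continuous_intros continuous_on_coordinate)
  then show "continuous_on U (\<lambda>x. A x j)"
    by (rule continuous_on_eq) (simp add: assms)
qed

section \<open>The orbit category\<close>

lemma topspace_quotient_top: "topspace (quotient_top X q) = q ` topspace X"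
proof
  show "topspace (quotient_top X q) \<subseteq> q ` topspace X"
    using openin_topspace[of "quotient_top X q"] unfolding openin_quotient_top by blast
  have "{x \<in> topspace X. q x \<in> q ` topspace X} = topspace X" by blast
  then have "openin (quotient_top X q) (q ` topspace X)"
    unfolding openin_quotient_top by simp
  then show "q ` topspace X \<subseteq> topspace (quotient_top X q)" by (rule openin_subset)
qed

lemma topspace_map_mod: "topspace (map_mod G X Q) = orbit X ` L2_mor G (fst X) Q"
  by (simp add: map_mod_def topspace_quotient_top topspace_L2_map)

lemma orbit_eq: "orbit X f = {compose (pts (fst X)) f t | t. t \<in> snd X}"
  by (simp add: orbit_def split: prod.split)

lemma Orb_ab_homD:
  assumes "\<eta> \<in> Orb_ab_hom G GM X Y"
  shows "\<eta> \<in> extensional (L2_obj G GM)"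
    "\<And>Q. Q \<in> L2_obj G GM \<Longrightarrow> \<eta> Q \<in> extensional (topspace (map_mod G X Q))"
    "\<And>Q. Q \<in> L2_obj G GM \<Longrightarrow> continuous_map (map_mod G X Q) (map_mod G Y Q) (\<eta> Q)"
    "\<And>Q R h \<omega>. Q \<in> L2_obj G GM \<Longrightarrow> R \<in> L2_obj G GM \<Longrightarrow> h \<in> L2_mor G Q R
      \<Longrightarrow> \<omega> \<in> topspace (map_mod G X Q) \<Longrightarrow> \<eta> R (push X h \<omega>) = push Y h (\<eta> Q \<omega>)"
  using assms unfolding Orb_ab_hom_def by simp_all

lemma Orb_ab_homI:
  assumes "\<eta> \<in> extensional (L2_obj G GM)"
    "\<And>Q. Q \<in> L2_obj G GM \<Longrightarrow> \<eta> Q \<in> extensional (topspace (map_mod G X Q))"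
    "\<And>Q. Q \<in> L2_obj G GM \<Longrightarrow> continuous_map (map_mod G X Q) (map_mod G Y Q) (\<eta> Q)"
    "\<And>Q R h \<omega>. Q \<in> L2_obj G GM \<Longrightarrow> R \<in> L2_obj G GM \<Longrightarrow> h \<in> L2_mor G Q R
      \<Longrightarrow> \<omega> \<in> topspace (map_mod G X Q) \<Longrightarrow> \<eta> R (push X h \<omega>) = push Y h (\<eta> Q \<omega>)"
  shows "\<eta> \<in> Orb_ab_hom G GM X Y"
  using assms unfolding Orb_ab_hom_def by simp

lemma Orb_ab_hom_in:
  assumes "\<eta> \<in> Orb_ab_hom G GM X Y" "Q \<in> L2_obj G GM" "\<omega> \<in> topspace (map_mod G X Q)"
  shows "\<eta> Q \<omega> \<in> topspace (map_mod G Y Q)"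
  by (rule continuous_map_in_topspace[OF Orb_ab_homD(3)[OF assms(1,2)] assms(3)])

context orb_object
begin

lemma push_orbit:
  assumes "f \<in> L2_mor G P Q"
  shows "push X h (orbit X f) = orbit X (compose (pts P) h f)"
proof -
  have "compose (pts P) h (compose (pts P) f t) = compose (pts P) (compose (pts P) h f) t" if "t \<in> T" for t
    using L2_morD(6)[OF T_mor[OF that]] by (auto simp: compose_def)
  then show ?thesis unfolding push_def orbit_eq by force
qed

lemma push_in:
  assumes Q: "Q \<in> L2_obj G GM" and R: "R \<in> L2_obj G GM" and h: "h \<in> L2_mor G Q R"
    and \<omega>: "\<omega> \<in> topspace (map_mod G X Q)"
  shows "push X h \<omega> \<in> topspace (map_mod G X R)"
proof -
  obtain f where f: "f \<in> L2_mor G P Q" "\<omega> = orbit X f" using \<omega> by (auto simp: topspace_map_mod)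
  show ?thesis
    unfolding f(2) push_orbit[OF f(1)] topspace_map_mod
    using L2_mor_compose[OF lie P_obj Q R f(1) h] by blast
qed

lemma id_in_T: "L2_id P \<in> T"
  using one_closed by (simp add: aut_group_simps)

lemma compose_id: "f \<in> extensional (pts P) \<Longrightarrow> compose (pts P) f (L2_id P) = f"
  by (auto simp: compose_def L2_id_def fun_eq_iff extensional_def)

lemma in_orbit: "f \<in> L2_mor G P Q \<Longrightarrow> f \<in> orbit X f"
  unfolding orbit_eq using compose_id[OF L2_morD(1)] id_in_T by force

text \<open>Left multiplication by an element of the group \<open>T\<close> permutes
  \<open>T\<close>.\<close>

lemma orbit_of_T:
  assumes t: "t \<in> T"
  shows "orbit X t = orbit X (L2_id P)"
proof -
  have m: "t \<otimes>\<^bsub>aut_group G X\<^esub> s = compose (pts P) t s" for t s by (simp add: aut_group_simps)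
  have c: "carrier (aut_group G X) = T" by (simp add: aut_group_simps)
  have "{compose (pts P) u s | s. s \<in> T} = T" if u: "u \<in> T" for u
  proof
    show "{compose (pts P) u s | s. s \<in> T} \<subseteq> T" using m_closed u unfolding c m by blast
    show "T \<subseteq> {compose (pts P) u s | s. s \<in> T}"
    proof
      fix s assume s: "s \<in> T"
      let ?v = "inv\<^bsub>aut_group G X\<^esub> u \<otimes>\<^bsub>aut_group G X\<^esub> s"
      have iu: "inv\<^bsub>aut_group G X\<^esub> u \<in> T" using inv_closed[of u] u unfolding c by blast
      have "u \<otimes>\<^bsub>aut_group G X\<^esub> ?v = s"
        using m_assoc[of u "inv\<^bsub>aut_group G X\<^esub> u" s] r_inv[of u] l_one[of s] u s iu unfolding c by simp
      moreover have "?v \<in> T" using m_closed[of "inv\<^bsub>aut_group G X\<^esub> u" s] iu s unfolding c by blast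
      ultimately show "s \<in> {compose (pts P) u s | s. s \<in> T}" unfolding m by (metis (mono_tags, lifting) mem_Collect_eq)
    qed
  qed
  then show ?thesis unfolding orbit_eq using t id_in_T by simp
qed

lemma id_orbit_in: "orbit X (L2_id P) \<in> topspace (map_mod G X P)"
  unfolding topspace_map_mod using T_mor[OF id_in_T] by blast

end

lemma is_category_Orb_ab:
  fixes G :: "'g monoid" and GM :: "('g, 'e::real_normed_vector) smfd"
  assumes lie: "compact_lie_group G GM"
  shows "is_category (Orb_ab G GM :: (('p, 'b, 'g, 'e) orb_obj, ('p, 'b, 'g, 'e) orb_mor) cat)"
proof (rule is_categoryI)
  fix X :: "('p, 'b, 'g, 'e) orb_obj" assume "X \<in> Obj (Orb_ab G GM)"
  then interpret X: orb_object G GM X by unfold_locales (auto simp: lie Orb_ab_def)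
  have "(\<lambda>Q\<in>L2_obj G GM. \<lambda>\<omega>\<in>topspace (map_mod G X Q). \<omega>) \<in> Orb_ab_hom G GM X X"
  proof (rule Orb_ab_homI)
    fix Q :: "('p, 'b, 'g, 'e) gbundle" assume Q: "Q \<in> L2_obj G GM"
    have "continuous_map (map_mod G X Q) (map_mod G X Q) (\<lambda>\<omega>\<in>topspace (map_mod G X Q). \<omega>)"
      by (rule continuous_map_eq[OF continuous_map_id]) simp
    then show "continuous_map (map_mod G X Q) (map_mod G X Q)
        ((\<lambda>Q\<in>L2_obj G GM. \<lambda>\<omega>\<in>topspace (map_mod G X Q). \<omega>) Q)" using Q by simp
  qed (auto simp: X.push_in)
  then show "Id (Orb_ab G GM) X \<in> Hom (Orb_ab G GM) X X" by (simp add: Orb_ab_def)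
next
  fix X Y Z :: "('p, 'b, 'g, 'e) orb_obj" and \<phi> \<psi>
  assume X: "X \<in> Obj (Orb_ab G GM)" and "\<phi> \<in> Hom (Orb_ab G GM) X Y" "\<psi> \<in> Hom (Orb_ab G GM) Y Z"
  then have \<phi>: "\<phi> \<in> Orb_ab_hom G GM X Y" and \<psi>: "\<psi> \<in> Orb_ab_hom G GM Y Z" by (auto simp: Orb_ab_def)
  interpret X: orb_object G GM X using X by unfold_locales (auto simp: lie Orb_ab_def)
  have "(\<lambda>Q\<in>L2_obj G GM. compose (topspace (map_mod G X Q)) (\<psi> Q) (\<phi> Q)) \<in> Orb_ab_hom G GM X Z"
  proof (rule Orb_ab_homI)
    fix Q :: "('p, 'b, 'g, 'e) gbundle" assume Q: "Q \<in> L2_obj G GM"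
    have "continuous_map (map_mod G X Q) (map_mod G Z Q) (compose (topspace (map_mod G X Q)) (\<psi> Q) (\<phi> Q))"
      by (rule continuous_map_eq[OF continuous_map_compose[OF Orb_ab_homD(3)[OF \<phi> Q] Orb_ab_homD(3)[OF \<psi> Q]]])
        (simp add: compose_def)
    then show "continuous_map (map_mod G X Q) (map_mod G Z Q)
        ((\<lambda>Q\<in>L2_obj G GM. compose (topspace (map_mod G X Q)) (\<psi> Q) (\<phi> Q)) Q)" using Q by simp
    fix R h \<omega> assume R: "R \<in> L2_obj G GM" and h: "h \<in> L2_mor G Q R" and \<omega>: "\<omega> \<in> topspace (map_mod G X Q)"
    show "(\<lambda>Q\<in>L2_obj G GM. compose (topspace (map_mod G X Q)) (\<psi> Q) (\<phi> Q)) R (push X h \<omega>) =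
        push Z h ((\<lambda>Q\<in>L2_obj G GM. compose (topspace (map_mod G X Q)) (\<psi> Q) (\<phi> Q)) Q \<omega>)"
      using Q R \<omega> X.push_in[OF Q R h \<omega>] Orb_ab_homD(4)[OF \<phi> Q R h \<omega>]
        Orb_ab_homD(4)[OF \<psi> Q R h Orb_ab_hom_in[OF \<phi> Q \<omega>]] by (simp add: compose_def)
  qed (auto simp: compose_def)
  then show "Comp (Orb_ab G GM) X Y Z \<psi> \<phi> \<in> Hom (Orb_ab G GM) X Z" by (simp add: Orb_ab_def)
next
  fix X Y :: "('p, 'b, 'g, 'e) orb_obj" and \<phi>
  assume "\<phi> \<in> Hom (Orb_ab G GM) X Y"
  then have \<phi>: "\<phi> \<in> Orb_ab_hom G GM X Y" by (auto simp: Orb_ab_def)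
  have 1: "compose (topspace (map_mod G X Q)) (\<phi> Q) (\<lambda>\<omega>\<in>topspace (map_mod G X Q). \<omega>) = \<phi> Q"
    if "Q \<in> L2_obj G GM" for Q :: "('p, 'b, 'g, 'e) gbundle"
    using Orb_ab_homD(2)[OF \<phi> that] by (auto simp: compose_def fun_eq_iff extensional_def)
  have 2: "compose (topspace (map_mod G X Q)) (\<lambda>\<omega>\<in>topspace (map_mod G Y Q). \<omega>) (\<phi> Q) = \<phi> Q"
    if "Q \<in> L2_obj G GM" for Q :: "('p, 'b, 'g, 'e) gbundle"
    using Orb_ab_homD(2)[OF \<phi> that] Orb_ab_hom_in[OF \<phi> that] by (auto simp: compose_def fun_eq_iff extensional_def)
  \<comment> \<open>Equality of natural transformations is equality of functions, so arguments that
    are not objects have to be compared too.\<close>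
  have 3: "\<phi> Q = undefined" if "Q \<notin> L2_obj G GM" for Q :: "('p, 'b, 'g, 'e) gbundle"
    using Orb_ab_homD(1)[OF \<phi>] that by (simp add: extensional_def)
  show "Comp (Orb_ab G GM) X X Y \<phi> (Id (Orb_ab G GM) X) = \<phi>"
    by (rule ext) (simp add: Orb_ab_def restrict_def 1[unfolded restrict_def] 3)
  show "Comp (Orb_ab G GM) X Y Y (Id (Orb_ab G GM) Y) \<phi> = \<phi>"
    by (rule ext) (simp add: Orb_ab_def restrict_def 2[unfolded restrict_def] 3)
next
  fix W X Y Z :: "('p, 'b, 'g, 'e) orb_obj" and \<phi> \<psi> \<theta> :: "('p, 'b, 'g, 'e) orb_mor"
  assume "\<phi> \<in> Hom (Orb_ab G GM) W X"
  then have \<phi>: "\<phi> \<in> Orb_ab_hom G GM W X" by (auto simp: Orb_ab_def)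
  have "compose (topspace (map_mod G W Q)) (\<theta> Q) (compose (topspace (map_mod G W Q)) (\<psi> Q) (\<phi> Q)) =
      compose (topspace (map_mod G W Q)) (compose (topspace (map_mod G X Q)) (\<theta> Q) (\<psi> Q)) (\<phi> Q)"
    if "Q \<in> L2_obj G GM" for Q :: "('p, 'b, 'g, 'e) gbundle"
    using Orb_ab_hom_in[OF \<phi> that] by (auto simp: compose_def fun_eq_iff)
  then show "Comp (Orb_ab G GM) W Y Z \<theta> (Comp (Orb_ab G GM) W X Y \<psi> \<phi>) =
      Comp (Orb_ab G GM) W X Z (Comp (Orb_ab G GM) X Y Z \<theta> \<psi>) \<phi>"
    by (simp add: Orb_ab_def fun_eq_iff restrict_def)
qed

section \<open>The induced homomorphism of a morphism of orbits\<close>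

text \<open>Fixes a representative \<open>g\<close> of the orbit that corresponds to \<phi> under
  the Yoneda lemma. It points backwards, from the bundle of \<open>Y\<close> to that of
  \<open>X\<close>.\<close>

locale orb_morphism = X: orb_object G GM X + Y: orb_object G GM Y
  for G :: "'g monoid" and GM :: "('g, 'e::real_normed_vector) smfd" and X Y :: "('p, 'b, 'g, 'e) orb_obj" +
  fixes \<phi> :: "('p, 'b, 'g, 'e) orb_mor" and g :: "'p \<Rightarrow> 'p"
  assumes mor: "\<phi> \<in> Orb_ab_hom G GM X Y" and g: "g \<in> L2_mor G Y.P X.P"
    and \<phi>_id: "\<phi> X.P (orbit X (L2_id X.P)) = orbit Y g"
begin

text \<open>Pushing forward along \<open>t\<close> preserves the orbit of the identity, hence by
  naturality also its image under \<phi>, the orbit of \<open>g\<close>. So \<open>t\<close> after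
  \<open>g\<close> lies in that orbit again.\<close>

lemma conjugate_in_T:
  assumes t: "t \<in> X.T"
  obtains t' where "t' \<in> Y.T" "compose (pts Y.P) t g = compose (pts Y.P) g t'"
proof -
  have tm: "t \<in> L2_mor G X.P X.P" by (rule X.T_mor[OF t])
  have "push X t (orbit X (L2_id X.P)) = orbit X (L2_id X.P)"
    unfolding X.push_orbit[OF X.T_mor[OF X.id_in_T]] X.compose_id[OF L2_morD(1)[OF tm]] by (rule X.orbit_of_T[OF t])
  then have "push Y t (orbit Y g) = orbit Y g"
    using Orb_ab_homD(4)[OF mor X.P_obj X.P_obj tm X.id_orbit_in] by (simp add: \<phi>_id)
  then have "orbit Y (compose (pts Y.P) t g) = orbit Y g" unfolding Y.push_orbit[OF g] .
  moreover have "compose (pts Y.P) t g \<in> orbit Y (compose (pts Y.P) t g)"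
    by (rule Y.in_orbit[OF L2_mor_compose[OF X.lie Y.P_obj X.P_obj X.P_obj g tm]])
  ultimately have "compose (pts Y.P) t g \<in> orbit Y g" by simp
  then show ?thesis using that unfolding orbit_eq by blast
qed

text \<open>\<open>ind_hom\<close> conjugates by an arbitrarily chosen representative, which differs
  from \<open>g\<close> by an element \<open>s\<close> of the commutative group of \<open>Y\<close>;
  conjugation by \<open>s\<close> is trivial there. The equation in the conclusion avoids the
  inverse of \<open>g\<close>.\<close>

lemma ind_hom_props:
  assumes t: "t \<in> X.T"
  shows "ind_hom X Y \<phi> t \<in> Y.T" and "\<And>p. p \<in> pts Y.P \<Longrightarrow> g (ind_hom X Y \<phi> t p) = t (g p)"
proof -
  obtain t' where t': "t' \<in> Y.T" "compose (pts Y.P) t g = compose (pts Y.P) g t'"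
    using conjugate_in_T[OF t] .
  have gt: "t (g p) = g (t' p)" if "p \<in> pts Y.P" for p
    using fun_cong[OF t'(2), of p] that by (simp add: compose_def)
  define g1 where "g1 = (SOME g. g \<in> \<phi> X.P (orbit X (L2_id X.P)))"
  have "g1 \<in> \<phi> X.P (orbit X (L2_id X.P))"
    unfolding g1_def by (rule someI[of _ g]) (simp add: \<phi>_id Y.in_orbit[OF g])
  then have "g1 \<in> orbit Y g" unfolding \<phi>_id .
  then obtain s where s: "s \<in> Y.T" "g1 = compose (pts Y.P) g s"
    unfolding orbit_eq by blast
  note sm = Y.T_mor[OF s(1)] and tm' = Y.T_mor[OF t'(1)]
  have g1: "g1 \<in> L2_mor G Y.P X.P"
    unfolding s(2) by (rule L2_mor_compose[OF X.lie Y.P_obj Y.P_obj X.P_obj sm g])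
  have "ind_hom X Y \<phi> t = compose (pts Y.P) (L2_inv Y.P X.P g1) (compose (pts Y.P) t g1)"
    unfolding ind_hom_def g1_def by (simp add: Let_def case_prod_unfold)
  moreover have "compose (pts Y.P) (L2_inv Y.P X.P g1) (compose (pts Y.P) t g1) = t'"
  proof (rule extensionalityI[OF compose_extensional L2_morD(1)[OF tm']])
    fix p assume p: "p \<in> pts Y.P"
    have st: "s (t' p) = t' (s p)"
      using fun_cong[OF Y.T_commute[OF s(1) t'(1)], of p] p by (simp add: compose_def)
    have "t (g1 p) = g (t' (s p))" using gt[OF L2_morD(6)[OF sm p]] p by (simp add: s(2) compose_def)
    also have "\<dots> = g1 (t' p)" using L2_morD(6)[OF tm' p] by (simp add: s(2) compose_def st)
    finally show "compose (pts Y.P) (L2_inv Y.P X.P g1) (compose (pts Y.P) t g1) p = t' p"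
      using L2_inv_props(1)[OF g1 L2_morD(6)[OF tm' p]] p by (simp add: compose_def)
  qed
  ultimately have eq: "ind_hom X Y \<phi> t = t'" by simp
  show "ind_hom X Y \<phi> t \<in> Y.T" unfolding eq by (rule t'(1))
  show "g (ind_hom X Y \<phi> t p) = t (g p)" if "p \<in> pts Y.P" for p unfolding eq gt[OF that] ..
qed

text \<open>As \<open>g\<close> is injective, the intertwining equation determines the induced
  automorphism. Compatibility with products, identities and composition is proved by checking this
  equation.\<close>

lemma ind_hom_unique:
  assumes t: "t \<in> X.T" and u: "u \<in> L2_mor G Y.P Y.P" and eq: "\<And>p. p \<in> pts Y.P \<Longrightarrow> g (u p) = t (g p)"
  shows "ind_hom X Y \<phi> t = u"
proof (rule extensionalityI[OF L2_morD(1)[OF Y.T_mor[OF ind_hom_props(1)[OF t]]] L2_morD(1)[OF u]])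
  fix p assume p: "p \<in> pts Y.P"
  have "g (ind_hom X Y \<phi> t p) = g (u p)" using ind_hom_props(2)[OF t p] eq[OF p] by simp
  moreover have "inj_on g (pts Y.P)" using L2_morD(7)[OF g] by (simp add: bij_betw_def)
  ultimately show "ind_hom X Y \<phi> t p = u p"
    using L2_morD(6)[OF Y.T_mor[OF ind_hom_props(1)[OF t]] p] L2_morD(6)[OF u p] by (simp add: inj_on_def)
qed

lemma ind_hom_compose:
  assumes s: "s \<in> X.T" and t: "t \<in> X.T"
  shows "ind_hom X Y \<phi> (compose (pts X.P) s t) = compose (pts Y.P) (ind_hom X Y \<phi> s) (ind_hom X Y \<phi> t)"
proof (rule ind_hom_unique)
  note sm = Y.T_mor[OF ind_hom_props(1)[OF s]] and tm = Y.T_mor[OF ind_hom_props(1)[OF t]]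
  show "compose (pts X.P) s t \<in> X.T" using X.m_closed s t by (simp add: aut_group_simps)
  show "compose (pts Y.P) (ind_hom X Y \<phi> s) (ind_hom X Y \<phi> t) \<in> L2_mor G Y.P Y.P"
    by (rule L2_mor_compose[OF X.lie Y.P_obj Y.P_obj Y.P_obj tm sm])
  show "g (compose (pts Y.P) (ind_hom X Y \<phi> s) (ind_hom X Y \<phi> t) p) = compose (pts X.P) s t (g p)"
    if p: "p \<in> pts Y.P" for p
    using ind_hom_props(2)[OF s L2_morD(6)[OF tm p]] ind_hom_props(2)[OF t p] L2_morD(6)[OF g p] p
    by (simp add: compose_def)
qed

text \<open>For continuity, a subbasic condition on the conjugated automorphism, sending
  \<open>K\<close> into \<open>U\<close>, is one on the original: it sends the image of
  \<open>K\<close> under \<open>g\<close> into the preimage of \<open>U\<close> under the inverse of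
  \<open>g\<close>.\<close>

lemma ind_hom_HomC:
  assumes \<gamma>: "\<gamma> \<in> X.HomC"
  shows "(\<lambda>z. ind_hom X Y \<phi> (\<gamma> z)) \<in> Y.HomC"
proof (rule Y.HomC_I)
  have T: "\<gamma> z \<in> X.T" for z using X.HomC_closed[OF \<gamma>] by (simp add: aut_group_simps)
  show in_T: "ind_hom X Y \<phi> (\<gamma> z) \<in> carrier (aut_group G Y)" for z
    using ind_hom_props(1)[OF T] by (simp add: aut_group_simps)
  show "ind_hom X Y \<phi> (\<gamma> (z + w)) = ind_hom X Y \<phi> (\<gamma> z) \<otimes>\<^bsub>aut_group G Y\<^esub> ind_hom X Y \<phi> (\<gamma> w)" for z w
    unfolding X.HomC_add[OF \<gamma>] unfolding aut_group_simps by (rule ind_hom_compose[OF T T])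
  have \<gamma>c: "continuous_map euclidean (L2_map G X.P X.P) \<gamma>"
    using X.HomC_continuous[OF \<gamma>] continuous_map_into_fulltopology by blast
  have "continuous_map euclidean (L2_map G Y.P Y.P) (\<lambda>z. ind_hom X Y \<phi> (\<gamma> z))"
    unfolding L2_map_def[of G Y.P Y.P]
  proof (rule continuous_map_into_compact_open)
    show "(\<lambda>z. ind_hom X Y \<phi> (\<gamma> z)) \<in> topspace euclidean \<rightarrow> L2_mor G Y.P Y.P"
      using Y.T_mor[OF ind_hom_props(1)[OF T]] by simp
    fix K U assume K: "compactin (mtop (tot Y.P)) K" and U: "openin (mtop (tot Y.P)) U"
    have KP: "K \<subseteq> pts Y.P" by (rule compactin_subset_topspace[OF K])
    let ?h = "L2_inv Y.P X.P g"
    let ?U = "{q \<in> pts X.P. ?h q \<in> U}"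
    have gU: "openin (mtop (tot X.P)) ?U"
      by (rule openin_continuous_map_preimage[OF L2_morD(5)[OF L2_mor_inv[OF X.lie Y.P_obj X.P_obj g]] U])
    have gK: "compactin (mtop (tot X.P)) (g ` K)" by (rule image_compactin[OF K L2_morD(5)[OF g]])
    have "openin euclidean {z \<in> topspace euclidean. \<gamma> z \<in> {f \<in> L2_mor G X.P X.P. f ` (g ` K) \<subseteq> ?U}}"
      by (rule openin_continuous_map_preimage[OF \<gamma>c openin_L2_map[OF gK gU]])
    moreover have "\<gamma> z \<in> {f \<in> L2_mor G X.P X.P. f ` (g ` K) \<subseteq> ?U} \<longleftrightarrow> (\<lambda>p. ind_hom X Y \<phi> (\<gamma> z) p) ` K \<subseteq> U" for z
    proof -
      have "\<gamma> z (g p) \<in> ?U \<longleftrightarrow> ind_hom X Y \<phi> (\<gamma> z) p \<in> U" if "p \<in> K" for p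
      proof -
        have p: "p \<in> pts Y.P" using that KP by blast
        have "?h (\<gamma> z (g p)) = ind_hom X Y \<phi> (\<gamma> z) p"
          using L2_inv_props(1)[OF g L2_morD(6)[OF Y.T_mor[OF ind_hom_props(1)[OF T]] p]] ind_hom_props(2)[OF T p] by simp
        then show ?thesis using L2_morD(6)[OF X.T_mor[OF T] L2_morD(6)[OF g p]] by simp
      qed
      then show ?thesis using X.T_mor[OF T] by (simp add: image_subset_iff)
    qed
    ultimately show "openin euclidean {z \<in> topspace euclidean. ind_hom X Y \<phi> (\<gamma> z) ` K \<subseteq> U}" by simp
  qed
  then show "continuous_map euclidean Y.\<tau> (\<lambda>z. ind_hom X Y \<phi> (\<gamma> z))"
    using in_T by (simp add: continuous_map_in_subtopology)
qed

text \<open>The diffeomorphism of the bases that \<open>g\<close> covers intertwines the two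
  actions, so transitivity on one base carries over to the other.\<close>

lemma ind_hom_frames:
  assumes \<gamma>: "\<gamma> \<in> X.frames"
  shows "(\<lambda>z. ind_hom X Y \<phi> (\<gamma> z)) \<in> Y.frames"
proof -
  have \<gamma>H: "\<gamma> \<in> X.HomC" using \<gamma> by (simp add: X.frames_def)
  have T: "\<gamma> z \<in> X.T" for z using X.HomC_closed[OF \<gamma>H] by (simp add: aut_group_simps)
  obtain h where h: "diffeo (base Y.P) (base X.P) h" "covers Y.P X.P g h" using L2_morD(4)[OF g] by blast
  obtain k where k: "\<And>x. x \<in> base_pts Y.P \<Longrightarrow> k (h x) = x" using diffeo_inverse[OF h(1)] by metis
  have hin: "h x \<in> base_pts X.P" if "x \<in> base_pts Y.P" for x
    by (rule smooth_map_in_topspace[OF diffeo_imp_smooth_map[OF h(1)] that])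
  have hact: "h (base_act Y.P (ind_hom X Y \<phi> (\<gamma> z)) x) = base_act X.P (\<gamma> z) (h x)" if x: "x \<in> base_pts Y.P" for z x
  proof -
    obtain p where p: "p \<in> pts Y.P" "bproj Y.P p = x" using bproj_surj[OF X.lie Y.P_obj x] by blast
    note im = Y.T_mor[OF ind_hom_props(1)[OF T[of z]]]
    have "h (base_act Y.P (ind_hom X Y \<phi> (\<gamma> z)) x) = h (bproj Y.P (ind_hom X Y \<phi> (\<gamma> z) p))"
      using base_act_bproj[OF im p(1)] p(2) by simp
    also have "\<dots> = bproj X.P (g (ind_hom X Y \<phi> (\<gamma> z) p))"
      using h(2) L2_morD(6)[OF im p(1)] by (simp add: covers_def)
    also have "\<dots> = bproj X.P (\<gamma> z (g p))" using ind_hom_props(2)[OF T p(1)] by simp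
    also have "\<dots> = base_act X.P (\<gamma> z) (bproj X.P (g p))"
      using base_act_bproj[OF X.T_mor[OF T] L2_morD(6)[OF g p(1)]] by simp
    also have "bproj X.P (g p) = h x" using h(2) p by (simp add: covers_def)
    finally show ?thesis .
  qed
  have "\<exists>z. base_act Y.P (ind_hom X Y \<phi> (\<gamma> z)) x = y" if x: "x \<in> base_pts Y.P" and y: "y \<in> base_pts Y.P" for x y
  proof -
    have "\<forall>x\<in>base_pts X.P. \<forall>y\<in>base_pts X.P. \<exists>z. base_act X.P (\<gamma> z) x = y"
      using \<gamma> by (simp add: X.frames_def)
    from bspec[OF bspec[OF this hin[OF x]] hin[OF y]] obtain z where z: "base_act X.P (\<gamma> z) (h x) = h y" ..
    have "base_act Y.P (ind_hom X Y \<phi> (\<gamma> z)) x \<in> base_pts Y.P"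
      using Y.act_in[OF Y.HomC_closed[OF ind_hom_HomC[OF \<gamma>H]] x] .
    then have "base_act Y.P (ind_hom X Y \<phi> (\<gamma> z)) x = k (h (base_act Y.P (ind_hom X Y \<phi> (\<gamma> z)) x))"
      by (simp add: k)
    also have "\<dots> = y" unfolding hact[OF x] z by (rule k[OF y])
    finally show ?thesis by blast
  qed
  then show ?thesis using ind_hom_HomC[OF \<gamma>H] by (simp add: Y.frames_def)
qed

end

section \<open>Functoriality of the induced homomorphism\<close>

lemma orb_morphism_exists:
  assumes lie: "compact_lie_group G GM" and X: "X \<in> Orb_ab_obj G GM" and Y: "Y \<in> Orb_ab_obj G GM"
    and \<phi>: "\<phi> \<in> Orb_ab_hom G GM X Y"
  obtains g where "orb_morphism G GM X Y \<phi> g"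
proof -
  interpret X: orb_object G GM X by unfold_locales (rule lie, rule X)
  interpret Y: orb_object G GM Y by unfold_locales (rule lie, rule Y)
  have "\<phi> X.P (orbit X (L2_id X.P)) \<in> topspace (map_mod G Y X.P)"
    by (rule Orb_ab_hom_in[OF \<phi> X.P_obj X.id_orbit_in])
  then obtain g where "g \<in> L2_mor G Y.P X.P" "\<phi> X.P (orbit X (L2_id X.P)) = orbit Y g"
    by (auto simp: topspace_map_mod)
  then have "orb_morphism G GM X Y \<phi> g"
    using \<phi> by unfold_locales
  then show ?thesis using that by blast
qed

lemma ind_hom_Id:
  assumes lie: "compact_lie_group G GM" and X: "X \<in> Orb_ab_obj G GM" and t: "t \<in> snd X"
  shows "ind_hom X X (Id (Orb_ab G GM) X) t = t"
proof -
  interpret X: orb_object G GM X by unfold_locales (rule lie, rule X)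
  let ?I = "Id (Orb_ab G GM) X"
  have "?I X.P (orbit X (L2_id X.P)) = orbit X (L2_id X.P)"
    using X.P_obj X.id_orbit_in by (simp add: Orb_ab_def)
  moreover have "?I \<in> Orb_ab_hom G GM X X"
  proof -
    have "Obj (Orb_ab G GM) = Orb_ab_obj G GM" "Hom (Orb_ab G GM) = Orb_ab_hom G GM" by (simp_all add: Orb_ab_def)
    then show ?thesis using is_category_Orb_ab[OF lie] X unfolding is_category_def by metis
  qed
  ultimately interpret orb_morphism G GM X X ?I "L2_id X.P"
    using X.T_mor[OF X.id_in_T] by unfold_locales
  note tm = X.T_mor[OF t]
  show ?thesis
    by (rule ind_hom_unique[OF t tm]) (use L2_morD(6)[OF tm] in \<open>simp add: L2_id_def\<close>)
qed

text \<open>Writing the orbit of \<open>g\<close> as the pushforward along \<open>g\<close> of the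
  orbit of the identity, naturality of \<psi> shows that the composite is represented by
  \<open>g\<close> after \<open>g'\<close>. Conjugations then compose in the right order.\<close>

lemma ind_hom_Comp:
  assumes "orb_morphism G GM X Y \<phi> g" "orb_morphism G GM Y Z \<psi> g'" and t: "t \<in> snd X"
  shows "ind_hom X Z (Comp (Orb_ab G GM) X Y Z \<psi> \<phi>) t = ind_hom Y Z \<psi> (ind_hom X Y \<phi> t)"
proof -
  interpret f: orb_morphism G GM X Y \<phi> g by fact
  interpret f': orb_morphism G GM Y Z \<psi> g' by fact
  let ?C = "Comp (Orb_ab G GM) X Y Z \<psi> \<phi>" and ?g = "compose (pts f'.Y.P) g g'"
  have C: "?C f.X.P (orbit X (L2_id f.X.P)) = orbit Z ?g"
  proof -
    have "?C f.X.P (orbit X (L2_id f.X.P)) = \<psi> f.X.P (orbit Y g)"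
      using f.X.P_obj f.X.id_orbit_in by (simp add: Orb_ab_def compose_def f.\<phi>_id)
    also have "orbit Y g = push Y g (orbit Y (L2_id f.Y.P))"
      unfolding f.Y.push_orbit[OF f.Y.T_mor[OF f.Y.id_in_T]] f.Y.compose_id[OF L2_morD(1)[OF f.g]] ..
    also have "\<psi> f.X.P (push Y g (orbit Y (L2_id f.Y.P))) = push Z g (\<psi> f.Y.P (orbit Y (L2_id f.Y.P)))"
      by (rule Orb_ab_homD(4)[OF f'.mor f.Y.P_obj f.X.P_obj f.g f.Y.id_orbit_in])
    also have "\<dots> = orbit Z ?g" unfolding f'.\<phi>_id f'.Y.push_orbit[OF f'.g] ..
    finally show ?thesis .
  qed
  have "?C \<in> Orb_ab_hom G GM X Z"
  proof -
    have "Obj (Orb_ab G GM) = Orb_ab_obj G GM" "Hom (Orb_ab G GM) = Orb_ab_hom G GM" by (simp_all add: Orb_ab_def)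
    then show ?thesis
      using is_category_Orb_ab[OF f.X.lie] f.X.obj f.Y.obj f'.Y.obj f.mor f'.mor unfolding is_category_def by metis
  qed
  then interpret c: orb_morphism G GM X Z ?C ?g
    using C L2_mor_compose[OF f.X.lie f'.Y.P_obj f.Y.P_obj f.X.P_obj f'.g f.g] by unfold_locales
  note it = f.ind_hom_props[OF t] and iit = f'.ind_hom_props[OF f.ind_hom_props(1)[OF t]]
  show ?thesis
  proof (rule c.ind_hom_unique[OF t f'.Y.T_mor[OF iit(1)]])
    fix p assume p: "p \<in> pts f'.Y.P"
    show "?g (ind_hom Y Z \<psi> (ind_hom X Y \<phi> t) p) = t (?g p)"
      using L2_morD(6)[OF f'.Y.T_mor[OF iit(1)] p] iit(2)[OF p] it(2)[OF L2_morD(6)[OF f'.g p]] p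
      by (simp add: compose_def)
  qed
qed

section \<open>The functor of frames\<close>

text \<open>The reference chart that occurs in the definition of \<open>Fr\<close>. It covers all of
  Fr(T), so the frames form a manifold with a global chart.\<close>

definition frame_chart ::
    "'g monoid \<Rightarrow> ('p, 'b, 'g, 'e::real_normed_vector) orb_obj \<Rightarrow> nat
      \<Rightarrow> ((nat \<Rightarrow> complex) \<Rightarrow> 'p chom) \<Rightarrow> 'p chom cchart" where
  "frame_chart G X n L = ({x \<in> Cn n. L x \<in> Fr_set G X}, restrict L {x \<in> Cn n. L x \<in> Fr_set G X})"

context orb_object
begin

definition Fr_top where "Fr_top = subtopology (Hom_C_top G X) (Fr_set G X)"

lemma topspace_Fr_top: "topspace Fr_top = Fr_set G X"
  unfolding Fr_top_def using Fr_set_subset by (auto simp: topspace_Hom_C_top)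

text \<open>Brings \<open>Fr\<close> into the shape of \<open>Cx_manifold_global_charts\<close>,
  with the linear charts as the set \<open>R\<close>.\<close>

lemma Fr_eq: "Fr G X = \<lparr>ctop = Fr_top, cact = Hom_C_scale, cdim = Hom_C_dim G X,
    ccharts = {c. is_cchart Fr_top Hom_C_scale (Hom_C_dim G X) c \<and>
      (\<forall>r\<in>{frame_chart G X (Hom_C_dim G X) L | L. lin_iso G X (Hom_C_dim G X) L}.
        holo_compatible (Hom_C_dim G X) c r)}\<rparr>"
  unfolding Fr_def Let_def Fr_top_def frame_chart_def by (auto simp: cmfd.simps)

lemma lin_isoD:
  assumes "lin_iso G X n L"
  shows "inj_on L (Cn n)" "L ` Cn n = Hom_C G X"
    "\<And>x y z. x \<in> Cn n \<Longrightarrow> y \<in> Cn n \<Longrightarrow> L (\<lambda>i. x i + y i) z = compose (pts P) (L x z) (L y z)"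
    "\<And>c x. x \<in> Cn n \<Longrightarrow> L (cscale c x) = Hom_C_scale c (L x)"
  using assms by (auto simp: lin_iso_def bij_betw_def Hom_C_add_def Aut_def)

lemma frame_chart_image:
  assumes "lin_iso G X n L"
  shows "snd (frame_chart G X n L) ` fst (frame_chart G X n L) = Fr_set G X"
proof -
  have "Fr_set G X \<subseteq> L ` Cn n" using lin_isoD(2)[OF assms] Fr_set_subset by simp
  then show ?thesis by (auto simp: frame_chart_def)
qed

lemma is_cchart_frame_chart:
  assumes ne: "Fr_set G X \<noteq> {}" and L: "lin_iso G X n L"
  shows "is_cchart Fr_top Hom_C_scale n (frame_chart G X n L)"
proof -
  let ?U = "{x \<in> Cn n. L x \<in> Fr_set G X}"
  have im: "restrict L ?U ` ?U = Fr_set G X" using frame_chart_image[OF L] by (simp add: frame_chart_def)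
  have "homeomorphic_map (subtopology (top_of_set (Cn n)) ?U) (subtopology (Hom_C_top G X) (Fr_set G X)) L"
  proof (rule homeomorphic_map_subtopologies[OF lin_iso_homeomorphic_map[OF L]])
    show "L ` (topspace (top_of_set (Cn n)) \<inter> ?U) = topspace (Hom_C_top G X) \<inter> Fr_set G X"
      using lin_isoD(2)[OF L] by (auto simp: topspace_Hom_C_top)
  qed
  then have "homeomorphic_map (top_of_set ?U) Fr_top L"
    by (simp add: subtopology_subtopology Fr_top_def Int_absorb1 Collect_conj_eq[symmetric] Int_def)
  then have "homeomorphic_map (top_of_set ?U) Fr_top (restrict L ?U)"
    by (rule homeomorphic_map_eq) simp
  moreover have "subtopology Fr_top (Fr_set G X) = Fr_top"
    using subtopology_topspace[of Fr_top] by (simp add: topspace_Fr_top)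
  ultimately have hom: "homeomorphic_map (top_of_set ?U) (subtopology Fr_top (restrict L ?U ` ?U)) (restrict L ?U)"
    by (simp only: im)
  have op: "openin Fr_top (restrict L ?U ` ?U)"
    unfolding im using openin_topspace[of Fr_top] by (simp add: topspace_Fr_top)
  have "cscale c x \<in> ?U \<and> restrict L ?U (cscale c x) = Hom_C_scale c (restrict L ?U x)"
    if "c \<noteq> 0" "x \<in> ?U" for c x
    using that lin_isoD(4)[OF L] Fr_set_scale Cn_cscale by simp
  then have "\<forall>c x. c \<noteq> 0 \<and> x \<in> ?U \<longrightarrow>
      cscale c x \<in> ?U \<and> restrict L ?U (cscale c x) = Hom_C_scale c (restrict L ?U x)"
    by blast
  then show ?thesis
    unfolding is_cchart_def frame_chart_def prod.case
    by (intro conjI restrict_extensional openin_Fr_set[OF ne L] op hom)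
qed

end

section \<open>Linear maps in the linear charts\<close>

text \<open>The map \<open>F\<close> is left open so that the identity gives the change of linear
  charts and conjugation gives the map induced by a morphism. Additivity is expressed through a
  third homomorphism \<theta>, which is what the value of \<open>L\<close> at a sum
  provides.\<close>

lemma linear_transition:
  assumes X: "orb_object G GM X" and Y: "orb_object G GM Y"
    and L: "lin_iso G X n L" and L': "lin_iso G Y m L'"
    and F: "\<And>\<gamma>. \<gamma> \<in> Hom_C G X \<Longrightarrow> F \<gamma> \<in> Hom_C G Y"
    and add: "\<And>\<gamma> \<delta> \<theta>. \<gamma> \<in> Hom_C G X \<Longrightarrow> \<delta> \<in> Hom_C G X \<Longrightarrow> \<theta> \<in> Hom_C G X \<Longrightarrow>
        (\<And>z. \<theta> z = compose (pts (fst X)) (\<gamma> z) (\<delta> z)) \<Longrightarrow>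
        (\<And>z. F \<theta> z = compose (pts (fst Y)) (F \<gamma> z) (F \<delta> z))"
    and scale: "\<And>c \<gamma>. \<gamma> \<in> Hom_C G X \<Longrightarrow> F (Hom_C_scale c \<gamma>) = Hom_C_scale c (F \<gamma>)"
  obtains A a where "\<And>x. x \<in> Cn n \<Longrightarrow> A x \<in> Cn m" "\<And>x. x \<in> Cn n \<Longrightarrow> L' (A x) = F (L x)"
    "\<And>x j. x \<in> Cn n \<Longrightarrow> A x j = (\<Sum>i<n. a j i * x i)"
proof -
  interpret X: orb_object G GM X by fact
  interpret Y: orb_object G GM Y by fact
  note l = X.lin_isoD[OF L] and l' = Y.lin_isoD[OF L']
  \<comment> \<open>The coordinate form of \<open>F\<close>. Its linearity is verified after
    applying the injective \<open>L'\<close>.\<close>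
  define A where "A x = the_inv_into (Cn m) L' (F (L x))" for x
  have LX: "L x \<in> Hom_C G X" if "x \<in> Cn n" for x using l(2) that by blast
  have im: "F (L x) \<in> L' ` Cn m" if "x \<in> Cn n" for x
    unfolding l'(2) by (rule F[OF LX[OF that]])
  have AC: "A x \<in> Cn m" if "x \<in> Cn n" for x
    unfolding A_def by (rule the_inv_into_into[OF l'(1) im[OF that] subset_refl])
  have LA: "L' (A x) = F (L x)" if "x \<in> Cn n" for x
    unfolding A_def by (rule f_the_inv_into_f[OF l'(1) im[OF that]])
  have Aadd: "A (\<lambda>i. x i + y i) = (\<lambda>j. A x j + A y j)" if xy: "x \<in> Cn n" "y \<in> Cn n" for x y
  proof (rule inj_onD[OF l'(1)])
    have "L' (A (\<lambda>i. x i + y i)) z = L' (\<lambda>j. A x j + A y j) z" for z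
      unfolding LA[OF Cn_add[OF xy]] l'(3)[OF AC[OF xy(1)] AC[OF xy(2)]] LA[OF xy(1)] LA[OF xy(2)]
      by (rule add[OF LX[OF xy(1)] LX[OF xy(2)] LX[OF Cn_add[OF xy]] l(3)[OF xy]])
    then show "L' (A (\<lambda>i. x i + y i)) = L' (\<lambda>j. A x j + A y j)" ..
  qed (use AC xy Cn_add in auto)
  have Ascale: "A (cscale c x) = cscale c (A x)" if x: "x \<in> Cn n" for c x
  proof (rule inj_onD[OF l'(1)])
    show "L' (A (cscale c x)) = L' (cscale c (A x))"
      unfolding LA[OF Cn_cscale[OF x]] l'(4)[OF AC[OF x]] l(4)[OF x] LA[OF x] by (rule scale[OF LX[OF x]])
  qed (use AC x Cn_cscale in auto)
  have "\<exists>a. \<forall>x\<in>Cn n. \<forall>j. A x j = (\<Sum>i<n. a j i * x i)"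
    by (rule linear_Cn_matrix[OF AC Aadd Ascale]) blast+
  then obtain a where a: "\<forall>x\<in>Cn n. \<forall>j. A x j = (\<Sum>i<n. a j i * x i)" ..
  show ?thesis by (rule that[of A a]) (use AC LA a in blast)+
qed

lemma frame_chart_transition:
  assumes X: "orb_object G GM X" and Y: "orb_object G GM Y"
    and L: "lin_iso G X n L" and L': "lin_iso G Y m L'"
    and A: "\<And>x. x \<in> Cn n \<Longrightarrow> A x \<in> Cn m" "\<And>x. x \<in> Cn n \<Longrightarrow> L' (A x) = F (L x)"
      "\<And>x j. x \<in> Cn n \<Longrightarrow> A x j = (\<Sum>i<n. a j i * x i)"
    and F: "\<And>\<gamma>. \<gamma> \<in> Fr_set G X \<Longrightarrow> F \<gamma> \<in> Fr_set G Y"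
  shows "holo_on n m (fst (frame_chart G X n L))
    (the_inv_into (fst (frame_chart G Y m L')) (snd (frame_chart G Y m L')) \<circ> F \<circ> snd (frame_chart G X n L))"
proof -
  interpret Y: orb_object G GM Y by fact
  let ?U = "fst (frame_chart G X n L)" and ?V = "fst (frame_chart G Y m L')"
    and ?r = "snd (frame_chart G X n L)" and ?s = "snd (frame_chart G Y m L')"
  have UC: "?U \<subseteq> Cn n" by (auto simp: frame_chart_def)
  have inj: "inj_on ?s ?V"
    using Y.lin_isoD(1)[OF L'] by (auto simp: frame_chart_def inj_on_def)
  have eqA: "A x = (the_inv_into ?V ?s \<circ> F \<circ> ?r) x" if x: "x \<in> ?U" for x
  proof -
    have x': "x \<in> Cn n" "L x \<in> Fr_set G X" "?r x = L x" using x by (auto simp: frame_chart_def)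
    have "A x \<in> ?V" using A(1,2)[OF x'(1)] F[OF x'(2)] by (simp add: frame_chart_def)
    moreover have "?s (A x) = F (?r x)"
      using \<open>A x \<in> ?V\<close> A(2)[OF x'(1)] x'(3) by (simp add: frame_chart_def)
    ultimately show ?thesis using the_inv_into_f_f[OF inj, of "A x"] by simp
  qed
  have "holo_on n m ?U A"
    by (rule holo_on_matrix[OF UC, where A = a]) (use A(3) UC in blast)
  then show ?thesis by (rule holo_on_cong[OF UC, rotated]) (rule eqA)
qed

context orb_object
begin

text \<open>The case of the identity in the two preceding lemmas: the transition is the restriction
  of an invertible linear map, and by symmetry only one direction needs an argument.\<close>

lemma frame_charts_compatible:
  assumes L: "lin_iso G X n L" and L': "lin_iso G X n L'"
  shows "holo_compatible n (frame_chart G X n L) (frame_chart G X n L')"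
proof -
  have O: "orb_object G GM X" by (rule orb_object_axioms)
  have "holo_on n n {x \<in> fst (frame_chart G X n L). snd (frame_chart G X n L) x \<in> Fr_set G X}
      (the_inv_into (fst (frame_chart G X n L')) (snd (frame_chart G X n L')) \<circ> snd (frame_chart G X n L))"
    if L: "lin_iso G X n L" and L': "lin_iso G X n L'" for L L'
  proof -
    obtain A a where A: "\<And>x. x \<in> Cn n \<Longrightarrow> A x \<in> Cn n" "\<And>x. x \<in> Cn n \<Longrightarrow> L' (A x) = (\<lambda>\<gamma>. \<gamma>) (L x)"
      "\<And>x j. x \<in> Cn n \<Longrightarrow> A x j = (\<Sum>i<n. a j i * x i)"
      by (rule linear_transition[OF O O L L', of "\<lambda>\<gamma>. \<gamma>"]) auto
    have "holo_on n n (fst (frame_chart G X n L))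
      (the_inv_into (fst (frame_chart G X n L')) (snd (frame_chart G X n L')) \<circ> (\<lambda>\<gamma>. \<gamma>) \<circ> snd (frame_chart G X n L))"
      by (rule frame_chart_transition[where F = "\<lambda>\<gamma>. \<gamma>", OF O O L L' A])
    then have "holo_on n n (fst (frame_chart G X n L))
      (the_inv_into (fst (frame_chart G X n L')) (snd (frame_chart G X n L')) \<circ> snd (frame_chart G X n L))"
      by (simp add: comp_def)
    then show ?thesis by (rule holo_on_subset) auto
  qed
  from this[OF L L'] this[OF L' L] show ?thesis
    using frame_chart_image[OF L] frame_chart_image[OF L']
    by (simp add: holo_compatible_def case_prod_unfold)
qed

lemma Cx_manifold_Fr: "Cx_manifold (Fr G X)"
  unfolding Fr_eq
proof (rule Cx_manifold_global_charts)
  fix x assume "x \<in> topspace Fr_top"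
  show "Hom_C_scale 1 x = x" by (simp add: Hom_C_scale_def)
next
  fix c d x
  show "Hom_C_scale c (Hom_C_scale d x) = Hom_C_scale (c * d) x"
    by (simp add: Hom_C_scale_def mult_ac)
next
  assume "topspace Fr_top \<noteq> {}"
  then have ne: "Fr_set G X \<noteq> {}" by (simp add: topspace_Fr_top)
  obtain n L where L: "lin_iso G X n L" using lin_iso_exists[OF ne] .
  then show "{frame_chart G X (Hom_C_dim G X) L | L. lin_iso G X (Hom_C_dim G X) L} \<noteq> {}"
    using Hom_C_dim_eq[OF L] by blast
next
  fix r assume "topspace Fr_top \<noteq> {}" "r \<in> {frame_chart G X (Hom_C_dim G X) L | L. lin_iso G X (Hom_C_dim G X) L}"
  then show "is_cchart Fr_top Hom_C_scale (Hom_C_dim G X) r \<and> snd r ` fst r = topspace Fr_top"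
    using is_cchart_frame_chart frame_chart_image unfolding topspace_Fr_top by blast
next
  fix r s
  assume "r \<in> {frame_chart G X (Hom_C_dim G X) L | L. lin_iso G X (Hom_C_dim G X) L}"
    "s \<in> {frame_chart G X (Hom_C_dim G X) L | L. lin_iso G X (Hom_C_dim G X) L}"
  then show "holo_compatible (Hom_C_dim G X) r s"
    using frame_charts_compatible by blast
qed

lemma Fr_simps: "ctop (Fr G X) = Fr_top" "cact (Fr G X) = Hom_C_scale" "cdim (Fr G X) = Hom_C_dim G X"
  by (simp_all add: Fr_eq)

lemma frame_chart_in_atlas:
  assumes ne: "Fr_set G X \<noteq> {}" and L: "lin_iso G X (Hom_C_dim G X) L"
  shows "frame_chart G X (Hom_C_dim G X) L \<in> ccharts (Fr G X)"
  using is_cchart_frame_chart[OF ne L] frame_charts_compatible[OF L] by (auto simp: Fr_eq)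

lemma ex_lin_iso_dim:
  assumes "Fr_set G X \<noteq> {}"
  obtains L where "lin_iso G X (Hom_C_dim G X) L"
proof -
  obtain n L where L: "lin_iso G X n L" using lin_iso_exists[OF assms] .
  then show ?thesis using that Hom_C_dim_eq[OF L] by blast
qed

end

text \<open>Covers morphisms out of an object without frames, for which no linear chart is at
  hand.\<close>

lemma Cx_holo_map_empty:
  assumes "Cx_manifold M" "topspace (ctop M) = {}"
  shows "Cx_holo_map M N f"
proof (rule Cx_holo_mapI)
  show "continuous_map (ctop M) (ctop N) f" using assms(2) by (simp add: continuous_map_def Pi_def)
  show "holo_on (cdim M) (cdim N) {x \<in> U. f (\<phi> x) \<in> \<psi> ` V} (the_inv_into V \<psi> \<circ> f \<circ> \<phi>)"
    if "(U, \<phi>) \<in> ccharts M" for U \<phi> V \<psi>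
  proof -
    have "U = {}" using is_cchartD(5)[OF Cx_manifoldD(1)[OF assms(1) that]] assms(2) by blast
    then show ?thesis by (simp add: holo_on_def)
  qed
qed (use assms(2) in simp)

context orb_morphism
begin

lemma Fr_map_Fr_set: "\<gamma> \<in> Fr_set G X \<Longrightarrow> Fr_map G X Y \<phi> \<gamma> \<in> Fr_set G Y"
  using ind_hom_frames by (simp add: Fr_map_def X.Fr_set_eq Y.Fr_set_eq comp_def)

lemma Cx_holo_map_Fr_map: "Cx_holo_map (Fr G X) (Fr G Y) (Fr_map G X Y \<phi>)"
proof (cases "Fr_set G X = {}")
  case True
  then show ?thesis
    by (intro Cx_holo_map_empty X.Cx_manifold_Fr) (simp add: X.Fr_simps X.topspace_Fr_top)
next
  case ne: False
  \<comment> \<open>A frame of \<open>X\<close> is carried to one of \<open>Y\<close>, so a linear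
    chart is available on the target as well.\<close>
  then have ne': "Fr_set G Y \<noteq> {}" using Fr_map_Fr_set by blast
  obtain L where L: "lin_iso G X (Hom_C_dim G X) L" using X.ex_lin_iso_dim[OF ne] .
  obtain L' where L': "lin_iso G Y (Hom_C_dim G Y) L'" using Y.ex_lin_iso_dim[OF ne'] .
  let ?n = "Hom_C_dim G X" and ?m = "Hom_C_dim G Y" and ?f = "Fr_map G X Y \<phi>"
  let ?W = "fst (frame_chart G X ?n L)" and ?r = "snd (frame_chart G X ?n L)"
    and ?W' = "fst (frame_chart G Y ?m L')" and ?s = "snd (frame_chart G Y ?m L')"
  \<comment> \<open>\<open>Fr_map\<close> is restricted to frames, which are not closed under
    addition. The linear algebra needs the same formula on all of Hom(C, T).\<close>
  let ?F = "\<lambda>\<gamma>. ind_hom X Y \<phi> \<circ> \<gamma>"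
  have T: "\<gamma> z \<in> X.T" if "\<gamma> \<in> Hom_C G X" for \<gamma> z
    using X.HomC_closed that by (simp add: X.Hom_C_eq aut_group_simps)
  obtain A a where A: "\<And>x. x \<in> Cn ?n \<Longrightarrow> A x \<in> Cn ?m" "\<And>x. x \<in> Cn ?n \<Longrightarrow> L' (A x) = ?F (L x)"
    "\<And>x j. x \<in> Cn ?n \<Longrightarrow> A x j = (\<Sum>i<?n. a j i * x i)"
  proof (rule linear_transition[OF X.orb_object_axioms Y.orb_object_axioms L L', of ?F])
    show "?F \<gamma> \<in> Hom_C G Y" if "\<gamma> \<in> Hom_C G X" for \<gamma>
      using ind_hom_HomC that by (simp add: X.Hom_C_eq Y.Hom_C_eq comp_def)
    show "?F \<theta> z = compose (pts Y.P) (?F \<gamma> z) (?F \<delta> z)"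
      if "\<gamma> \<in> Hom_C G X" "\<delta> \<in> Hom_C G X" "\<And>z. \<theta> z = compose (pts X.P) (\<gamma> z) (\<delta> z)" for \<gamma> \<delta> \<theta> z
      using ind_hom_compose[OF T[OF that(1)] T[OF that(2)]] by (simp add: that(3))
    show "?F (Hom_C_scale c \<gamma>) = Hom_C_scale c (?F \<gamma>)" for c \<gamma>
      by (simp add: Hom_C_scale_def comp_def)
  qed blast
  have rX: "(?W, ?r) \<in> ccharts (Fr G X)" using X.frame_chart_in_atlas[OF ne L] by simp
  have sY: "(?W', ?s) \<in> ccharts (Fr G Y)" using Y.frame_chart_in_atlas[OF ne' L'] by simp
  have WC: "?W \<subseteq> Cn ?n" by (auto simp: frame_chart_def)
  have fr: "?f (?r x) = ?s (A x)" "A x \<in> ?W'" if x: "x \<in> ?W" for x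
  proof -
    have x': "x \<in> Cn ?n" "L x \<in> Fr_set G X" "?r x = L x" using x by (auto simp: frame_chart_def)
    have eq: "?f (L x) = L' (A x)" using x'(2) A(2)[OF x'(1)] by (simp add: Fr_map_def)
    then show "A x \<in> ?W'" using Fr_map_Fr_set[OF x'(2)] A(1)[OF x'(1)] by (simp add: frame_chart_def)
    then show "?f (?r x) = ?s (A x)" using eq x'(3) by (simp add: frame_chart_def)
  qed
  show ?thesis
  proof (rule Cx_holo_map_global[OF X.Cx_manifold_Fr Y.Cx_manifold_Fr rX _ sY])
    show imX: "?r ` ?W = topspace (ctop (Fr G X))"
      using X.frame_chart_image[OF L] by (simp add: X.Fr_simps X.topspace_Fr_top)
    show "?s ` ?W' = topspace (ctop (Fr G Y))"
      using Y.frame_chart_image[OF L'] by (simp add: Y.Fr_simps Y.topspace_Fr_top)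
    have hom: "homeomorphic_map (top_of_set ?W) (ctop (Fr G X)) ?r"
      using is_cchartD(7)[OF Cx_manifoldD(1)[OF X.Cx_manifold_Fr rX]] by (simp add: imX)
    have cs: "continuous_map (top_of_set ?W') (ctop (Fr G Y)) ?s"
      by (rule is_cchartD(4)[OF Cx_manifoldD(1)[OF Y.Cx_manifold_Fr sY]])
    \<comment> \<open>Continuity for the compact-open topologies is read off the matrix, since both
      global charts are homeomorphisms.\<close>
    have "continuous_on ?W A"
      by (rule continuous_on_matrix[where n = ?n and a = a]) (use A(3) WC in blast)
    then have "continuous_map (top_of_set ?W) (top_of_set ?W') A"
      using fr(2) by (simp add: continuous_map_in_subtopology Pi_iff)
    from continuous_map_compose[OF this cs]
    have "continuous_map (top_of_set ?W) (ctop (Fr G Y)) (?f \<circ> ?r)"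
      by (rule continuous_map_eq) (simp add: fr(1))
    then show "continuous_map (ctop (Fr G X)) (ctop (Fr G Y)) ?f"
      by (rule continuous_map_from_global_chart[OF hom])
    show "?f (cact (Fr G X) c \<gamma>) = cact (Fr G Y) c (?f \<gamma>)" if "\<gamma> \<in> topspace (ctop (Fr G X))" "c \<noteq> 0" for c \<gamma>
      using that X.Fr_set_scale[of \<gamma> c]
      by (simp add: X.Fr_simps Y.Fr_simps X.topspace_Fr_top Fr_map_def) (simp add: Hom_C_scale_def comp_def)
    have "holo_on ?n ?m ?W (the_inv_into ?W' ?s \<circ> ?F \<circ> ?r)"
    proof (rule frame_chart_transition[where F = ?F, OF X.orb_object_axioms Y.orb_object_axioms L L' A])
      show "?F \<gamma> \<in> Fr_set G Y" if "\<gamma> \<in> Fr_set G X" for \<gamma>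
        using Fr_map_Fr_set[OF that] that by (simp add: Fr_map_def)
    qed
    then have "holo_on ?n ?m ?W (the_inv_into ?W' ?s \<circ> ?f \<circ> ?r)"
    proof (rule holo_on_cong[OF WC, rotated])
      fix x assume "x \<in> ?W"
      then have "?r x \<in> Fr_set G X" by (auto simp: frame_chart_def)
      then show "(the_inv_into ?W' ?s \<circ> ?F \<circ> ?r) x = (the_inv_into ?W' ?s \<circ> ?f \<circ> ?r) x"
        by (simp only: comp_apply Fr_map_def restrict_apply if_True)
    qed
    then show "holo_on (cdim (Fr G X)) (cdim (Fr G Y)) ?W (the_inv_into ?W' ?s \<circ> ?f \<circ> ?r)"
      by (simp add: X.Fr_simps Y.Fr_simps)
  qed
qed

end

theorem lemma3p20:
  fixes G :: "'g monoid" and GM :: "('g, 'e::real_normed_vector) smfd"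
  assumes "compact_lie_group G GM"
  shows "is_functor (Orb_ab G GM :: (('p, 'b, 'g, 'e) orb_obj, ('p, 'b, 'g, 'e) orb_mor) cat)
           (CxMfd :: ('p chom cmfd, 'p chom \<Rightarrow> 'p chom) cat) (Fr G) (Fr_map G)"
proof -
  let ?C = "Orb_ab G GM :: (('p, 'b, 'g, 'e) orb_obj, ('p, 'b, 'g, 'e) orb_mor) cat"
  have C: "Obj ?C = Orb_ab_obj G GM" "Hom ?C = Orb_ab_hom G GM" by (simp_all add: Orb_ab_def)
  have obj: "orb_object G GM X" if "X \<in> Obj ?C" for X
    using that assms by (simp add: C orb_object_def)
  have mor: "\<exists>g. orb_morphism G GM X Y \<phi> g" if "X \<in> Obj ?C" "Y \<in> Obj ?C" "\<phi> \<in> Hom ?C X Y" for X Y \<phi>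
    using orb_morphism_exists[OF assms] that unfolding C by metis
  \<comment> \<open>The laws for \<open>ind_hom\<close> hold only on \<open>T\<close>; through this
    inclusion they apply at every value of a frame.\<close>
  have frameT: "\<gamma> z \<in> snd X" if "\<gamma> \<in> Fr_set G X" for \<gamma> z and X :: "('p, 'b, 'g, 'e) orb_obj"
    using that by (auto simp: Fr_set_def)
  have top: "topspace (ctop (Fr G X)) = Fr_set G X" if "X \<in> Obj ?C" for X
    using orb_object.topspace_Fr_top[OF obj[OF that]] orb_object.Fr_simps(1)[OF obj[OF that]] by simp
  show ?thesis
    unfolding is_functor_def
  proof (intro conjI ballI)
    show "is_category ?C" by (rule is_category_Orb_ab[OF assms])
    show "is_category (CxMfd :: ('p chom cmfd, 'p chom \<Rightarrow> 'p chom) cat)" by (rule is_category_CxMfd)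
  next
    fix X assume "X \<in> Obj ?C"
    then show "Fr G X \<in> Obj CxMfd"
      using orb_object.Cx_manifold_Fr[OF obj] by (simp add: CxMfd_def)
  next
    fix X Y \<phi> assume X: "X \<in> Obj ?C" and Y: "Y \<in> Obj ?C" and \<phi>: "\<phi> \<in> Hom ?C X Y"
    obtain g where "orb_morphism G GM X Y \<phi> g" using mor[OF X Y \<phi>] by blast
    from orb_morphism.Cx_holo_map_Fr_map[OF this]
    show "Fr_map G X Y \<phi> \<in> Hom CxMfd (Fr G X) (Fr G Y)"
      by (simp add: CxMfd_def top[OF X] Fr_map_def)
  next
    fix X assume X: "X \<in> Obj ?C"
    have "ind_hom X X (Id ?C X) \<circ> \<gamma> = \<gamma>" if "\<gamma> \<in> Fr_set G X" for \<gamma>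
    proof
      fix z
      show "(ind_hom X X (Id ?C X) \<circ> \<gamma>) z = \<gamma> z"
        using ind_hom_Id[OF assms _ frameT[OF that]] X by (simp add: C)
    qed
    then show "Fr_map G X X (Id ?C X) = Id CxMfd (Fr G X)"
      unfolding CxMfd_def cat.simps top[OF X] Fr_map_def by (intro restrict_ext)
  next
    fix X Y Z \<phi> \<psi>
    assume X: "X \<in> Obj ?C" and Y: "Y \<in> Obj ?C" and Z: "Z \<in> Obj ?C"
      and \<phi>: "\<phi> \<in> Hom ?C X Y" and \<psi>: "\<psi> \<in> Hom ?C Y Z"
    obtain g g' where g: "orb_morphism G GM X Y \<phi> g" "orb_morphism G GM Y Z \<psi> g'"
      using mor[OF X Y \<phi>] mor[OF Y Z \<psi>] by blast
    have "(ind_hom X Z (Comp ?C X Y Z \<psi> \<phi>) \<circ> \<gamma>) = Fr_map G Y Z \<psi> (Fr_map G X Y \<phi> \<gamma>)"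
      if \<gamma>: "\<gamma> \<in> Fr_set G X" for \<gamma>
    proof
      fix z
      show "(ind_hom X Z (Comp ?C X Y Z \<psi> \<phi>) \<circ> \<gamma>) z = Fr_map G Y Z \<psi> (Fr_map G X Y \<phi> \<gamma>) z"
        using ind_hom_Comp[OF g frameT[OF \<gamma>]] orb_morphism.Fr_map_Fr_set[OF g(1) \<gamma>] \<gamma>
        by (simp add: Fr_map_def)
    qed
    then show "Fr_map G X Z (Comp ?C X Y Z \<psi> \<phi>) =
        Comp CxMfd (Fr G X) (Fr G Y) (Fr G Z) (Fr_map G Y Z \<psi>) (Fr_map G X Y \<phi>)"
      unfolding CxMfd_def cat.simps top[OF X] compose_def
      by (subst Fr_map_def) (rule restrict_ext)
  qed
qed

end
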